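(* Let $p$ be a prime, let $n\ge2$ be an integer, let $(X,\le)$ be a finite nonempty totally ordered set, and let $S$ be the free profinite group on the basis $X$. Order the set $\mathrm{Lyn}_{\le n}(X)$ of Lyndon words of length $\le n$ in the alphabet $X$ as follows: first order the permutation classes according to the length-lexicographic order of their lexicographically least elements; within each permutation class, use the lexicographic order. Then, under this order, the matrix $$\bigl[(\sigma_{w,n},\alpha_{w',n})_n\bigr]_{w,w'\in\mathrm{Lyn}_{\le n}(X)}$$ over $\mathbb{F}_p$ (rows indexed by $w$, columns by $w'$) is block diagonal, with one diagonal block for each permutation class, and each diagonal block is unipotent upper triangular. Here $(\cdot,\cdot)_n$ is the transgression pairing, and $\sigma_{w,n}$, $\alpha_{w',n}$ are the elements defined in the context.
   Context: Lower $p$-central filtration. For a profinite group $G$: $G^{(1,p)}=G$ and $G^{(n+1,p)}=(G^{(n,p)})^p[G,G^{(n,p)}]$, i.e. the closed subgroup generated by all $\tau^p$ and $[\sigma,\tau]=\sigma^{-1}\tau^{-1}\sigma\tau$ with $\sigma\in G$, $\tau\in G^{(n,p)}$. Words. $X^*$ is the free monoid on $X$ (words under concatenation), and $|w|$ is the length of $w$. A nonempty word is Lyndon if it is strictly smaller, in the lexicographic order induced by $\le$, than all its proper (nonempty) suffixes. If $w$ is Lyndon with $|w|\ge2$, its standard factorization is $w=uv$ where $v$ is the longest proper suffix of $w$ which is Lyndon; then $u$ is also Lyndon. Two words are permutations of one another if each letter occurs in both the same number of times; the permutation classes here are the classes of this equivalence relation on $\mathrm{Lyn}_{\le n}(X)$.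 The length-lexicographic order: $w\preceq v$ iff $|w|<|v|$, or $|w|=|v|$ and $w\le v$ lexicographically. Elements $\sigma_{w,n}$. For a Lyndon word $w$ define $\tau_w\in S$ recursively: $\tau_{(x)}=x$ for $x\in X$, and $\tau_w=[\tau_u,\tau_v]=\tau_u^{-1}\tau_v^{-1}\tau_u\tau_v$ if $|w|\ge 2$ has standard factorization $w=uv$. For $|w|=s\le n$ put $\sigma_{w,n}=\tau_w^{p^{n-s}}$; it lies in $S^{(n,p)}$. Magnus coefficients. For a profinite commutative unital ring $R$, $R\langle\langle X\rangle\rangle$ is the algebra of formal power series in the non-commuting variables $X$ over $R$ (words are viewed as monomials), and $\mathrm{Mag}_R\colon S\to R\langle\langle X\rangle\rangle^{\times}$ is the continuous homomorphism with $\mathrm{Mag}_R(x)=1+x$ for $x\in X$. Write $\epsilon_{w,R}(\sigma)$ for the coefficient of the word $w$ in $\mathrm{Mag}_R(\sigma)$. Elements $\alpha_{w,n}$. Let $w=(a_1\cdots a_s)$ be a word with $1\le s\le n$ and let $R=\mathbb{Z}/p^{n-s+1}$. Let $\mathbb{U}_s(R)$ be the group of unipotent upper triangular $(s+1)\times(s+1)$ matrices over $R$. The map $\rho_w\colon S\to\mathbb{U}_s(R)$, $\sigma\mapsto[\epsilon_{(a_i\cdots a_{j-1}),R}(\sigma)]_{1\le i\le j\le s+1}$, is a continuous homomorphism. The subgroup $\mathbb{U}_s(R)^{(n,p)}$ is central and consists of all matrices $I+ap^{n-s}E_{1,s+1}$, $a\in\mathbb{Z}$; identify it with $\mathbb{F}_p$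 via $I+ap^{n-s}E_{1,s+1}\leftrightarrow a \bmod p$. Put $\overline{\mathbb{U}}_s(R)=\mathbb{U}_s(R)/\mathbb{U}_s(R)^{(n,p)}$ and let $\omega_{s,n}\in H^2(\overline{\mathbb{U}}_s(R),\mathbb{F}_p)$ be the class of the central extension $0\to\mathbb{F}_p\to\mathbb{U}_s(R)\to\overline{\mathbb{U}}_s(R)\to1$ (represented, for a set-theoretic section $\theta$, by the cocycle $(g,h)\mapsto \theta(g)\theta(h)\theta(gh)^{-1}$). The map $\rho_w$ induces $\bar\rho_w\colon S/S^{(n,p)}\to\overline{\mathbb{U}}_s(R)$, and $\alpha_{w,n}=\bar\rho_w^{\,*}\omega_{s,n}\in H^2(S/S^{(n,p)},\mathbb{F}_p)$. Transgression pairing. For $n\ge2$ the transgression map $\mathrm{trg}\colon H^1(S^{(n,p)},\mathbb{F}_p)^S\to H^2(S/S^{(n,p)},\mathbb{F}_p)$ in the five-term exact sequence of $S^{(n,p)}\trianglelefteq S$ (trivial coefficients) is an isomorphism. Convention: $\mathrm{trg}(\psi)$ is the class of the cocycle on $S/S^{(n,p)}$ induced by the coboundary $(g,h)\mapsto y(h)-y(gh)+y(g)$, for a suitable continuous map $y\colon S\to\mathbb{F}_p$ extending $\psi$ for which this coboundary depends only on cosets modulo $S^{(n,p)}$. Define $(\sigma,\alpha)_n=-(\mathrm{trg}^{-1}(\alpha))(\sigma)$ for $\sigma\in S^{(n,p)}$ and $\alpha\in H^2(S/S^{(n,p)},\mathbb{F}_p)$. *)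

theory Defs
  imports
    "HOL-Analysis.Analysis"
    "HOL-Algebra.Generated_Groups"
    "HOL-Number_Theory.Residues"
    "HOL-Library.List_Lexorder"
    "HOL-Library.Multiset"
    "HOL-Library.Sublist"
    "Jordan_Normal_Form.Matrix"
begin

section \<open>Profinite groups\<close>

locale topological_group = group G for G (structure) and T +
  assumes topspace_eq: "topspace T = carrier G"
    and continuous_mult: "continuous_map (prod_topology T T) T (\<lambda>(x, y). x \<otimes> y)"
    and continuous_inv: "continuous_map T T (\<lambda>x. inv x)"

locale profinite_group = topological_group +
  assumes compact: "compact_space T"
    and Hausdorff: "Hausdorff_space T"
    and totally_disconnected: "connectedin T C \<Longrightarrow> x \<in> C \<Longrightarrow> y \<in> C \<Longrightarrow> x = y"

definition closed_generate :: "('g, 'm) monoid_scheme \<Rightarrow> 'g topology \<Rightarrow> 'g set \<Rightarrow> 'g set" where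
  "closed_generate G T A = T closure_of (generate G A)"

text \<open>
  The free profinite group on a finite basis \<open>\<iota> :: 'x \<Rightarrow> 'g\<close>: the basis generates it topologically,
  and every map from the basis to a profinite group extends to a continuous homomorphism (which is
  unique, by the first condition). HOL does not allow a quantification over types here, so the test
  groups are those with carrier in the type \<open>nat set\<close>. This is no restriction: one may replace a
  test group by its closed subgroup generated by the finite image of the basis, and
  a finitely generated profinite group has at most continuum many elements.
\<close>

definition free_profinite_group ::
    "('g, 'm) monoid_scheme \<Rightarrow> 'g topology \<Rightarrow> ('x::finite \<Rightarrow> 'g) \<Rightarrow> bool" where
  "free_profinite_group S T \<iota> \<longleftrightarrow>
     profinite_group S T \<and> range \<iota> \<subseteq> carrier S \<and>
     closed_generate S T (range \<iota>) = carrier S \<and>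
     (\<forall>(H :: nat set monoid) TH f. profinite_group H TH \<and> range f \<subseteq> carrier H \<longrightarrow>
        (\<exists>\<phi> \<in> hom S H. continuous_map T TH \<phi> \<and> (\<forall>x. \<phi> (\<iota> x) = f x)))"

definition commutator :: "('g, 'm) monoid_scheme \<Rightarrow> 'g \<Rightarrow> 'g \<Rightarrow> 'g" where
  "commutator G s t = inv\<^bsub>G\<^esub> s \<otimes>\<^bsub>G\<^esub> inv\<^bsub>G\<^esub> t \<otimes>\<^bsub>G\<^esub> s \<otimes>\<^bsub>G\<^esub> t"

text \<open>The filtration is indexed from 1; the value at 0 is irrelevant.\<close>

fun lower_p_central ::
    "('g, 'm) monoid_scheme \<Rightarrow> 'g topology \<Rightarrow> nat \<Rightarrow> nat \<Rightarrow> 'g set" where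
  "lower_p_central G T p 0 = carrier G"
| "lower_p_central G T p (Suc 0) = carrier G"
| "lower_p_central G T p (Suc (Suc n)) =
     closed_generate G T
       ({t [^]\<^bsub>G\<^esub> p | t. t \<in> lower_p_central G T p (Suc n)} \<union>
        {commutator G s t | s t. s \<in> carrier G \<and> t \<in> lower_p_central G T p (Suc n)})"

text \<open>The quotient topology on a partition \<open>Q\<close> of the space.\<close>

definition quotient_topology :: "'g topology \<Rightarrow> 'g set set \<Rightarrow> 'g set topology" where
  "quotient_topology T Q = topology (\<lambda>U. U \<subseteq> Q \<and> openin T (\<Union>U))"


section \<open>Cohomology with coefficients in the prime field\<close>

abbreviation Fp :: "nat \<Rightarrow> int ring" where
  "Fp p \<equiv> residue_ring (int p)"

abbreviation Fp_topology :: "nat \<Rightarrow> int topology" where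
  "Fp_topology p \<equiv> discrete_topology (carrier (Fp p))"

text \<open>Continuous inhomogeneous cochains, for the trivial action on the coefficients.\<close>

definition coboundary ::
    "('g, 'm) monoid_scheme \<Rightarrow> nat \<Rightarrow> ('g \<Rightarrow> int) \<Rightarrow> 'g \<times> 'g \<Rightarrow> int" where
  "coboundary G p y =
     (\<lambda>(g, h) \<in> carrier G \<times> carrier G. y h \<ominus>\<^bsub>Fp p\<^esub> y (g \<otimes>\<^bsub>G\<^esub> h) \<oplus>\<^bsub>Fp p\<^esub> y g)"

definition Z2 :: "('g, 'm) monoid_scheme \<Rightarrow> 'g topology \<Rightarrow> nat \<Rightarrow> ('g \<times> 'g \<Rightarrow> int) monoid" where
  "Z2 G T p =
     \<lparr>carrier =
        {z \<in> carrier G \<times> carrier G \<rightarrow>\<^sub>E carrier (Fp p).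
           continuous_map (prod_topology T T) (Fp_topology p) z \<and>
           (\<forall>g \<in> carrier G. \<forall>h \<in> carrier G. \<forall>k \<in> carrier G.
              z (h, k) \<oplus>\<^bsub>Fp p\<^esub> z (g, h \<otimes>\<^bsub>G\<^esub> k) = z (g \<otimes>\<^bsub>G\<^esub> h, k) \<oplus>\<^bsub>Fp p\<^esub> z (g, h))},
      monoid.mult = (\<lambda>z z'. \<lambda>u \<in> carrier G \<times> carrier G. z u \<oplus>\<^bsub>Fp p\<^esub> z' u),
      monoid.one = (\<lambda>u \<in> carrier G \<times> carrier G. \<zero>\<^bsub>Fp p\<^esub>)\<rparr>"

definition B2 :: "('g, 'm) monoid_scheme \<Rightarrow> 'g topology \<Rightarrow> nat \<Rightarrow> ('g \<times> 'g \<Rightarrow> int) set" where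
  "B2 G T p = {coboundary G p y | y. continuous_map T (Fp_topology p) y}"

definition H2 :: "('g, 'm) monoid_scheme \<Rightarrow> 'g topology \<Rightarrow> nat \<Rightarrow> ('g \<times> 'g \<Rightarrow> int) set monoid" where
  "H2 G T p = Z2 G T p Mod B2 G T p"

definition H2_class ::
    "('g, 'm) monoid_scheme \<Rightarrow> 'g topology \<Rightarrow> nat \<Rightarrow> ('g \<times> 'g \<Rightarrow> int) \<Rightarrow> ('g \<times> 'g \<Rightarrow> int) set" where
  "H2_class G T p z = B2 G T p #>\<^bsub>Z2 G T p\<^esub> z"

text \<open>
  Below, \<open>the_elem\<close> extracts the common value of a construction that is independent of the
  choice of representatives.
\<close>

definition H2_pullback ::
    "('g, 'm) monoid_scheme \<Rightarrow> 'g topology \<Rightarrow> nat \<Rightarrow> ('g \<Rightarrow> 'h) \<Rightarrow>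
     ('h \<times> 'h \<Rightarrow> int) set \<Rightarrow> ('g \<times> 'g \<Rightarrow> int) set" where
  "H2_pullback G T p \<phi> c =
     the_elem ((\<lambda>z. H2_class G T p (\<lambda>(g, h) \<in> carrier G \<times> carrier G. z (\<phi> g, \<phi> h))) ` c)"

text \<open>The \<open>S\<close>-invariant continuous homomorphisms from the normal subgroup \<open>N\<close> to the prime field.\<close>

definition H1_invariants ::
    "('g, 'm) monoid_scheme \<Rightarrow> 'g topology \<Rightarrow> 'g set \<Rightarrow> nat \<Rightarrow> ('g \<Rightarrow> int) set" where
  "H1_invariants S T N p =
     {\<psi> \<in> hom (S\<lparr>carrier := N\<rparr>) (add_monoid (Fp p)).
        \<psi> \<in> extensional N \<and>
        continuous_map (subtopology T N) (Fp_topology p) \<psi> \<and>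
        (\<forall>s \<in> carrier S. \<forall>v \<in> N. \<psi> (inv\<^bsub>S\<^esub> s \<otimes>\<^bsub>S\<^esub> v \<otimes>\<^bsub>S\<^esub> s) = \<psi> v)}"

definition transgression ::
    "('g, 'm) monoid_scheme \<Rightarrow> 'g topology \<Rightarrow> 'g set \<Rightarrow> nat \<Rightarrow> ('g \<Rightarrow> int) \<Rightarrow>
     ('g set \<times> 'g set \<Rightarrow> int) set" where
  "transgression S T N p \<psi> =
     (let Q = S Mod N; TQ = quotient_topology T (carrier Q) in
      the_elem {H2_class Q TQ p z | z y.
        z \<in> carrier (Z2 Q TQ p) \<and>
        continuous_map T (Fp_topology p) y \<and>
        (\<forall>v \<in> N. y v = \<psi> v) \<and>
        (\<forall>g \<in> carrier S. \<forall>h \<in> carrier S.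
           z (N #>\<^bsub>S\<^esub> g, N #>\<^bsub>S\<^esub> h) = coboundary S p y (g, h))})"

definition transgression_pairing ::
    "('g, 'm) monoid_scheme \<Rightarrow> 'g topology \<Rightarrow> nat \<Rightarrow> nat \<Rightarrow> 'g \<Rightarrow>
     ('g set \<times> 'g set \<Rightarrow> int) set \<Rightarrow> int" where
  "transgression_pairing S T p n \<sigma> \<alpha> =
     (let N = lower_p_central S T p n in
      \<ominus>\<^bsub>Fp p\<^esub> (the_inv_into (H1_invariants S T N p) (transgression S T N p) \<alpha>) \<sigma>)"


section \<open>Lyndon words\<close>

text \<open>Words are lists, with the lexicographic order (in which a proper prefix is smaller).\<close>

definition lyndon :: "'x::linorder list \<Rightarrow> bool" where
  "lyndon w \<longleftrightarrow> w \<noteq> [] \<and> (\<forall>v. strict_suffix v w \<and> v \<noteq> [] \<longrightarrow> w < v)"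

definition Lyn :: "nat \<Rightarrow> 'x::linorder list set" where
  "Lyn n = {w. lyndon w \<and> length w \<le> n}"

text \<open>
  The standard factorization of \<open>w\<close> is \<open>take k w @ drop k w\<close> with \<open>k = std_cut w\<close>: the longest
  proper Lyndon suffix is obtained by dropping as few letters as possible.
\<close>

definition std_cut :: "'x::linorder list \<Rightarrow> nat" where
  "std_cut w = (LEAST k. 0 < k \<and> k < length w \<and> lyndon (drop k w))"

lemma std_cut_bounds:
  assumes "length w \<ge> 2"
  shows "0 < std_cut w" "std_cut w < length w"
proof -
  have "drop (length w - 1) w = [last w]"
    using assms by (metis append_butlast_last_id append_eq_conv_conj length_butlast list.size(3)
        not_numeral_le_zero)
  moreover have "lyndon [last w]"
    by (auto simp: lyndon_def strict_suffix_def suffix_Cons)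
  ultimately have "0 < length w - 1 \<and> length w - 1 < length w \<and> lyndon (drop (length w - 1) w)"
    using assms by auto
  from LeastI[of "\<lambda>k. 0 < k \<and> k < length w \<and> lyndon (drop k w)", OF this]
  show "0 < std_cut w" "std_cut w < length w"
    by (auto simp: std_cut_def)
qed

definition perm_class :: "nat \<Rightarrow> 'x::linorder list \<Rightarrow> 'x list set" where
  "perm_class n w = {v \<in> Lyn n. mset v = mset w}"

definition length_lex_less :: "'x::linorder list \<Rightarrow> 'x list \<Rightarrow> bool" where
  "length_lex_less w v \<longleftrightarrow> length w < length v \<or> length w = length v \<and> w < v"

definition perm_class_less :: "'x::linorder list set \<Rightarrow> 'x list set \<Rightarrow> bool" where
  "perm_class_less C D \<longleftrightarrow> length_lex_less (Min C) (Min D)"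

definition Lyn_less :: "nat \<Rightarrow> 'x::linorder list \<Rightarrow> 'x list \<Rightarrow> bool" where
  "Lyn_less n w v \<longleftrightarrow>
     perm_class_less (perm_class n w) (perm_class n v) \<or>
     perm_class n w = perm_class n v \<and> w < v"


section \<open>The elements \<open>\<sigma>\<close>\<close>

function tau :: "('g, 'm) monoid_scheme \<Rightarrow> ('x::linorder \<Rightarrow> 'g) \<Rightarrow> 'x list \<Rightarrow> 'g" where
  "tau S \<iota> w =
     (if length w \<ge> 2
      then commutator S (tau S \<iota> (take (std_cut w) w)) (tau S \<iota> (drop (std_cut w) w))
      else \<iota> (hd w))"
  by pat_completeness auto
termination
proof (relation "Wellfounded.measure (\<lambda>(S, \<iota>, w). length w)", goal_cases)
  case 1
  show ?case by simp
next
  case (2 S \<iota> w)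
  then show ?case using std_cut_bounds[of w] by simp
next
  case (3 S \<iota> w)
  then show ?case using std_cut_bounds[of w] by simp
qed

declare tau.simps [simp del]

definition sigma ::
    "('g, 'm) monoid_scheme \<Rightarrow> ('x::linorder \<Rightarrow> 'g) \<Rightarrow> nat \<Rightarrow> nat \<Rightarrow> 'x list \<Rightarrow> 'g" where
  "sigma S \<iota> p n w = tau S \<iota> w [^]\<^bsub>S\<^esub> (p ^ (n - length w))"


section \<open>Magnus coefficients\<close>

text \<open>Formal power series in non-commuting variables, as functions from words to coefficients.\<close>

definition nc_power_series :: "('r, 'm) ring_scheme \<Rightarrow> ('x list \<Rightarrow> 'r) ring" where
  "nc_power_series R =
     \<lparr>carrier = UNIV \<rightarrow> carrier R,
      monoid.mult = (\<lambda>f g w. \<Oplus>\<^bsub>R\<^esub>k \<in> {0..length w}. f (take k w) \<otimes>\<^bsub>R\<^esub> g (drop k w)),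
      monoid.one = (\<lambda>w. if w = [] then \<one>\<^bsub>R\<^esub> else \<zero>\<^bsub>R\<^esub>),
      ring.zero = (\<lambda>w. \<zero>\<^bsub>R\<^esub>),
      ring.add = (\<lambda>f g w. f w \<oplus>\<^bsub>R\<^esub> g w)\<rparr>"

definition nc_var :: "('r, 'm) ring_scheme \<Rightarrow> 'x \<Rightarrow> 'x list \<Rightarrow> 'r" where
  "nc_var R x = (\<lambda>w. if w = [x] then \<one>\<^bsub>R\<^esub> else \<zero>\<^bsub>R\<^esub>)"

text \<open>
  The Magnus homomorphism over a finite ring \<open>R\<close>, considered with the discrete topology. The
  extensionality condition only fixes the values outside the carrier of \<open>S\<close>.
\<close>

definition magnus ::
    "('g, 'k) monoid_scheme \<Rightarrow> 'g topology \<Rightarrow> ('x \<Rightarrow> 'g) \<Rightarrow> ('r, 'm) ring_scheme \<Rightarrow>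
     'g \<Rightarrow> 'x list \<Rightarrow> 'r" where
  "magnus S T \<iota> R =
     (THE f. f \<in> hom S (units_of (nc_power_series R)) \<and> f \<in> extensional (carrier S) \<and>
        continuous_map T (product_topology (\<lambda>_. discrete_topology (carrier R)) UNIV) f \<and>
        (\<forall>x. f (\<iota> x) = \<one>\<^bsub>nc_power_series R\<^esub> \<oplus>\<^bsub>nc_power_series R\<^esub> nc_var R x))"

definition magnus_coeff ::
    "('g, 'k) monoid_scheme \<Rightarrow> 'g topology \<Rightarrow> ('x \<Rightarrow> 'g) \<Rightarrow> ('r, 'm) ring_scheme \<Rightarrow>
     'x list \<Rightarrow> 'g \<Rightarrow> 'r" where
  "magnus_coeff S T \<iota> R w \<sigma> = magnus S T \<iota> R \<sigma> w"


section \<open>Unipotent matrices and the classes \<open>\<alpha>\<close>\<close>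

text \<open>Matrices of size \<open>s + 1\<close> are functions on pairs of indices from \<open>1\<close> to \<open>s + 1\<close>.\<close>

abbreviation mat_indices :: "nat \<Rightarrow> (nat \<times> nat) set" where
  "mat_indices s \<equiv> {1..s+1} \<times> {1..s+1}"

definition unip :: "('r, 'm) ring_scheme \<Rightarrow> nat \<Rightarrow> (nat \<times> nat \<Rightarrow> 'r) monoid" where
  "unip R s =
     \<lparr>carrier = {A \<in> mat_indices s \<rightarrow>\<^sub>E carrier R.
        (\<forall>i \<in> {1..s+1}. A (i, i) = \<one>\<^bsub>R\<^esub>) \<and>
        (\<forall>i \<in> {1..s+1}. \<forall>j \<in> {1..s+1}. j < i \<longrightarrow> A (i, j) = \<zero>\<^bsub>R\<^esub>)},
      monoid.mult = (\<lambda>A B. \<lambda>(i, j) \<in> mat_indices s.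
        \<Oplus>\<^bsub>R\<^esub>k \<in> {1..s+1}. A (i, k) \<otimes>\<^bsub>R\<^esub> B (k, j)),
      monoid.one = (\<lambda>(i, j) \<in> mat_indices s. if i = j then \<one>\<^bsub>R\<^esub> else \<zero>\<^bsub>R\<^esub>)\<rparr>"

definition magnus_rep ::
    "('g, 'k) monoid_scheme \<Rightarrow> 'g topology \<Rightarrow> ('x \<Rightarrow> 'g) \<Rightarrow> ('r, 'm) ring_scheme \<Rightarrow>
     'x list \<Rightarrow> 'g \<Rightarrow> nat \<times> nat \<Rightarrow> 'r" where
  "magnus_rep S T \<iota> R w \<sigma> =
     (\<lambda>(i, j) \<in> mat_indices (length w).
        if i \<le> j then magnus_coeff S T \<iota> R (take (j - i) (drop (i - 1) w)) \<sigma> else \<zero>\<^bsub>R\<^esub>)"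

abbreviation Zpk :: "nat \<Rightarrow> nat \<Rightarrow> nat \<Rightarrow> int ring" where
  "Zpk p n s \<equiv> residue_ring (int p ^ (n - s + 1))"

definition unip_filtration :: "nat \<Rightarrow> nat \<Rightarrow> nat \<Rightarrow> (nat \<times> nat \<Rightarrow> int) set" where
  "unip_filtration p n s =
     lower_p_central (unip (Zpk p n s) s) (discrete_topology (carrier (unip (Zpk p n s) s))) p n"

definition unip_bar :: "nat \<Rightarrow> nat \<Rightarrow> nat \<Rightarrow> (nat \<times> nat \<Rightarrow> int) set monoid" where
  "unip_bar p n s = unip (Zpk p n s) s Mod unip_filtration p n s"

text \<open>The matrix \<open>I + a p ^ (n - s) E\<close>, where \<open>E\<close> is the matrix unit at \<open>(1, s+1)\<close>.\<close>

definition corner_mat :: "nat \<Rightarrow> nat \<Rightarrow> nat \<Rightarrow> int \<Rightarrow> nat \<times> nat \<Rightarrow> int" where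
  "corner_mat p n s a =
     (\<lambda>(i, j) \<in> mat_indices s.
        if i = j then 1
        else if i = 1 \<and> j = s + 1 then a * int p ^ (n - s) mod int p ^ (n - s + 1)
        else 0)"

text \<open>The class of the central extension of \<open>unip_bar p n s\<close> by the prime field; the kernel
  \<open>unip_filtration p n s\<close> is identified with the prime field through \<open>corner_mat\<close>.\<close>

definition omega ::
    "nat \<Rightarrow> nat \<Rightarrow> nat \<Rightarrow> ((nat \<times> nat \<Rightarrow> int) set \<times> (nat \<times> nat \<Rightarrow> int) set \<Rightarrow> int) set" where
  "omega p n s =
     (let U = unip (Zpk p n s) s; Q = unip_bar p n s;
          identify = the_inv_into (carrier (Fp p)) (corner_mat p n s) in
      the_elem {H2_class Q (discrete_topology (carrier Q)) p
          (\<lambda>(g, h) \<in> carrier Q \<times> carrier Q.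
             identify (\<theta> g \<otimes>\<^bsub>U\<^esub> \<theta> h \<otimes>\<^bsub>U\<^esub> inv\<^bsub>U\<^esub> \<theta> (g \<otimes>\<^bsub>Q\<^esub> h)))
        | \<theta>. \<forall>C \<in> carrier Q. \<theta> C \<in> C})"

definition magnus_rep_bar ::
    "('g, 'k) monoid_scheme \<Rightarrow> 'g topology \<Rightarrow> ('x \<Rightarrow> 'g) \<Rightarrow> nat \<Rightarrow> nat \<Rightarrow> 'x list \<Rightarrow>
     'g set \<Rightarrow> (nat \<times> nat \<Rightarrow> int) set" where
  "magnus_rep_bar S T \<iota> p n w C =
     (let s = length w; R = Zpk p n s in
      the_elem ((\<lambda>\<sigma>. unip_filtration p n s #>\<^bsub>unip R s\<^esub> magnus_rep S T \<iota> R w \<sigma>) ` C))"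

definition alpha ::
    "('g, 'k) monoid_scheme \<Rightarrow> 'g topology \<Rightarrow> ('x \<Rightarrow> 'g) \<Rightarrow> nat \<Rightarrow> nat \<Rightarrow> 'x list \<Rightarrow>
     ('g set \<times> 'g set \<Rightarrow> int) set" where
  "alpha S T \<iota> p n w =
     (let Q = S Mod lower_p_central S T p n in
      H2_pullback Q (quotient_topology T (carrier Q)) p
        (magnus_rep_bar S T \<iota> p n w) (omega p n (length w)))"


section \<open>The matrix of the transgression pairing\<close>

text \<open>
  The matrix with rows and columns indexed by a list of words. Its entries are elements of
  \<open>carrier (Fp p)\<close>, that is, the integers \<open>0, \<dots>, p - 1\<close>.
\<close>

definition pairing_mat ::
    "('g, 'k) monoid_scheme \<Rightarrow> 'g topology \<Rightarrow> ('x::linorder \<Rightarrow> 'g) \<Rightarrow> nat \<Rightarrow> nat \<Rightarrow>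
     'x list list \<Rightarrow> int mat" where
  "pairing_mat S T \<iota> p n ws =
     mat (length ws) (length ws) (\<lambda>(i, j).
       transgression_pairing S T p n (sigma S \<iota> p n (ws ! i)) (alpha S T \<iota> p n (ws ! j)))"

definition unipotent_upper_triangular :: "int mat \<Rightarrow> bool" where
  "unipotent_upper_triangular A \<longleftrightarrow>
     square_mat A \<and> upper_triangular A \<and> (\<forall>i < dim_row A. A $$ (i, i) = 1)"

end

theory Submission
  imports Defs
begin

text \<open>
  The homomorphism \<open>\<rho>\<^sub>z\<close> maps \<open>N = S\<^bsup>(n,p)\<^esup>\<close> into the central corner subgroup, and writing \<open>\<rho>\<^sub>z\<close> as its
  corner coordinate times a section shows that \<open>\<alpha>\<^sub>z\<close> is the transgression of minus the restriction
  of \<open>\<rho>\<^sub>z\<close> to \<open>N\<close>. The transgression is injective because homomorphisms from \<open>S\<close> to the prime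
  field vanish on \<open>N\<close>; it is everywhere defined because \<open>N\<close> is open, so that cosets of \<open>N\<close> have
  a continuous section. Hence the entry at \<open>(w, z)\<close> is the coefficient of \<open>z\<close> in the Magnus
  expansion of \<open>\<sigma>\<^sub>w\<close>, divided by \<open>p ^ (n - |z|)\<close> and reduced modulo \<open>p\<close>. Along the standard
  factorization one sees that the expansion of \<open>\<tau>\<^sub>w\<close> over the integers is \<open>1 + w\<close> plus
  lexicographically larger rearrangements of \<open>w\<close> plus longer words. Modulo \<open>p ^ (n - |z| + 1)\<close>,
  the coefficient of the Lyndon word \<open>z\<close> in the power \<open>\<sigma>\<^sub>w\<close> is \<open>p ^ (n - |w|)\<close> times that
  in \<open>\<tau>\<^sub>w\<close> if \<open>|z| = |w|\<close>, and \<open>0\<close> otherwise.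
\<close>


section \<open>Integral power series in non-commuting variables\<close>

text \<open>The moduli p ^ (n - |z| + 1) change with the column z, so every series is expanded once
  over the integers and reduced afterwards. Series modulo m, their finite truncations and the
  unipotent matrices all inherit their group laws from integral series in this way. The guiding
  weight is p ^ (n - d) at words of length d: a p-th power gains a factor p where a commutator gains
  a degree, so both kinds of generators move one step down the filtration. Modulo p ^ (n - s + 1)
  this weight kills every entry strictly between the diagonal and the corner of a matrix of size s +
  1, which explains the modulus attached to words of length s. The estimate for powers needs a
  leading part of degree at least 2. Binomial coefficients spoil it for single letters, as p = 2 and
  2 choose 2 = 1 show, so these are treated apart. Much of the cohomological work consists in
  showing that the choices behind \<open>the_elem\<close> and \<open>the_inv_into\<close> are
  harmless: the section of the extension, the representative of the class and the cochain extending
  a homomorphism.\<close>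

datatype 'x ncps = NCPS (coeff: "'x list \<Rightarrow> int")

lemma ncps_eqI: "(\<And>w. coeff f w = coeff g w) \<Longrightarrow> f = g"
  by (cases f; cases g) auto

text \<open>The Cauchy product by recursion on the word, peeling letters off the left factor. In
  this form associativity is an induction that needs only linearity in the left factor, with no
  double sums over cuts.\<close>

fun conv :: "('x list \<Rightarrow> int) \<Rightarrow> ('x list \<Rightarrow> int) \<Rightarrow> 'x list \<Rightarrow> int" where
  "conv f g [] = f [] * g []"
| "conv f g (x # w) = f [] * g (x # w) + conv (\<lambda>v. f (x # v)) g w"

lemma conv_eq_sum: "conv f g w = (\<Sum>k = 0..length w. f (take k w) * g (drop k w))"
proof (induction w arbitrary: f)
  case (Cons x w)
  have "(\<Sum>k = 0..length (x # w). f (take k (x # w)) * g (drop k (x # w))) =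
      f [] * g (x # w) + (\<Sum>k = Suc 0..Suc (length w). f (take k (x # w)) * g (drop k (x # w)))"
    by (simp add: sum.atLeast_Suc_atMost)
  also have "(\<Sum>k = Suc 0..Suc (length w). f (take k (x # w)) * g (drop k (x # w))) =
      (\<Sum>k = 0..length w. f (x # take k w) * g (drop k w))"
    by (subst sum.shift_bounds_cl_Suc_ivl) simp
  finally show ?case by (simp add: Cons)
qed simp

lemma conv_add_left: "conv (\<lambda>v. f v + f' v) g w = conv f g w + conv f' g w"
  by (simp add: conv_eq_sum algebra_simps sum.distrib)

lemma conv_add_right: "conv f (\<lambda>v. g v + g' v) w = conv f g w + conv f g' w"
  by (simp add: conv_eq_sum algebra_simps sum.distrib)

lemma conv_scale_left: "conv (\<lambda>v. c * f v) g w = c * conv f g w"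
  by (simp add: conv_eq_sum algebra_simps sum_distrib_left)

lemma conv_assoc: "conv (conv f g) h w = conv f (conv g h) w"
  by (induction w arbitrary: f) (simp_all add: conv_add_left conv_scale_left algebra_simps)

lemma conv_one_left: "conv (\<lambda>v. if v = [] then 1 else 0) g w = g w"
  by (cases w) (simp_all add: conv_scale_left[of 0, simplified])

lemma conv_one_right: "conv f (\<lambda>v. if v = [] then 1 else 0) w = f w"
  by (induction w arbitrary: f) simp_all

instantiation ncps :: (type) ring_1
begin

definition "0 = NCPS (\<lambda>_. 0)"
definition "1 = NCPS (\<lambda>w. if w = [] then 1 else 0)"
definition "f + g = NCPS (\<lambda>w. coeff f w + coeff g w)"
definition "f - g = NCPS (\<lambda>w. coeff f w - coeff g w)"
definition "- f = NCPS (\<lambda>w. - coeff f w)"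
definition "f * g = NCPS (conv (coeff f) (coeff g))"

instance
proof
  fix f g h :: "'a ncps"
  show "f * g * h = f * (g * h)"
    by (auto simp: times_ncps_def conv_assoc)
  show "1 * f = f" "f * 1 = f"
    by (auto simp: times_ncps_def one_ncps_def conv_one_left conv_one_right intro: ncps_eqI)
  show "(f + g) * h = f * h + g * h" "f * (g + h) = f * g + f * h"
    by (auto simp: times_ncps_def plus_ncps_def conv_add_left conv_add_right intro: ncps_eqI)
  show "(0 :: 'a ncps) \<noteq> 1"
    by (auto simp: zero_ncps_def one_ncps_def fun_eq_iff)
qed (auto simp: plus_ncps_def minus_ncps_def uminus_ncps_def zero_ncps_def intro: ncps_eqI)

end

lemma coeff_0 [simp]: "coeff 0 w = 0"
  and coeff_1: "coeff 1 w = (if w = [] then 1 else 0)"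
  and coeff_add [simp]: "coeff (f + g) w = coeff f w + coeff g w"
  and coeff_diff [simp]: "coeff (f - g) w = coeff f w - coeff g w"
  and coeff_minus [simp]: "coeff (- f) w = - coeff f w"
  by (simp_all add: zero_ncps_def one_ncps_def plus_ncps_def minus_ncps_def uminus_ncps_def)

lemma coeff_mult: "coeff (f * g) w = (\<Sum>k = 0..length w. coeff f (take k w) * coeff g (drop k w))"
  by (simp add: times_ncps_def conv_eq_sum)

lemma coeff_mult_Nil [simp]: "coeff (f * g) [] = coeff f [] * coeff g []"
  by (simp add: times_ncps_def)

lemma coeff_of_nat_mult [simp]: "coeff (of_nat k * f) w = int k * coeff f w"
  by (induction k) (simp_all add: algebra_simps)

definition nvar :: "'x \<Rightarrow> 'x ncps" where
  "nvar x = NCPS (\<lambda>w. if w = [x] then 1 else 0)"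

lemma coeff_nvar: "coeff (nvar x) w = (if w = [x] then 1 else 0)"
  by (simp add: nvar_def)


text \<open>The weight 0 forces the coefficients of that degree to vanish, so orders and p-adic
  bounds are treated alike. The set is an ideal as soon as \<open>c (Suc d)\<close> divides
  \<open>c d\<close>.\<close>

definition dv_ideal :: "(nat \<Rightarrow> int) \<Rightarrow> 'x ncps set" where
  "dv_ideal c = {f. \<forall>w. c (length w) dvd coeff f w}"

lemma dv_idealD: "f \<in> dv_ideal c \<Longrightarrow> c (length w) dvd coeff f w"
  by (simp add: dv_ideal_def)

lemma dv_ideal_0 [simp]: "0 \<in> dv_ideal c"
  by (simp add: dv_ideal_def)

lemma dv_ideal_add: "f \<in> dv_ideal c \<Longrightarrow> g \<in> dv_ideal c \<Longrightarrow> f + g \<in> dv_ideal c"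
  by (simp add: dv_ideal_def)

lemma dv_ideal_diff: "f \<in> dv_ideal c \<Longrightarrow> g \<in> dv_ideal c \<Longrightarrow> f - g \<in> dv_ideal c"
  by (simp add: dv_ideal_def)

lemma dv_ideal_minus: "f \<in> dv_ideal c \<Longrightarrow> - f \<in> dv_ideal c"
  by (simp add: dv_ideal_def)

lemma dv_ideal_mult:
  assumes "f \<in> dv_ideal a" "g \<in> dv_ideal b" "\<And>i j. c (i + j) dvd a i * b j"
  shows "f * g \<in> dv_ideal c"
  unfolding dv_ideal_def
proof (intro CollectI allI)
  fix w
  show "c (length w) dvd coeff (f * g) w"
    unfolding coeff_mult
  proof (rule dvd_sum)
    fix k assume k: "k \<in> {0..length w}"
    have "c (k + (length w - k)) dvd a k * b (length w - k)" by (rule assms(3))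
    then have "c (length w) dvd a (length (take k w)) * b (length (drop k w))"
      using k by (auto simp: min_def)
    then show "c (length w) dvd coeff f (take k w) * coeff g (drop k w)"
      using dv_idealD[OF assms(1)] dv_idealD[OF assms(2)]
      by (meson dvd_trans mult_dvd_mono)
  qed
qed

lemma dv_ideal_UNIV [simp]: "f \<in> dv_ideal (\<lambda>_. 1)"
  by (simp add: dv_ideal_def)

lemma dv_ideal_antimono_dvd:
  assumes "\<And>d :: nat. (c (Suc d) :: int) dvd c d"
  shows "c (i + j) dvd c i"
  by (induction j) (use assms dvd_trans in auto)

lemma dv_ideal_mult_left:
  assumes "\<And>d. c (Suc d) dvd c d" "g \<in> dv_ideal c"
  shows "f * g \<in> dv_ideal c"
proof (rule dv_ideal_mult[OF dv_ideal_UNIV assms(2)])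
  show "c (i + j) dvd 1 * c j" for i j
    using dv_ideal_antimono_dvd[of c j i, OF assms(1)] by (simp add: add.commute)
qed

lemma dv_ideal_mult_right:
  assumes "\<And>d. c (Suc d) dvd c d" "f \<in> dv_ideal c"
  shows "f * g \<in> dv_ideal c"
  using dv_ideal_mult[OF assms(2) dv_ideal_UNIV, of c g] dv_ideal_antimono_dvd[of c, OF assms(1)]
  by simp

section \<open>Orders, inverses and powers of series\<close>

definition order_ge :: "nat \<Rightarrow> 'x ncps \<Rightarrow> bool" where
  "order_ge k f \<longleftrightarrow> (\<forall>w. length w < k \<longrightarrow> coeff f w = 0)"

lemma order_ge_0 [simp]: "order_ge 0 f"
  by (simp add: order_ge_def)

lemma order_ge_add: "order_ge k f \<Longrightarrow> order_ge k g \<Longrightarrow> order_ge k (f + g)"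
  by (simp add: order_ge_def)

lemma order_ge_mult: 
  assumes "order_ge k f" "order_ge l g" 
  shows "order_ge (k + l) (f * g)"
  unfolding order_ge_def
proof (intro allI impI)
  fix w :: "'a list" assume w: "length w < k + l"
  show "coeff (f * g) w = 0"
    unfolding coeff_mult
  proof (rule sum.neutral, rule ballI)
    fix i assume "i \<in> {0..length w}"
    then have "length (take i w) < k \<or> length (drop i w) < l" using w by auto
    then show "coeff f (take i w) * coeff g (drop i w) = 0"
      using assms by (auto simp: order_ge_def)
  qed
qed

lemma order_ge_mono: "order_ge k f \<Longrightarrow> l \<le> k \<Longrightarrow> order_ge l f"
  by (auto simp: order_ge_def)

lemma order_ge_power: "order_ge 1 f \<Longrightarrow> order_ge k (f ^ k)"
  by (induction k) (use order_ge_mult[of 1 f] in auto)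

text \<open>The geometric series of 1 - f. If f has constant coefficient 1, the k-th power starts in
  degree k, so cutting the sum at the length of w loses nothing.\<close>

definition ninv :: "'x ncps \<Rightarrow> 'x ncps" where
  "ninv f = NCPS (\<lambda>w. \<Sum>k\<le>length w. coeff ((1 - f) ^ k) w)"

lemma ninv_aux:
  assumes "order_ge 1 g"
  defines "h \<equiv> NCPS (\<lambda>w. \<Sum>k\<le>length w. coeff (g ^ k) w)"
  shows "h = 1 + g * h" "h = 1 + h * g"
proof -
  \<comment> \<open>Every longer partial sum has the same coefficient, so the identity for finite
    geometric sums can be used with N adapted to the word.\<close>
  have trunc: "coeff h w = coeff (\<Sum>k\<le>N. g ^ k) w" if "length w \<le> N" for w N
  proof -
    have "coeff (\<Sum>k\<le>N. g ^ k) w = (\<Sum>k\<le>N. coeff (g ^ k) w)" for N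
      by (induction N) auto
    also have "\<dots> N = (\<Sum>k\<le>length w. coeff (g ^ k) w)"
      using that order_ge_power[OF assms(1)]
      by (intro sum.mono_neutral_right) (auto simp: order_ge_def)
    finally show ?thesis by (simp add: h_def)
  qed
  have sub: "coeff (g * h) w = coeff (g * (\<Sum>k\<le>length w. g ^ k)) w" 
       "coeff (h * g) w = coeff ((\<Sum>k\<le>length w. g ^ k) * g) w" for w
    by (auto simp: coeff_mult intro!: sum.cong trunc arg_cong2[where f = "(*)"])
  have "1 + g * (\<Sum>k\<le>N. g ^ k) = (\<Sum>k\<le>Suc N. g ^ k)" for N
    by (simp add: sum.atMost_Suc_shift sum_distrib_left del: sum.atMost_Suc)
  moreover have "1 + (\<Sum>k\<le>N. g ^ k) * g = (\<Sum>k\<le>Suc N. g ^ k)" for N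
    by (simp add: sum.atMost_Suc_shift sum_distrib_right power_commutes del: sum.atMost_Suc)
  ultimately have "coeff h w = coeff (1 + g * h) w" "coeff h w = coeff (1 + h * g) w" for w
    using trunc[of w "Suc (length w)"] sub[of w]
    by (metis coeff_add le_SucI order_refl)+
  then show "h = 1 + g * h" "h = 1 + h * g" by (metis ncps_eqI)+
qed

lemma ninv_mult:
  assumes "coeff f [] = 1"
  shows "f * ninv f = 1" "ninv f * f = 1"
proof -
  have "order_ge 1 (1 - f)" using assms by (simp add: order_ge_def coeff_1)
  from ninv_aux[OF this] have "ninv f = 1 + (1 - f) * ninv f" "ninv f = 1 + ninv f * (1 - f)"
    unfolding ninv_def by blast+
  then show "f * ninv f = 1" "ninv f * f = 1" by (simp_all add: algebra_simps)
qed

lemma coeff_ninv_Nil [simp]: "coeff f [] = 1 \<Longrightarrow> coeff (ninv f) [] = 1"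
  by (metis coeff_1 coeff_mult_Nil ninv_mult(1) mult_1)

text \<open>Only the linear term is needed exactly; any multiple of g * g gains enough divisibility
  in both applications.\<close>

lemma one_plus_power:
  fixes g :: "'a::ring_1"
  shows "\<exists>h. (1 + g) ^ m = 1 + of_nat m * g + h * (g * g)"
proof (induction m)
  case (Suc m)
  then obtain h where h: "(1 + g) ^ m = 1 + of_nat m * g + h * (g * g)" by blast
  have "(1 + g) ^ Suc m = (1 + of_nat m * g + h * (g * g)) * (1 + g)"
    by (simp only: power_Suc2 h)
  also have "\<dots> = 1 + of_nat (Suc m) * g + (of_nat m + h + h * g) * (g * g)"
    by (simp add: algebra_simps mult_of_nat_commute)
  finally show ?case by blast
qed (rule exI[of _ 0], simp)

text \<open>
  As both factors of a nonzero term have degree at least \<open>2\<close>, products of two series in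
  \<open>dv_ideal (pcut q k)\<close> lie in \<open>dv_ideal (pcut q (k + 2))\<close>.
\<close>

definition pcut :: "int \<Rightarrow> nat \<Rightarrow> nat \<Rightarrow> int" where
  "pcut q k d = (if d < 2 then 0 else q ^ (k - d))"

lemma pcut_mult_left:
  assumes "g \<in> dv_ideal (pcut q k)"
  shows "f * g \<in> dv_ideal (pcut q k)"
proof (rule dv_ideal_mult[OF dv_ideal_UNIV assms])
  show "pcut q k (i + j) dvd 1 * pcut q k j" for i j
    by (auto simp: pcut_def le_imp_power_dvd)
qed

text \<open>A further q-th power turns 1 + g into 1 + q g plus a multiple of g * g: the factor q
  gains one step in the exponent, and in the square both factors have degree at least 2. When r + s
  = n, the exponent at degree d is n - d + 1, the one in the modulus attached to words of length
  d.\<close>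

lemma power_prime_power:
  assumes t: "order_ge s t" and s: "s \<ge> 2"
  shows "(1 + t) ^ (q ^ r) - 1 - of_nat (q ^ r) * t \<in> dv_ideal (pcut (int q) (r + s + 1))"
proof (induction r)
  case 0
  then show ?case by simp
next
  case (Suc r)
  define e where "e = (1 + t) ^ (q ^ r) - 1 - of_nat (q ^ r) * t"
  define g where "g = of_nat (q ^ r) * t + e"
  have f: "(1 + t) ^ (q ^ r) = 1 + g" by (simp add: g_def e_def)
  obtain h where h: "(1 + g) ^ q = 1 + of_nat q * g + h * (g * g)"
    using one_plus_power by blast
  have e: "e \<in> dv_ideal (pcut (int q) (r + s + 1))" using Suc by (simp add: e_def)
  \<comment> \<open>Below degree s the series t vanishes; from degree s on, q ^ (r + s - d) divides
    q ^ r.\<close>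
  have "of_nat (q ^ r) * t \<in> dv_ideal (pcut (int q) (r + s))"
    unfolding dv_ideal_def
  proof (intro CollectI allI)
    fix w show "pcut (int q) (r + s) (length w) dvd coeff (of_nat (q ^ r) * t) w"
    proof (cases "length w < s")
      case True
      then show ?thesis using t by (simp add: order_ge_def flip: of_nat_power)
    next
      case False
      then have "int q ^ (r + s - length w) dvd int q ^ r"
        by (intro le_imp_power_dvd) simp
      then show ?thesis using False s by (simp add: pcut_def flip: of_nat_power)
    qed
  qed
  moreover have "e \<in> dv_ideal (pcut (int q) (r + s))"
    using e unfolding dv_ideal_def
    by (auto simp: pcut_def elim!: dvd_trans[rotated] intro!: le_imp_power_dvd split: if_splits)
  ultimately have g: "g \<in> dv_ideal (pcut (int q) (r + s))"
    unfolding g_def by (rule dv_ideal_add)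
  have "g * g \<in> dv_ideal (pcut (int q) (Suc r + s + 1))"
  proof (rule dv_ideal_mult[OF g g])
    fix i j
    have "int q ^ (Suc r + s + 1 - (i + j)) dvd int q ^ (r + s - i) * int q ^ (r + s - j)"
      if "i \<ge> 2" "j \<ge> 2"
      unfolding power_add[symmetric] using that by (intro le_imp_power_dvd) auto
    then show "pcut (int q) (Suc r + s + 1) (i + j)
        dvd pcut (int q) (r + s) i * pcut (int q) (r + s) j"
      by (auto simp: pcut_def)
  qed
  then have 1: "h * (g * g) \<in> dv_ideal (pcut (int q) (Suc r + s + 1))"
    by (rule pcut_mult_left)
  have 2: "of_nat q * e \<in> dv_ideal (pcut (int q) (Suc r + s + 1))"
    unfolding dv_ideal_def
  proof (intro CollectI allI)
    fix w :: "'a list"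
    have "pcut (int q) (Suc r + s + 1) (length w) dvd int q * pcut (int q) (r + s + 1) (length w)"
      by (auto simp: pcut_def simp flip: power_Suc intro!: le_imp_power_dvd)
    also have "int q * pcut (int q) (r + s + 1) (length w) dvd int q * coeff e w"
      using dv_idealD[OF e, of w] by (rule mult_dvd_mono[OF dvd_refl])
    finally show "pcut (int q) (Suc r + s + 1) (length w) dvd coeff (of_nat q * e) w" by simp
  qed
  have "(1 + t) ^ (q ^ Suc r) = (1 + g) ^ q"
    by (simp only: f[symmetric] power_mult[symmetric] power_Suc2)
  also have "\<dots> = 1 + of_nat (q ^ Suc r) * t + of_nat q * e + h * (g * g)"
    unfolding h by (simp add: g_def algebra_simps)
  finally have "(1 + t) ^ (q ^ Suc r) - 1 - of_nat (q ^ Suc r) * t = of_nat q * e + h * (g * g)"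
    by simp
  then show ?case using dv_ideal_add[OF 2 1] by simp
qed

lemma coeff_power_prime_power:
  assumes "order_ge s t" "s \<ge> 2" "length w \<ge> 2"
  shows "[coeff ((1 + t) ^ (q ^ r)) w = int (q ^ r) * coeff t w] (mod int q ^ (r + s + 1 - length w))"
  using dv_idealD[OF power_prime_power[OF assms(1,2), of q r], of w] assms(3)
  by (auto simp: cong_iff_dvd_diff pcut_def coeff_1 simp del: of_nat_power
      simp flip: of_nat_power split: if_splits)

lemma coeff_nvar_power:
  "coeff (nvar x ^ k) w = (if w = replicate k x then 1 else 0)"
proof (induction k arbitrary: w)
  case (Suc k)
  have "coeff (nvar x ^ Suc k) w =
     (\<Sum>i = 0..length w. if take i w = [x] \<and> drop i w = replicate k x then 1 else 0)"
    unfolding power_Suc coeff_mult by (intro sum.cong) (auto simp: coeff_nvar Suc)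
  also have "\<dots> = (if w = replicate (Suc k) x then 1 else 0)"
  proof (cases "w = replicate (Suc k) x")
    case True
    have "take i w = [x] \<and> drop i w = replicate k x \<longleftrightarrow> i = 1" if "i \<le> length w" for i
      using that True by (cases i) auto
    then have "(\<Sum>i = 0..length w. if take i w = [x] \<and> drop i w = replicate k x then 1 else (0::int)) =
        (\<Sum>i = 0..length w. if i = 1 then 1 else 0)"
      by (intro sum.cong) auto
    then show ?thesis using True by simp
  next
    case False
    have "\<not> (take i w = [x] \<and> drop i w = replicate k x)" for i
      using False by (metis append_Cons append_Nil append_take_drop_id replicate_Suc)
    then have "(\<Sum>i = 0..length w. if take i w = [x] \<and> drop i w = replicate k x then 1 else 0) = (0::int)"
      by (intro sum.neutral) auto
    then show ?thesis using False by simp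
  qed
  finally show ?case .
qed (simp add: coeff_1)

text \<open>The binomial theorem in a single letter, for the case that escapes
  \<open>power_prime_power\<close>.\<close>

lemma coeff_one_plus_nvar_power:
  "coeff ((1 + nvar x) ^ m) w =
    (if w = replicate (length w) x then int (m choose (length w)) else 0)"
proof -
  have "(1 + nvar x) ^ m = (\<Sum>k\<le>m. of_nat (m choose k) * nvar x ^ k)"
  proof (induction m)
    case (Suc m)
    have "(1 + nvar x) ^ Suc m =
        (\<Sum>k\<le>m. of_nat (m choose k) * nvar x ^ k) + (\<Sum>k\<le>m. of_nat (m choose k) * nvar x ^ Suc k)"
      unfolding power_Suc2 Suc
      by (simp add: algebra_simps sum_distrib_right power_commutes)
    also have "(\<Sum>k\<le>m. of_nat (m choose k) * nvar x ^ k) =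
        (\<Sum>k\<le>Suc m. of_nat (m choose k) * nvar x ^ k)"
      by (simp add: binomial_eq_0)
    finally show ?case
      by (simp add: sum.atMost_Suc_shift algebra_simps sum.distrib del: sum.atMost_Suc)
  qed simp
  moreover have "coeff (\<Sum>k\<le>m. of_nat (m choose k) * nvar x ^ k) w =
      (\<Sum>k\<le>m. int (m choose k) * (if w = replicate k x then 1 else 0))"
  proof -
    have *: "coeff (\<Sum>k\<le>j. F k) w = (\<Sum>k\<le>j. coeff (F k) w)" for F and j :: nat
      by (induction j) auto
    show ?thesis unfolding * by (simp add: coeff_nvar_power)
  qed
  ultimately have *: "coeff ((1 + nvar x) ^ m) w =
     (\<Sum>k\<le>m. int (m choose k) * (if w = replicate k x then 1 else 0))" by simp
  show ?thesis
  proof (cases "w = replicate (length w) x \<and> length w \<le> m")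
    case True
    have "(\<Sum>k\<le>m. int (m choose k) * (if w = replicate k x then 1 else 0)) =
       (\<Sum>k\<in>{length w}. int (m choose k))"
      using True by (intro sum.mono_neutral_cong_right) auto
    then show ?thesis using True * by simp
  next
    case False
    then have "(\<Sum>k\<le>m. int (m choose k) * (if w = replicate k x then 1 else 0)) = 0"
      by (intro sum.neutral) auto
    then show ?thesis using False * by (auto simp: binomial_eq_0)
  qed
qed


section \<open>Lyndon words and their commutators\<close>

lemma append_less_append_iff [simp]: "xs @ ys < xs @ zs \<longleftrightarrow> ys < (zs :: 'x::linorder list)"
  by (induction xs) auto

lemma less_append_self: "ys \<noteq> [] \<Longrightarrow> xs < xs @ (ys :: 'x::linorder list)"
  by (induction xs) (auto simp: neq_Nil_conv)

text \<open>The first difference already occurs inside u, so the continuations do not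
  matter.\<close>

lemma append_less_append_of_not_prefix:
  "u < v \<Longrightarrow> \<not> prefix u v \<Longrightarrow> u @ x < v @ (y :: 'x::linorder list)"
proof (induction u arbitrary: v)
  case (Cons a u)
  then show ?case by (cases v) auto
qed simp

lemma append_less_append_same_length:
  "u < v \<Longrightarrow> length u = length v \<Longrightarrow> u @ x < v @ (y :: 'x::linorder list)"
  by (rule append_less_append_of_not_prefix)
    (auto simp: prefix_def)

lemma append_le_append:
  "u \<le> v \<Longrightarrow> x \<le> y \<Longrightarrow> length u = length v \<Longrightarrow> u @ x \<le> v @ (y :: 'x::linorder list)"
  using append_less_append_same_length[of u v x y] by (auto simp: le_less)

lemma lyndon_less_suffix:
  "lyndon (u @ v) \<Longrightarrow> u \<noteq> [] \<Longrightarrow> v \<noteq> [] \<Longrightarrow> u @ v < v"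
  by (auto simp: lyndon_def strict_suffix_def suffix_def)

lemma lyndon_single_letter: "lyndon w \<Longrightarrow> \<not> 2 \<le> length w \<Longrightarrow> \<exists>x. w = [x]"
  by (cases w rule: remdups_adj.cases) (auto simp: lyndon_def)

lemma lyndonI:
  assumes "w \<noteq> []" "\<And>u v. w = u @ v \<Longrightarrow> u \<noteq> [] \<Longrightarrow> v \<noteq> [] \<Longrightarrow> w < v"
  shows "lyndon w"
  using assms by (auto simp: lyndon_def strict_suffix_def suffix_def)

text \<open>A proper suffix of u v is either x v with x a proper suffix of u, or a suffix of v. In
  the first case u < x is decided before x ends, as u is longer than x; in the second it is enough
  that u v < v.\<close>

lemma lyndon_append:
  assumes u: "lyndon u" and v: "lyndon v" and uv: "u < v"
  shows "lyndon (u @ v)"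
proof (rule lyndonI)
  have [simp]: "u \<noteq> []" "v \<noteq> []" using u v by (auto simp: lyndon_def)
  then show "u @ v \<noteq> []" by simp
  have less: "u @ v < v"
  proof (cases "prefix u v")
    \<comment> \<open>With v = u z, the inequality u v < v reduces to v < z, which holds because v
      is Lyndon.\<close>
    case True
    then obtain z where z: "v = u @ z" by (auto simp: prefix_def)
    with uv have "z \<noteq> []" by auto
    with v z show ?thesis using lyndon_less_suffix[of u z] by simp
  next
    case False
    then show ?thesis using append_less_append_of_not_prefix[OF uv, of v "[]"] by simp
  qed
  fix a b assume ab: "u @ v = a @ b" "a \<noteq> []" "b \<noteq> []"
  show "u @ v < b"
  proof (cases "length a < length u")
    case True
    with ab obtain x where x: "u = a @ x" "b = x @ v" "x \<noteq> []"
      by (auto simp: append_eq_append_conv2)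
    have "u < x" using lyndon_less_suffix[of a x] u x ab by simp
    moreover have "\<not> prefix u x" using x ab by (auto dest: prefix_length_le)
    ultimately show ?thesis using append_less_append_of_not_prefix x(2) by blast
  next
    case False
    with ab obtain x where x: "v = x @ b" by (auto simp: append_eq_append_conv2)
    have "v \<le> b" using lyndon_less_suffix[of x b] v x ab by (cases "x = []") auto
    with less show ?thesis by simp
  qed
qed

lemma std_cut_lyndon_drop:
  assumes "length w \<ge> 2"
  shows "lyndon (drop (std_cut w) w)"
proof -
  have "drop (length w - 1) w = [last w]"
    using assms by (metis append_butlast_last_id append_eq_conv_conj length_butlast list.size(3)
        not_numeral_le_zero)
  moreover have "lyndon [last w]" by (auto simp: lyndon_def strict_suffix_def suffix_Cons)
  ultimately have "0 < length w - 1 \<and> length w - 1 < length w \<and> lyndon (drop (length w - 1) w)"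
    using assms by auto
  from LeastI[of "\<lambda>k. 0 < k \<and> k < length w \<and> lyndon (drop k w)", OF this]
  show ?thesis by (simp add: std_cut_def)
qed

lemma std_cut_le: "0 < k \<Longrightarrow> k < length w \<Longrightarrow> lyndon (drop k w) \<Longrightarrow> std_cut w \<le> k"
  unfolding std_cut_def by (rule Least_le) simp

text \<open>
  Otherwise the least suffix \<open>m\<close> of the left factor \<open>u\<close> is a proper Lyndon suffix, and by the
  choice of \<open>v\<close> the word \<open>m @ v\<close> is not Lyndon, whence \<open>v \<le> m \<le> u \<le> w < v\<close>.
\<close>

lemma std_cut_lyndon_take:
  assumes w: "lyndon w" and len: "length w \<ge> 2"
  shows "lyndon (take (std_cut w) w)"
proof (rule ccontr)
  define u v where "u = take (std_cut w) w" and "v = drop (std_cut w) w"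
  assume "\<not> lyndon (take (std_cut w) w)"
  then have nl: "\<not> lyndon u" by (simp add: u_def)
  have uv: "w = u @ v" by (simp add: u_def v_def)
  have ne: "u \<noteq> []" "v \<noteq> []" using std_cut_bounds[OF len] by (auto simp: u_def v_def)
  have v: "lyndon v" unfolding v_def by (rule std_cut_lyndon_drop[OF len])
  define A where "A = {x. suffix x u \<and> x \<noteq> []}"
  have "A \<subseteq> set (suffixes u)" by (auto simp: A_def)
  then have fin: "finite A" by (rule finite_subset) simp
  have uA: "u \<in> A" using ne by (simp add: A_def)
  define m where "m = Min A"
  have mA: "m \<in> A" and min: "\<And>x. x \<in> A \<Longrightarrow> m \<le> x"
    using Min_in[OF fin] Min_le[OF fin] uA by (auto simp: m_def)
  from mA obtain a where a: "u = a @ m" "m \<noteq> []" by (auto simp: A_def suffix_def)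
  have m: "lyndon m"
  proof (rule lyndonI)
    fix c d assume cd: "m = c @ d" "c \<noteq> []" "d \<noteq> []"
    then have "d \<in> A" using a by (auto simp: A_def suffix_def)
    then have "m \<le> d" by (rule min)
    moreover have "m \<noteq> d" using cd by auto
    ultimately show "m < d" by simp
  qed (use a in simp)
  have "a \<noteq> []" using a m nl by auto
  have "\<not> lyndon (m @ v)"
  proof
    assume l: "lyndon (m @ v)"
    have "m @ v = drop (length a) w" using uv a by simp
    then have "std_cut w \<le> length a"
      using l ne \<open>a \<noteq> []\<close> by (intro std_cut_le) (auto simp: uv a)
    moreover have "std_cut w = length u" using std_cut_bounds[OF len] by (simp add: u_def)
    ultimately show False using a by simp
  qed
  then have "v \<le> m" using lyndon_append[OF m v] by force
  also have "m \<le> u" using min[OF uA] .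
  also have "u < w" unfolding uv using ne by (intro less_append_self)
  finally show False using lyndon_less_suffix[of u v] w uv ne by simp
qed

text \<open>A group record, so that the generic \<open>commutator\<close> and \<open>tau\<close> can
  be evaluated on integral series and transported along homomorphisms.\<close>

definition ncps_units :: "'x ncps monoid" where
  "ncps_units = \<lparr>carrier = {f. coeff f [] = 1}, monoid.mult = (*), monoid.one = 1\<rparr>"

lemma ncps_units_simps [simp]:
  "f \<in> carrier ncps_units \<longleftrightarrow> coeff f [] = 1"
  "f \<otimes>\<^bsub>ncps_units\<^esub> g = f * g"
  "\<one>\<^bsub>ncps_units\<^esub> = 1"
  by (simp_all add: ncps_units_def)

lemma group_ncps_units: "group ncps_units"
proof (rule groupI)
  fix f :: "'a ncps" assume "f \<in> carrier ncps_units"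
  then show "\<exists>g\<in>carrier ncps_units. g \<otimes>\<^bsub>ncps_units\<^esub> f = \<one>\<^bsub>ncps_units\<^esub>"
    by (intro bexI[of _ "ninv f"]) (auto simp: ninv_mult)
qed (auto simp: mult.assoc coeff_1)

lemma inv_ncps_units: "coeff f [] = 1 \<Longrightarrow> inv\<^bsub>ncps_units\<^esub> f = ninv f"
  by (rule group.inv_equality[OF group_ncps_units]) (auto simp: ninv_mult)

lemma pow_ncps_units: "f [^]\<^bsub>ncps_units\<^esub> (k::nat) = f ^ k"
proof (induction k)
  case (Suc k)
  then show ?case 
    by (simp only: monoid.nat_pow_Suc[OF group.is_monoid[OF group_ncps_units]] power_Suc2 ncps_units_simps)
qed (simp only: monoid.nat_pow_0[OF group.is_monoid[OF group_ncps_units]] power_0 ncps_units_simps)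

text \<open>Since (1 + f) (1 + g) = (1 + g) (1 + f) + (f g - g f), multiplication by the inverse of
  (1 + g) (1 + f), which has the form 1 + q, exhibits the Lie bracket as the leading part.\<close>

lemma commutator_ncps_units:
  assumes "order_ge 1 f" "order_ge 1 g"
  shows "\<exists>q. order_ge 1 q \<and>
    commutator ncps_units (1 + f) (1 + g) = 1 + (1 + q) * (f * g - g * f)"
proof -
  have 1: "coeff (1 + f) [] = 1" "coeff (1 + g) [] = 1"
    using assms by (simp_all add: order_ge_def coeff_1)
  define i where "i = ninv (1 + f) * ninv (1 + g)"
  have "i * ((1 + g) * (1 + f)) = ninv (1 + f) * (ninv (1 + g) * (1 + g)) * (1 + f)"
    by (simp add: i_def mult.assoc)
  also have "\<dots> = 1" using 1 by (simp add: ninv_mult)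
  finally have i: "i * ((1 + g) * (1 + f)) = 1" .
  have "commutator ncps_units (1 + f) (1 + g) = i * ((1 + f) * (1 + g))"
    using 1 by (simp add: commutator_def inv_ncps_units i_def mult.assoc)
  also have "(1 + f) * (1 + g) = (1 + g) * (1 + f) + (f * g - g * f)"
    by (simp add: algebra_simps)
  also have "i * \<dots> = 1 + i * (f * g - g * f)" using i by (simp add: distrib_left)
  finally have "commutator ncps_units (1 + f) (1 + g) = 1 + (1 + (i - 1)) * (f * g - g * f)"
    by simp
  moreover have "order_ge 1 (i - 1)" using 1 by (simp add: order_ge_def i_def coeff_1)
  ultimately show ?thesis by blast
qed

text \<open>A cut anywhere else leaves one factor with a word shorter than its order.\<close>

lemma coeff_mult_leading:
  assumes "order_ge k f" "order_ge l g" "length z = k + l"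
  shows "coeff (f * g) z = coeff f (take k z) * coeff g (drop k z)"
proof -
  have "coeff (f * g) z = (\<Sum>i\<in>{k}. coeff f (take i z) * coeff g (drop i z))"
    unfolding coeff_mult
  proof (rule sum.mono_neutral_right)
    show "\<forall>i\<in>{0..length z} - {k}. coeff f (take i z) * coeff g (drop i z) = 0"
    proof
      fix i assume "i \<in> {0..length z} - {k}"
      then have "length (take i z) < k \<or> length (drop i z) < l" using assms(3) by auto
      then show "coeff f (take i z) * coeff g (drop i z) = 0"
        using assms by (auto simp: order_ge_def)
    qed
  qed (use assms in auto)
  then show ?thesis by simp
qed

section \<open>Leading terms of the iterated commutators\<close>

abbreviation ntau :: "'x::linorder list \<Rightarrow> 'x ncps" where
  "ntau w \<equiv> tau ncps_units (\<lambda>x. 1 + nvar x) w"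

text \<open>The leading part is f g - g f for the leading parts f and g of the two factors. Words in
  f g compare with w = u v factor by factor, as the lengths agree; words in g f are at least v u,
  and w < v < v u because a Lyndon word is smaller than its proper suffixes. Hence the coefficient
  of w comes from f g alone.\<close>

lemma ntau_leading:
  assumes "lyndon w"
  shows "order_ge (length w) (ntau w - 1) \<and>
    (\<forall>z. length z = length w \<longrightarrow> coeff (ntau w - 1) z \<noteq> 0 \<longrightarrow> mset z = mset w \<and> w \<le> z) \<and>
    coeff (ntau w - 1) w = 1"
  using assms
proof (induction w rule: length_induct)
  case (1 w)
  show ?case
  proof (cases "length w \<ge> 2")
    case False
    then obtain x where "w = [x]" using lyndon_single_letter[OF 1(2)] by blast
    then show ?thesis
      by (auto simp: tau.simps coeff_nvar order_ge_def)
  next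
    case True
    define k u v where "k = std_cut w" and "u = take k w" and "v = drop k w"
    have w: "w = u @ v" by (simp add: u_def v_def)
    have ne: "u \<noteq> []" "v \<noteq> []" using std_cut_bounds[OF True] by (auto simp: u_def v_def k_def)
    have lu: "lyndon u" and lv: "lyndon v"
      using std_cut_lyndon_take[OF 1(2) True] std_cut_lyndon_drop[OF True]
      by (simp_all add: u_def v_def k_def)
    define f g where "f = ntau u - 1" and "g = ntau v - 1"
    have tw: "ntau w = commutator ncps_units (1 + f) (1 + g)"
      by (subst tau.simps) (use True in \<open>simp add: f_def g_def u_def v_def k_def\<close>)
    have "length u < length w" "length v < length w" using ne w by auto
    with 1(1) lu lv have
      f: "order_ge (length u) f" "coeff f u = 1"
        "\<And>z. length z = length u \<Longrightarrow> coeff f z \<noteq> 0 \<Longrightarrow> mset z = mset u \<and> u \<le> z" and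
      g: "order_ge (length v) g" "coeff g v = 1"
        "\<And>z. length z = length v \<Longrightarrow> coeff g z \<noteq> 0 \<Longrightarrow> mset z = mset v \<and> v \<le> z"
      unfolding f_def g_def by blast+
    have "length u \<ge> 1" "length v \<ge> 1" using ne by (auto simp: Suc_le_eq)
    then have "order_ge 1 f" "order_ge 1 g" using f(1) g(1) order_ge_mono by blast+
    then obtain q where q: "order_ge 1 q" "ntau w = 1 + (1 + q) * (f * g - g * f)"
      using commutator_ncps_units tw by metis
    define d where "d = f * g - g * f"
    have "order_ge (length w) (f * g)" "order_ge (length w) (g * f)"
      using order_ge_mult[OF f(1) g(1)] order_ge_mult[OF g(1) f(1)]
      by (simp_all add: w add.commute)
    then have d: "order_ge (length w) d" by (simp add: d_def order_ge_def)
    have qd: "order_ge (Suc (length w)) (q * d)" using order_ge_mult[OF q(1) d] by simp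
    have t: "ntau w - 1 = d + q * d" using q(2) by (simp add: d_def algebra_simps)
    have coeff_t: "coeff (ntau w - 1) z =
        coeff f (take (length u) z) * coeff g (drop (length u) z) -
        coeff g (take (length v) z) * coeff f (drop (length v) z)"
      if "length z = length w" for z
    proof -
      have "coeff (ntau w - 1) z = coeff (f * g) z - coeff (g * f) z"
        using qd that unfolding t by (simp add: order_ge_def d_def)
      then show ?thesis
        using coeff_mult_leading[OF f(1) g(1), of z] coeff_mult_leading[OF g(1) f(1), of z] that
        by (simp add: w)
    qed
    have less: "w < v @ u"
    proof -
      have "w < v" using lyndon_less_suffix[of u v] 1(2) w ne by simp
      also have "v < v @ u" using ne by (intro less_append_self)
      finally show ?thesis .
    qed
    have A: "mset z = mset w \<and> w \<le> z"
      if "length z = length w" "coeff f (take (length u) z) * coeff g (drop (length u) z) \<noteq> 0" for z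
    proof -
      have "mset (take (length u) z) = mset u \<and> u \<le> take (length u) z"
        by (rule f(3)) (use that w in auto)
      moreover have "mset (drop (length u) z) = mset v \<and> v \<le> drop (length u) z"
        by (rule g(3)) (use that w in auto)
      ultimately show ?thesis
        using append_le_append[of u "take (length u) z" v "drop (length u) z"] that w
        by (metis append_take_drop_id length_append length_take mset_append min.absorb2
            le_add1)
    qed
    have B: "mset z = mset w \<and> w < z"
      if "length z = length w" "coeff g (take (length v) z) * coeff f (drop (length v) z) \<noteq> 0" for z
    proof -
      have "mset (take (length v) z) = mset v \<and> v \<le> take (length v) z"
        by (rule g(3)) (use that w in auto)
      moreover have "mset (drop (length v) z) = mset u \<and> u \<le> drop (length v) z"
        by (rule f(3)) (use that w in auto)
      ultimately have "mset z = mset w \<and> v @ u \<le> z"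
        using append_le_append[of v "take (length v) z" u "drop (length v) z"] that w
        by (metis add.commute append_take_drop_id length_append length_take mset_append min.absorb2
            le_add1)
      with less show ?thesis by auto
    qed
    have "order_ge (length w) (ntau w - 1)"
      unfolding t using d qd by (intro order_ge_add) (auto elim: order_ge_mono)
    moreover have "mset z = mset w \<and> w \<le> z"
      if "length z = length w" "coeff (ntau w - 1) z \<noteq> 0" for z
    proof (cases "coeff f (take (length u) z) * coeff g (drop (length u) z) = 0")
      case True
      then show ?thesis using coeff_t B[of z] that by auto
    next
      case False
      then show ?thesis using A that by blast
    qed
    moreover have "coeff (ntau w - 1) w = 1"
    proof -
      have "coeff g (take (length v) w) * coeff f (drop (length v) w) = 0"
        using B[of w] by blast
      then show ?thesis using coeff_t[of w] f(2) g(2) by (simp add: w)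
    qed
    ultimately show ?thesis by blast
  qed
qed

text \<open>A proper suffix of a power of a letter is also a proper prefix, hence smaller instead of
  larger.\<close>

lemma lyndon_not_replicate:
  assumes "lyndon w" "length w \<ge> 2"
  shows "w \<noteq> replicate (length w) x"
proof
  assume w: "w = replicate (length w) x"
  then have "w = [x] @ replicate (length w - 1) x" using assms(2)
    by (metis append_Cons append_Nil Suc_diff_1 less_le_trans pos2 replicate_Suc)
  moreover from this have "w < replicate (length w - 1) x"
    using lyndon_less_suffix[of "[x]" "replicate (length w - 1) x"] assms by simp
  moreover have "replicate (length w - 1) x < replicate (length w - 1) x @ [x]"
    by (rule less_append_self) simp
  ultimately show False
    by (metis append_Cons append_Nil less_asym replicate_app_Cons_same append_Nil2)
qed

text \<open>With r = n - |w| the bound of \<open>coeff_power_prime_power\<close> is exactly the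
  required modulus. For longer z the factor q ^ (n - |w|) is divisible by that modulus, for shorter
  z the leading part has no term. If w is a single letter x, the power has nonzero coefficients at
  powers of x only, and no Lyndon word of length at least 2 is one.\<close>

lemma coeff_ntau_power:
  assumes w: "lyndon w" "length w \<le> n" and z: "lyndon z" "length z \<le> n"
  shows "[coeff (ntau w ^ (q ^ (n - length w))) z =
    (if length z = length w then int q ^ (n - length w) * coeff (ntau w - 1) z else 0)]
    (mod int q ^ (n - length z + 1))"
proof (cases "length w \<ge> 2")
  case False
  then obtain x where x: "w = [x]" using lyndon_single_letter[OF w(1)] by blast
  have nt: "ntau w = 1 + nvar x" by (simp add: x tau.simps)
  have z1: "length z \<ge> 1" using z by (auto simp: lyndon_def Suc_le_eq)
  show ?thesis
  proof (cases "length z = 1")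
    case True
    then obtain y where "z = [y]" by (cases z) auto
    then show ?thesis by (simp add: x nt[unfolded x] coeff_one_plus_nvar_power coeff_nvar coeff_1)
  next
    case False
    then show ?thesis
      using z1 lyndon_not_replicate[OF z(1), of x]
      by (simp add: nt[unfolded x] coeff_one_plus_nvar_power x)
  qed
next
  case True
  define t r where "t = ntau w - 1" and "r = n - length w"
  have t: "order_ge (length w) t" using ntau_leading[OF w(1)] by (simp add: t_def)
  show ?thesis
  proof (cases "length z \<ge> 2")
    case True
    have e: "r + length w + 1 - length z = n - length z + 1"
      using w z by (simp add: r_def)
    have "[coeff ((1 + t) ^ (q ^ r)) z = int q ^ r * coeff t z] (mod int q ^ (n - length z + 1))"
      using coeff_power_prime_power[OF t \<open>length w \<ge> 2\<close> True, of q r] unfolding e by simp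
    moreover have "[int q ^ r * coeff t z = 0] (mod int q ^ (n - length z + 1))"
      if "length z \<noteq> length w"
    proof (cases "length z < length w")
      case True
      then show ?thesis using t by (simp add: order_ge_def)
    next
      case False
      then have "int q ^ (n - length z + 1) dvd int q ^ r"
        using that z by (intro le_imp_power_dvd) (simp add: r_def)
      then show ?thesis by (simp add: cong_0_iff)
    qed
    ultimately show ?thesis by (auto simp: t_def r_def intro: cong_trans)
  next
    case False
    then obtain y where y: "z = [y]" using lyndon_single_letter[OF z(1)] by blast
    have "order_ge 2 ((1 + t) ^ k - 1)" for k
    proof (induction k)
      case (Suc k)
      have t2: "order_ge 2 t" using t \<open>length w \<ge> 2\<close> by (rule order_ge_mono)
      have "(1 + t) ^ Suc k - 1 = ((1 + t) ^ k - 1) + (1 + t) ^ k * t"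
        by (simp add: power_Suc2 distrib_left del: power_Suc)
      moreover have "order_ge 2 ((1 + t) ^ k * t)"
        using order_ge_mult[OF order_ge_0 t2, of "(1 + t) ^ k"] by (simp only: add_0)
      ultimately show ?case using Suc order_ge_add by metis
    qed (simp add: order_ge_def)
    then have "coeff ((1 + t) ^ (q ^ r) - 1) z = 0" by (simp add: order_ge_def y)
    then have "coeff ((1 + t) ^ (q ^ r)) z = 0" by (simp add: y coeff_1)
    then show ?thesis using \<open>length w \<ge> 2\<close> by (simp add: t_def r_def y)
  qed
qed


section \<open>Central filtrations of groups\<close>

context group
begin

lemma inv_mult_cancel_left: "x \<in> carrier G \<Longrightarrow> y \<in> carrier G \<Longrightarrow> inv x \<otimes> (x \<otimes> y) = y"
  by (simp flip: m_assoc)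

lemma mult_inv_cancel_left: "x \<in> carrier G \<Longrightarrow> y \<in> carrier G \<Longrightarrow> x \<otimes> (inv x \<otimes> y) = y"
  by (simp flip: m_assoc)

text \<open>Rewriting to right-nested words with cancellation; this settles the identities between
  commutators and conjugates below.\<close>

lemmas group_normalize = m_assoc inv_mult_group inv_mult_cancel_left mult_inv_cancel_left

lemma commutator_closed [simp]:
  "s \<in> carrier G \<Longrightarrow> t \<in> carrier G \<Longrightarrow> commutator G s t \<in> carrier G"
  by (simp add: commutator_def)

lemma conj_commutator:
  assumes "g \<in> carrier G" "s \<in> carrier G" "t \<in> carrier G"
  shows "g \<otimes> commutator G s t \<otimes> inv g = commutator G (g \<otimes> s \<otimes> inv g) (g \<otimes> t \<otimes> inv g)"
  using assms by (simp add: commutator_def group_normalize)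

lemma conj_nat_pow:
  assumes "g \<in> carrier G" "t \<in> carrier G"
  shows "g \<otimes> t [^] (k::nat) \<otimes> inv g = (g \<otimes> t \<otimes> inv g) [^] k"
proof (induction k)
  case (Suc k)
  have "g \<otimes> t [^] Suc k \<otimes> inv g = (g \<otimes> t [^] k \<otimes> inv g) \<otimes> (g \<otimes> t \<otimes> inv g)"
    using assms by (simp add: group_normalize)
  then show ?case by (simp add: Suc)
qed (use assms in simp)

lemma inv_commutator:
  "s \<in> carrier G \<Longrightarrow> t \<in> carrier G \<Longrightarrow> inv (commutator G s t) = commutator G t s"
  by (simp add: commutator_def group_normalize)

lemma commute_inv:
  assumes "x \<otimes> a = a \<otimes> x" "x \<in> carrier G" "a \<in> carrier G"
  shows "x \<otimes> inv a = inv a \<otimes> x"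
proof -
  have "inv a \<otimes> (x \<otimes> a) \<otimes> inv a = inv a \<otimes> (a \<otimes> x) \<otimes> inv a" by (simp add: assms(1))
  then show ?thesis using assms(2,3) by (simp add: group_normalize)
qed

lemma commute_mult:
  assumes "x \<otimes> a = a \<otimes> x" "x \<otimes> b = b \<otimes> x" "x \<in> carrier G" "a \<in> carrier G" "b \<in> carrier G"
  shows "x \<otimes> (a \<otimes> b) = (a \<otimes> b) \<otimes> x"
proof -
  have "x \<otimes> (a \<otimes> b) = (x \<otimes> a) \<otimes> b" using assms(3-5) by (simp add: m_assoc)
  also have "\<dots> = a \<otimes> (x \<otimes> b)" unfolding assms(1) using assms(3-5) by (simp add: m_assoc)
  also have "\<dots> = (a \<otimes> b) \<otimes> x" unfolding assms(2) using assms(3-5) by (simp add: m_assoc)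
  finally show ?thesis .
qed

text \<open>Conjugation by x takes g to g u and t to t v, where u = [g, x] and v = [t, x]. In
  [g u, t v] the central v disappears, and u cancels because it commutes with t and with [g, t].
  This plays the part of the three subgroups lemma.\<close>

lemma commutator_commute:
  assumes c: "x \<in> carrier G" "g \<in> carrier G" "t \<in> carrier G"
    and gx_t: "commutator G g x \<otimes> t = t \<otimes> commutator G g x"
    and gx_gt: "commutator G g x \<otimes> commutator G g t = commutator G g t \<otimes> commutator G g x"
    and tx: "\<And>a. a \<in> carrier G \<Longrightarrow> commutator G t x \<otimes> a = a \<otimes> commutator G t x"
  shows "x \<otimes> commutator G g t = commutator G g t \<otimes> x"
proof -
  define u v where "u = commutator G g x" and "v = commutator G t x"
  have uv [simp]: "u \<in> carrier G" "v \<in> carrier G" using c by (simp_all add: u_def v_def)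
  have "inv x \<otimes> g \<otimes> x = g \<otimes> u" "inv x \<otimes> t \<otimes> x = t \<otimes> v"
    using c by (simp_all add: u_def v_def commutator_def group_normalize)
  then have "inv x \<otimes> commutator G g t \<otimes> x = commutator G (g \<otimes> u) (t \<otimes> v)"
    using conj_commutator[of "inv x" g t] c by simp
  also have "\<dots> = commutator G (g \<otimes> u) t"
  proof -
    have "commutator G (g \<otimes> u) (t \<otimes> v) = inv (g \<otimes> u) \<otimes> inv v \<otimes> inv t \<otimes> (g \<otimes> u) \<otimes> (t \<otimes> v)"
      using c by (simp add: commutator_def group_normalize)
    also have "\<dots> = inv (g \<otimes> u) \<otimes> inv v \<otimes> (inv t \<otimes> (g \<otimes> u) \<otimes> t \<otimes> v)"
      using c by (simp add: group_normalize)
    also have "inv t \<otimes> (g \<otimes> u) \<otimes> t \<otimes> v = v \<otimes> (inv t \<otimes> (g \<otimes> u) \<otimes> t)"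
      using tx[of "inv t \<otimes> (g \<otimes> u) \<otimes> t"] c by (simp add: v_def)
    finally show ?thesis using c by (simp add: commutator_def group_normalize)
  qed
  also have "\<dots> = inv u \<otimes> (inv g \<otimes> inv t \<otimes> g \<otimes> (u \<otimes> t))"
    using c by (simp add: commutator_def group_normalize)
  also have "u \<otimes> t = t \<otimes> u" using gx_t by (simp add: u_def)
  also have "inv u \<otimes> (inv g \<otimes> inv t \<otimes> g \<otimes> (t \<otimes> u)) = inv u \<otimes> (commutator G g t \<otimes> u)"
    using c by (simp add: commutator_def group_normalize)
  also have "commutator G g t \<otimes> u = u \<otimes> commutator G g t" using gx_gt by (simp add: u_def)
  also have "inv u \<otimes> (u \<otimes> commutator G g t) = commutator G g t"
    using c by (simp add: group_normalize)
  finally have "x \<otimes> (inv x \<otimes> commutator G g t \<otimes> x) = x \<otimes> commutator G g t" by simp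
  then show ?thesis using c by (simp add: group_normalize)
qed

end

lemma (in group_hom) hom_commutator:
  "s \<in> carrier G \<Longrightarrow> t \<in> carrier G \<Longrightarrow> h (commutator G s t) = commutator H (h s) (h t)"
  by (simp add: commutator_def)

lemma tau_closed:
  assumes "group G" "range \<iota> \<subseteq> carrier G"
  shows "tau G \<iota> w \<in> carrier G"
proof (induction w rule: length_induct)
  case (1 w)
  interpret group G by fact
  show ?case
    using 1[rule_format, of "take (std_cut w) w"] 1[rule_format, of "drop (std_cut w) w"]
      std_cut_bounds[of w] assms(2)
    by (subst tau.simps) auto
qed

lemma (in group_hom) hom_tau:
  assumes "range \<iota> \<subseteq> carrier G"
  shows "h (tau G \<iota> w) = tau H (h \<circ> \<iota>) w"
proof (induction w rule: length_induct)
  case (1 w)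
  show ?case
    using 1[rule_format, of "take (std_cut w) w"] 1[rule_format, of "drop (std_cut w) w"]
      std_cut_bounds[of w] assms tau_closed[OF G.is_group assms]
    by (subst (1 2) tau.simps) (auto simp: hom_commutator)
qed

text \<open>The commutator is the left quotient of x y by y x, whereas right cosets compare right
  quotients; normality passes from one to the other by conjugation.\<close>

lemma (in normal) commutator_mem_iff:
  assumes "x \<in> carrier G" "y \<in> carrier G"
  shows "commutator G x y \<in> H \<longleftrightarrow> H #> (x \<otimes> y) = H #> (y \<otimes> x)"
proof -
  have "H #> (x \<otimes> y) = H #> (y \<otimes> x) \<longleftrightarrow> (x \<otimes> y) \<otimes> inv (y \<otimes> x) \<in> H"
  proof
    assume "H #> (x \<otimes> y) = H #> (y \<otimes> x)"
    then have "x \<otimes> y \<in> H #> (y \<otimes> x)"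
      using rcos_self[of "x \<otimes> y" H] assms is_subgroup by simp
    then show "(x \<otimes> y) \<otimes> inv (y \<otimes> x) \<in> H"
      using rcos_module_imp[OF is_group, of "y \<otimes> x" "x \<otimes> y"] assms by simp
  next
    assume "(x \<otimes> y) \<otimes> inv (y \<otimes> x) \<in> H"
    then have "x \<otimes> y \<in> H #> (y \<otimes> x)"
      using rcos_module_rev[OF is_group, of "y \<otimes> x" "x \<otimes> y"] assms by simp
    then show "H #> (x \<otimes> y) = H #> (y \<otimes> x)"
      using repr_independence[of "x \<otimes> y" H "y \<otimes> x"] assms is_subgroup by simp
  qed
  also have "\<dots> \<longleftrightarrow> commutator G x y \<in> H"
  proof
    assume "(x \<otimes> y) \<otimes> inv (y \<otimes> x) \<in> H"
    from inv_op_closed1[OF _ this, of "y \<otimes> x"] show "commutator G x y \<in> H"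
      using assms by (simp add: commutator_def group_normalize)
  next
    assume "commutator G x y \<in> H"
    from inv_op_closed2[OF _ this, of "y \<otimes> x"] show "(x \<otimes> y) \<otimes> inv (y \<otimes> x) \<in> H"
      using assms by (simp add: commutator_def group_normalize)
  qed
  finally show ?thesis by simp
qed

text \<open>Indexed from \<open>0\<close>: the value at \<open>n\<close> is the term usually numbered \<open>n + 1\<close>.\<close>

fun lower_central :: "('g, 'm) monoid_scheme \<Rightarrow> nat \<Rightarrow> 'g set" where
  "lower_central G 0 = carrier G"
| "lower_central G (Suc n) =
     generate G {commutator G s t | s t. s \<in> carrier G \<and> t \<in> lower_central G n}"

context group
begin

lemma lower_central_normal: "lower_central G n \<lhd> G"
proof (induction n)
  case (Suc n)
  interpret N: normal "lower_central G n" G by fact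
  show ?case unfolding lower_central.simps
  proof (rule normal_generateI)
    show "{commutator G s t |s t. s \<in> carrier G \<and> t \<in> lower_central G n} \<subseteq> carrier G"
      using N.subset by auto
    fix h g assume "h \<in> {commutator G s t |s t. s \<in> carrier G \<and> t \<in> lower_central G n}"
      and g: "g \<in> carrier G"
    then obtain s t where "h = commutator G s t" "s \<in> carrier G" "t \<in> lower_central G n"
      by blast
    then have "g \<otimes> h \<otimes> inv g = commutator G (g \<otimes> s \<otimes> inv g) (g \<otimes> t \<otimes> inv g)"
      using conj_commutator[OF g, of s t] N.mem_carrier by simp
    moreover have "g \<otimes> t \<otimes> inv g \<in> lower_central G n"
      using \<open>t \<in> lower_central G n\<close> by (rule N.inv_op_closed2[OF g])
    moreover have "g \<otimes> s \<otimes> inv g \<in> carrier G" using g \<open>s \<in> carrier G\<close> by simp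
    ultimately show "g \<otimes> h \<otimes> inv g \<in> {commutator G s t |s t. s \<in> carrier G \<and> t \<in> lower_central G n}"
      by (intro CollectI exI conjI)
  qed
qed (simp add: normal_self)

lemma lower_central_subset: "lower_central G n \<subseteq> carrier G"
  by (rule subgroup.subset[OF normal_imp_subgroup[OF lower_central_normal]]) 

lemma lower_central_commutator_step:
  "s \<in> carrier G \<Longrightarrow> t \<in> lower_central G n \<Longrightarrow> commutator G s t \<in> lower_central G (Suc n)"
  by (auto intro: generate.incl)

lemma lower_central_antimono_step: "lower_central G (Suc n) \<subseteq> lower_central G n"
proof -
  interpret N: normal "lower_central G n" G by (rule lower_central_normal)
  show ?thesis unfolding lower_central.simps(2)
  proof (rule generate_subgroup_incl[OF _ N.is_subgroup], clarify)
    fix s t assume s: "s \<in> carrier G" and t: "t \<in> lower_central G n"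
    then have "inv s \<otimes> inv t \<otimes> s \<in> lower_central G n" using N.inv_op_closed1 by blast
    then show "commutator G s t \<in> lower_central G n" using t by (simp add: commutator_def)
  qed
qed

text \<open>
  In the induction on \<open>j\<close>, the commutators of \<open>x\<close> with \<open>t\<close> and with \<open>g\<close> are so deep in the
  filtration that \<open>commutator_commute\<close> applies modulo the required term.
\<close>

lemma lower_central_commutator:
  "x \<in> lower_central G i \<Longrightarrow> y \<in> lower_central G j \<Longrightarrow>
    commutator G x y \<in> lower_central G (Suc (i + j))"
proof (induction j arbitrary: i x y)
  case 0
  interpret M: normal "lower_central G (Suc i)" G by (rule lower_central_normal)
  have "commutator G y x \<in> lower_central G (Suc i)"
    using 0 by (intro lower_central_commutator_step) auto
  then have "inv (commutator G y x) \<in> lower_central G (Suc i)" by (rule M.m_inv_closed)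
  then show ?case using 0 lower_central_subset[of i] by (auto simp: inv_commutator)
next
  case (Suc j)
  define M where "M = lower_central G (Suc (i + Suc j))"
  interpret M: normal M G unfolding M_def by (rule lower_central_normal)
  interpret Q: group "G Mod M" by (rule M.factorgroup_is_group)
  interpret pi: group_hom G "G Mod M" "\<lambda>a. M #> a"
    by (intro group_hom.intro is_group Q.is_group group_hom_axioms.intro M.r_coset_hom_Mod)
  note sub = lower_central_subset[THEN subsetD]
  have commute: "(M #> a) \<otimes>\<^bsub>G Mod M\<^esub> (M #> b) = (M #> b) \<otimes>\<^bsub>G Mod M\<^esub> (M #> a)"
    if "commutator G a b \<in> M" "a \<in> carrier G" "b \<in> carrier G" for a b
    using that M.commutator_mem_iff[of a b] pi.hom_mult[of a b] pi.hom_mult[of b a]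
    by (simp only:)
  have commute': "(M #> a) \<otimes>\<^bsub>G Mod M\<^esub> (M #> b) = (M #> b) \<otimes>\<^bsub>G Mod M\<^esub> (M #> a)"
    if "a \<in> lower_central G (Suc i)" "b \<in> lower_central G j" for a b
  proof (rule commute)
    show "commutator G a b \<in> M"
      using Suc.IH[OF that] by (simp only: M_def add_Suc add_Suc_right)
  qed (use that sub in blast)+
  \<comment> \<open>Commuting modulo M with the whole term of index i is a subgroup condition on y,
    so it suffices to check it on the commutators [g, t] that generate the term of index
    \<open>Suc j\<close>.\<close>
  define C where "C = {y \<in> carrier G. \<forall>x \<in> lower_central G i.
      (M #> x) \<otimes>\<^bsub>G Mod M\<^esub> (M #> y) = (M #> y) \<otimes>\<^bsub>G Mod M\<^esub> (M #> x)}"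
  have "subgroup C G"
  proof (rule subgroupI)
    show "C \<subseteq> carrier G" by (auto simp: C_def)
    have "\<one> \<in> C"
      unfolding C_def
    proof (intro CollectI conjI ballI)
      fix x assume "x \<in> lower_central G i"
      then have "M #> x \<in> carrier (G Mod M)" using sub pi.hom_closed by blast
      then show "(M #> x) \<otimes>\<^bsub>G Mod M\<^esub> (M #> \<one>) = (M #> \<one>) \<otimes>\<^bsub>G Mod M\<^esub> (M #> x)"
        unfolding pi.hom_one by (simp only: Q.l_one Q.r_one)
    qed simp
    then show "C \<noteq> {}" by blast
  next
    fix a b assume a: "a \<in> C"
    show "inv a \<in> C"
      unfolding C_def
    proof (intro CollectI conjI ballI)
      show "inv a \<in> carrier G" using a by (simp add: C_def)
      fix x assume x: "x \<in> lower_central G i"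
      have c: "M #> x \<in> carrier (G Mod M)" "M #> a \<in> carrier (G Mod M)"
        using a x sub by (auto simp: C_def)
      have "(M #> x) \<otimes>\<^bsub>G Mod M\<^esub> (M #> a) = (M #> a) \<otimes>\<^bsub>G Mod M\<^esub> (M #> x)"
        using a x by (simp add: C_def)
      then have "(M #> x) \<otimes>\<^bsub>G Mod M\<^esub> inv\<^bsub>G Mod M\<^esub> (M #> a) =
          inv\<^bsub>G Mod M\<^esub> (M #> a) \<otimes>\<^bsub>G Mod M\<^esub> (M #> x)"
        by (rule Q.commute_inv[OF _ c])
      then show "(M #> x) \<otimes>\<^bsub>G Mod M\<^esub> (M #> inv a) = (M #> inv a) \<otimes>\<^bsub>G Mod M\<^esub> (M #> x)"
        using a pi.hom_inv[of a] by (simp add: C_def)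
    qed
    assume b: "b \<in> C"
    show "a \<otimes> b \<in> C"
      unfolding C_def
    proof (intro CollectI conjI ballI)
      show "a \<otimes> b \<in> carrier G" using a b by (simp add: C_def)
      fix x assume x: "x \<in> lower_central G i"
      have c: "M #> x \<in> carrier (G Mod M)" "M #> a \<in> carrier (G Mod M)" "M #> b \<in> carrier (G Mod M)"
        using a b x sub by (auto simp: C_def)
      have "(M #> x) \<otimes>\<^bsub>G Mod M\<^esub> (M #> a) = (M #> a) \<otimes>\<^bsub>G Mod M\<^esub> (M #> x)"
        "(M #> x) \<otimes>\<^bsub>G Mod M\<^esub> (M #> b) = (M #> b) \<otimes>\<^bsub>G Mod M\<^esub> (M #> x)"
        using a b x by (simp_all add: C_def)
      then have "(M #> x) \<otimes>\<^bsub>G Mod M\<^esub> ((M #> a) \<otimes>\<^bsub>G Mod M\<^esub> (M #> b)) =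
          ((M #> a) \<otimes>\<^bsub>G Mod M\<^esub> (M #> b)) \<otimes>\<^bsub>G Mod M\<^esub> (M #> x)"
        by (rule Q.commute_mult[OF _ _ c])
      then show "(M #> x) \<otimes>\<^bsub>G Mod M\<^esub> (M #> (a \<otimes> b)) = (M #> (a \<otimes> b)) \<otimes>\<^bsub>G Mod M\<^esub> (M #> x)"
        using a b by (simp add: C_def)
    qed
  qed
  moreover have "{commutator G s t |s t. s \<in> carrier G \<and> t \<in> lower_central G j} \<subseteq> C"
  proof clarify
    fix g t assume g: "g \<in> carrier G" and t: "t \<in> lower_central G j"
    then have tc: "t \<in> carrier G" using sub by blast
    have "(M #> x) \<otimes>\<^bsub>G Mod M\<^esub> commutator (G Mod M) (M #> g) (M #> t) =
        commutator (G Mod M) (M #> g) (M #> t) \<otimes>\<^bsub>G Mod M\<^esub> (M #> x)"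
      if x: "x \<in> lower_central G i" for x
    proof (rule Q.commutator_commute)
      have xc: "x \<in> carrier G" using x sub by blast
      show "M #> x \<in> carrier (G Mod M)" "M #> g \<in> carrier (G Mod M)" "M #> t \<in> carrier (G Mod M)"
        using g tc xc by auto
      \<comment> \<open>[g, x] lies one step deeper than x, so the induction hypothesis at
        \<open>Suc i\<close> makes it commute modulo M with the term of index j, to which both t and
        [g, t] belong.\<close>
      have gx: "commutator G g x \<in> lower_central G (Suc i)"
        using g x by (rule lower_central_commutator_step)
      show "commutator (G Mod M) (M #> g) (M #> x) \<otimes>\<^bsub>G Mod M\<^esub> (M #> t) =
          (M #> t) \<otimes>\<^bsub>G Mod M\<^esub> commutator (G Mod M) (M #> g) (M #> x)"
        using commute'[OF gx t] pi.hom_commutator[OF g xc] by simp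
      have "commutator G g t \<in> lower_central G j"
        using lower_central_commutator_step[OF g t] lower_central_antimono_step by blast
      then show "commutator (G Mod M) (M #> g) (M #> x) \<otimes>\<^bsub>G Mod M\<^esub>
            commutator (G Mod M) (M #> g) (M #> t) =
          commutator (G Mod M) (M #> g) (M #> t) \<otimes>\<^bsub>G Mod M\<^esub>
            commutator (G Mod M) (M #> g) (M #> x)"
        using commute'[OF gx] pi.hom_commutator g xc tc by metis
      fix A assume "A \<in> carrier (G Mod M)"
      then obtain a where a: "a \<in> carrier G" "A = M #> a" by (auto simp: FactGroup_def RCOSETS_def)
      \<comment> \<open>[t, x] lies in the term just before M, so every commutator with it falls
        into M: it is central modulo M.\<close>
      have tx: "commutator G t x \<in> lower_central G (Suc (i + j))"
        using subgroup.m_inv_closed[OF normal_imp_subgroup[OF lower_central_normal] Suc.IH[OF x t]]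
        unfolding inv_commutator[OF xc tc] .
      have "commutator G a (commutator G t x) \<in> M"
        unfolding M_def using lower_central_commutator_step[OF a(1) tx] by simp
      from commute[OF this] show "commutator (G Mod M) (M #> t) (M #> x) \<otimes>\<^bsub>G Mod M\<^esub> A =
           A \<otimes>\<^bsub>G Mod M\<^esub> commutator (G Mod M) (M #> t) (M #> x)"
        using a tc xc pi.hom_commutator by simp
    qed
    then show "commutator G g t \<in> C"
      using g tc pi.hom_commutator by (simp add: C_def)
  qed
  ultimately have "lower_central G (Suc j) \<subseteq> C"
    using generate_subgroup_incl by simp
  with Suc.prems have y: "y \<in> C" by blast
  then have "M #> (x \<otimes> y) = M #> (y \<otimes> x)"
    using Suc.prems(1) sub[of x i] by (auto simp: C_def)
  moreover have "x \<in> carrier G" "y \<in> carrier G" using Suc.prems sub by blast+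
  ultimately have "commutator G x y \<in> M" using M.commutator_mem_iff by blast
  then show ?case by (simp only: M_def)
qed

text \<open>Both factors of a standard factorization may be long, while the series is built from
  commutators with the whole group; this is what \<open>lower_central_commutator\<close> is
  for.\<close>

lemma tau_lower_central:
  assumes "range \<iota> \<subseteq> carrier G" "w \<noteq> []"
  shows "tau G \<iota> w \<in> lower_central G (length w - 1)"
  using assms(2)
proof (induction w rule: length_induct)
  case (1 w)
  show ?case
  proof (cases "length w \<ge> 2")
    case True
    let ?u = "take (std_cut w) w" and ?v = "drop (std_cut w) w"
    note b = std_cut_bounds[OF True]
    have "w \<noteq> []" using True by auto
    then have "tau G \<iota> ?u \<in> lower_central G (length ?u - 1)" "tau G \<iota> ?v \<in> lower_central G (length ?v - 1)"
      using 1(1)[rule_format, of ?u] 1(1)[rule_format, of ?v] b by auto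
    from lower_central_commutator[OF this]
    have "tau G \<iota> w \<in> lower_central G (Suc (length ?u - 1 + (length ?v - 1)))"
      using True by (subst tau.simps) simp
    also have "Suc (length ?u - 1 + (length ?v - 1)) = length w - 1" using b by simp
    finally show ?thesis .
  next
    case False
    then have "length w - 1 = 0" by simp
    then show ?thesis using False assms by (subst tau.simps) auto
  qed
qed

end

section \<open>The lower \<open>p\<close>-central filtration\<close>

context topological_group
begin

lemma continuous_mult_left: "a \<in> carrier G \<Longrightarrow> continuous_map T T (\<lambda>x. a \<otimes> x)"
  using continuous_map_compose[OF continuous_map_pairedI continuous_mult, of T "\<lambda>_. a" "\<lambda>x. x"]
  by (simp add: topspace_eq o_def)

lemma continuous_mult_right: "a \<in> carrier G \<Longrightarrow> continuous_map T T (\<lambda>x. x \<otimes> a)"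
  using continuous_map_compose[OF continuous_map_pairedI continuous_mult, of T "\<lambda>x. x" "\<lambda>_. a"]
  by (simp add: topspace_eq o_def)

lemma continuous_conj: "g \<in> carrier G \<Longrightarrow> continuous_map T T (\<lambda>x. g \<otimes> x \<otimes> inv g)"
  using continuous_map_compose[OF continuous_mult_left continuous_mult_right, of g "inv g"]
  by (simp add: o_def)

lemma closed_generate_incl: 
  assumes "A \<subseteq> carrier G"
  shows "A \<subseteq> closed_generate G T A"
proof -
  have "generate G A \<subseteq> closed_generate G T A"
    unfolding closed_generate_def
    using generate_incl[OF assms] by (intro closure_of_subset) (simp add: topspace_eq)
  then show ?thesis by (auto intro: generate.incl)
qed

lemma closed_generate_closed: "closedin T (closed_generate G T A)"
  by (simp add: closed_generate_def)

lemma closed_generate_minimal: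
  assumes "A \<subseteq> M" "subgroup M G" "closedin T M"
  shows "closed_generate G T A \<subseteq> M"
  unfolding closed_generate_def
  using generate_subgroup_incl[OF assms(1,2)] assms(3) by (rule closure_of_minimal)

text \<open>Stability properties of the generated subgroup pass to its closure along a continuous
  map.\<close>

lemma closed_generate_image_subset:
  assumes "continuous_map T T f" "f ` generate G A \<subseteq> closed_generate G T A"
  shows "f ` closed_generate G T A \<subseteq> closed_generate G T A"
proof -
  have "f ` closed_generate G T A \<subseteq> T closure_of (f ` generate G A)"
    unfolding closed_generate_def by (rule continuous_map_image_closure_subset[OF assms(1)])
  also have "\<dots> \<subseteq> closed_generate G T A"
    using assms(2) closed_generate_closed by (rule closure_of_minimal)
  finally show ?thesis .
qed

lemma closed_generate_subgroup:
  assumes "A \<subseteq> carrier G"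
  shows "subgroup (closed_generate G T A) G"
proof (rule subgroupI)
  interpret H: subgroup "generate G A" G by (rule generate_is_subgroup[OF assms])
  have HC: "generate G A \<subseteq> closed_generate G T A"
    unfolding closed_generate_def
    using generate_incl[OF assms] by (intro closure_of_subset) (simp add: topspace_eq)
  show C: "closed_generate G T A \<subseteq> carrier G"
    unfolding closed_generate_def using closure_of_subset_topspace[of T] by (simp add: topspace_eq)
  show "closed_generate G T A \<noteq> {}" using HC H.one_closed by blast
  have inv: "(\<lambda>x. inv x) ` closed_generate G T A \<subseteq> closed_generate G T A"
    by (rule closed_generate_image_subset[OF continuous_inv]) (use HC in auto)
  then show "inv a \<in> closed_generate G T A" if "a \<in> closed_generate G T A" for a
    using that by blast
  \<comment> \<open>First the left factor is taken in the dense subgroup and the right one in the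
    closure; the result then serves to let the left factor vary over the closure as well.\<close>
  have 1: "(\<lambda>x. h \<otimes> x) ` closed_generate G T A \<subseteq> closed_generate G T A" if "h \<in> generate G A" for h
    by (rule closed_generate_image_subset[OF continuous_mult_left]) (use that HC in auto)
  have 2: "(\<lambda>x. x \<otimes> c) ` closed_generate G T A \<subseteq> closed_generate G T A"
    if "c \<in> closed_generate G T A" for c
    by (rule closed_generate_image_subset[OF continuous_mult_right]) (use that C 1 in auto)
  then show "a \<otimes> b \<in> closed_generate G T A"
    if "a \<in> closed_generate G T A" "b \<in> closed_generate G T A" for a b
    using that by blast
qed

lemma closed_generate_normal:
  assumes A: "A \<subseteq> carrier G" and conj: "\<And>g a. g \<in> carrier G \<Longrightarrow> a \<in> A \<Longrightarrow> g \<otimes> a \<otimes> inv g \<in> A"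
  shows "closed_generate G T A \<lhd> G"
proof (rule normal_invI[OF closed_generate_subgroup[OF A]])
  interpret H: normal "generate G A" G by (rule normal_generateI[OF A conj])
  have HC: "generate G A \<subseteq> closed_generate G T A"
    unfolding closed_generate_def
    using generate_incl[OF A] by (intro closure_of_subset) (simp add: topspace_eq)
  fix g h assume g: "g \<in> carrier G" and h: "h \<in> closed_generate G T A"
  have "(\<lambda>x. g \<otimes> x \<otimes> inv g) ` generate G A \<subseteq> closed_generate G T A"
  proof clarify
    fix x assume "x \<in> generate G A"
    from H.inv_op_closed2[OF g this] show "g \<otimes> x \<otimes> inv g \<in> closed_generate G T A"
      using HC by blast
  qed
  then have "(\<lambda>x. g \<otimes> x \<otimes> inv g) ` closed_generate G T A \<subseteq> closed_generate G T A"
    by (rule closed_generate_image_subset[OF continuous_conj[OF g]])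
  then show "g \<otimes> h \<otimes> inv g \<in> closed_generate G T A" using h by blast
qed

lemma lower_p_central_normal_closed:
  "lower_p_central G T p (Suc k) \<lhd> G \<and> closedin T (lower_p_central G T p (Suc k))"
proof (induction k)
  case 0
  then show ?case using normal_self by (simp flip: topspace_eq)
next
  case (Suc k)
  define M where "M = lower_p_central G T p (Suc k)"
  interpret M: normal M G using Suc by (simp add: M_def)
  have "closed_generate G T ({t [^] p |t. t \<in> M} \<union>
      {commutator G s t |s t. s \<in> carrier G \<and> t \<in> M}) \<lhd> G"
  proof (rule closed_generate_normal)
    show "{t [^] p |t. t \<in> M} \<union> {commutator G s t |s t. s \<in> carrier G \<and> t \<in> M} \<subseteq> carrier G"
      using M.subset by auto
    fix g a assume g: "g \<in> carrier G"
      and "a \<in> {t [^] p |t. t \<in> M} \<union> {commutator G s t |s t. s \<in> carrier G \<and> t \<in> M}"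
    then consider t where "a = t [^] p" "t \<in> M"
      | s t where "a = commutator G s t" "s \<in> carrier G" "t \<in> M" by blast
    then show "g \<otimes> a \<otimes> inv g \<in> {t [^] p |t. t \<in> M} \<union>
        {commutator G s t |s t. s \<in> carrier G \<and> t \<in> M}"
    proof cases
      case 1
      then have "g \<otimes> a \<otimes> inv g = (g \<otimes> t \<otimes> inv g) [^] p" using g by (simp add: conj_nat_pow)
      then show ?thesis using M.inv_op_closed2[OF g 1(2)] by blast
    next
      case 2
      then have "g \<otimes> a \<otimes> inv g = commutator G (g \<otimes> s \<otimes> inv g) (g \<otimes> t \<otimes> inv g)"
        using g by (simp add: conj_commutator)
      then show ?thesis using M.inv_op_closed2[OF g 2(3)] g 2(2) by blast
    qed
  qed
  then show ?case by (simp add: M_def closed_generate_closed)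
qed

lemma lower_p_central_normal: "lower_p_central G T p k \<lhd> G"
  using lower_p_central_normal_closed[of p "k - 1"] normal_self by (cases k) auto

lemma lower_p_central_closed: "closedin T (lower_p_central G T p k)"
  using lower_p_central_normal_closed[of p "k - 1"] by (cases k) (auto simp flip: topspace_eq)

lemma lower_p_central_subset: "lower_p_central G T p k \<subseteq> carrier G"
  by (rule subgroup.subset[OF normal_imp_subgroup[OF lower_p_central_normal]]) 

lemma lower_p_central_gens_incl:
  "{t [^] p |t. t \<in> lower_p_central G T p (Suc k)} \<union>
   {commutator G s t |s t. s \<in> carrier G \<and> t \<in> lower_p_central G T p (Suc k)}
     \<subseteq> lower_p_central G T p (Suc (Suc k))"
  unfolding lower_p_central.simps using lower_p_central_subset[of p "Suc k"]
  by (intro closed_generate_incl) auto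

lemma lower_p_central_pow:
  "t \<in> lower_p_central G T p (Suc k) \<Longrightarrow> t [^] p \<in> lower_p_central G T p (Suc (Suc k))"
  using lower_p_central_gens_incl[of p k] by blast

lemma lower_p_central_commutator:
  "s \<in> carrier G \<Longrightarrow> t \<in> lower_p_central G T p (Suc k) \<Longrightarrow>
    commutator G s t \<in> lower_p_central G T p (Suc (Suc k))"
  using lower_p_central_gens_incl[of p k] by blast

lemma lower_p_central_prime_power:
  "t \<in> lower_p_central G T p (Suc k) \<Longrightarrow> t [^] (p ^ r) \<in> lower_p_central G T p (Suc (k + r))"
proof (induction r)
  case (Suc r)
  have "t \<in> carrier G" using Suc.prems lower_p_central_subset by blast
  then have "t [^] (p ^ Suc r) = (t [^] (p ^ r)) [^] p"
    by (simp add: nat_pow_pow mult.commute)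
  then show ?case using lower_p_central_pow[of "t [^] (p ^ r)" p "k + r"] Suc by simp
next
  case 0
  then have "t \<in> carrier G" using lower_p_central_subset by blast
  then show ?case using 0 by simp
qed

text \<open>The commutator calculus is carried out in the abstract lower central series, where no
  closures occur, and is transferred by this inclusion. The shift by one comes from the different
  starting indices.\<close>

lemma lower_central_subset_lower_p_central:
  "lower_central G k \<subseteq> lower_p_central G T p (Suc k)"
proof (induction k)
  case (Suc k)
  show ?case unfolding lower_central.simps
  proof (rule generate_subgroup_incl[OF _ normal_imp_subgroup[OF lower_p_central_normal]], clarify)
    fix s t assume "s \<in> carrier G" "t \<in> lower_central G k"
    then show "commutator G s t \<in> lower_p_central G T p (Suc (Suc k))"
      using Suc by (intro lower_p_central_commutator) auto
  qed
qed simp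

text \<open>Commutators reach the term with index |w|, and each of the n - |w| further p-th powers
  descends one more step.\<close>

lemma sigma_lower_p_central:
  assumes "range \<iota> \<subseteq> carrier G" "w \<noteq> []" "length w \<le> n"
  shows "sigma G \<iota> p n w \<in> lower_p_central G T p n"
proof -
  have "tau G \<iota> w \<in> lower_p_central G T p (Suc (length w - 1))"
    using tau_lower_central[OF assms(1,2)] lower_central_subset_lower_p_central by blast
  moreover have "Suc (length w - 1 + (n - length w)) = n"
    using assms by (cases w) auto
  ultimately show ?thesis
    using lower_p_central_prime_power[of "tau G \<iota> w" p "length w - 1" "n - length w"]
    by (simp add: sigma_def)
qed

end

text \<open>By continuity the preimage of a term is a closed subgroup, so only the generating powers
  and commutators have to be checked.\<close>

lemma hom_lower_p_central:
  assumes G: "topological_group G T" and H: "topological_group H U"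
    and f: "f \<in> hom G H" "continuous_map T U f"
  shows "f ` lower_p_central G T p k \<subseteq> lower_p_central H U p k"
proof -
  interpret G: topological_group G T by fact
  interpret H: topological_group H U by fact
  interpret f: group_hom G H f using f by unfold_locales
  have "f ` lower_p_central G T p (Suc k) \<subseteq> lower_p_central H U p (Suc k)" for k
  proof (induction k)
    case 0
    then show ?case by auto
  next
    case (Suc k)
    let ?M = "lower_p_central H U p (Suc (Suc k))"
    let ?P = "{x \<in> carrier G. f x \<in> ?M}"
    interpret M: subgroup ?M H by (rule normal_imp_subgroup[OF H.lower_p_central_normal])
    have "lower_p_central G T p (Suc (Suc k)) \<subseteq> ?P"
      unfolding lower_p_central.simps(3)[of G]
    proof (rule G.closed_generate_minimal)
      show "{t [^]\<^bsub>G\<^esub> p |t. t \<in> lower_p_central G T p (Suc k)} \<union>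
        {commutator G s t |s t. s \<in> carrier G \<and> t \<in> lower_p_central G T p (Suc k)} \<subseteq> ?P"
      proof (intro subsetI)
        fix a assume "a \<in> {t [^]\<^bsub>G\<^esub> p |t. t \<in> lower_p_central G T p (Suc k)} \<union>
          {commutator G s t |s t. s \<in> carrier G \<and> t \<in> lower_p_central G T p (Suc k)}"
        then consider t where "a = t [^]\<^bsub>G\<^esub> p" "t \<in> lower_p_central G T p (Suc k)"
          | s t where "a = commutator G s t" "s \<in> carrier G" "t \<in> lower_p_central G T p (Suc k)"
          by blast
        then show "a \<in> ?P"
        proof cases
          case 1
          then have t: "t \<in> carrier G" "f t \<in> lower_p_central H U p (Suc k)"
            using Suc G.lower_p_central_subset by blast+
          have "f (t [^]\<^bsub>G\<^esub> p) \<in> ?M"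
            using H.lower_p_central_pow[OF t(2)] unfolding f.hom_nat_pow[OF t(1)] .
          then show ?thesis using G.nat_pow_closed[OF t(1)] 1(1) by blast
        next
          case 2
          then have t: "t \<in> carrier G" "f t \<in> lower_p_central H U p (Suc k)"
            using Suc G.lower_p_central_subset by blast+
          have "f (commutator G s t) \<in> ?M"
            using H.lower_p_central_commutator[OF f.hom_closed[OF 2(2)] t(2)]
            unfolding f.hom_commutator[OF 2(2) t(1)] .
          then show ?thesis using G.commutator_closed[OF 2(2) t(1)] 2(1) by blast
        qed
      qed
      show "subgroup ?P G"
        by (rule G.subgroupI) (auto simp del: lower_p_central.simps)
      show "closedin T ?P"
        using closedin_continuous_map_preimage[OF f(2) H.lower_p_central_closed]
        by (simp add: G.topspace_eq del: lower_p_central.simps)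
    qed
    then show ?case by blast
  qed
  then show ?thesis by (cases k) auto
qed


section \<open>Openness of the filtration\<close>

text \<open>Modulo H the subgroup K becomes abelian of exponent dividing p, so the products of
  powers of elements of F with exponents below p form a finite set that is stable under right
  multiplication by F. E consists of such products, and stability holds up to a left factor in
  H.\<close>

lemma (in normal) finite_generation_mod:
  assumes p: "p > 0"
    and pow: "\<And>t. t \<in> K \<Longrightarrow> t [^] (p::nat) \<in> H"
    and comm: "\<And>s t. s \<in> K \<Longrightarrow> t \<in> K \<Longrightarrow> commutator G s t \<in> H"
    and K: "subgroup K G"
    and F: "finite F" "F \<subseteq> K"
  shows "\<exists>E. finite E \<and> E \<subseteq> K \<and> \<one> \<in> E \<and> (\<forall>e\<in>E. \<forall>f\<in>F. \<exists>m\<in>H. \<exists>e'\<in>E. e \<otimes> f = m \<otimes> e')"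
  using F
proof (induction F rule: finite_induct)
  case empty
  interpret K: subgroup K G by (rule K)
  show ?case by (rule exI[of _ "{\<one>}"]) simp
next
  case (insert g F)
  interpret K: subgroup K G by (rule K)
  have "F \<subseteq> K" using insert.prems by simp
  from insert.IH[OF this] obtain E where E: "finite E" "E \<subseteq> K" "\<one> \<in> E"
    and "\<forall>e\<in>E. \<forall>f\<in>F. \<exists>m\<in>H. \<exists>e'\<in>E. e \<otimes> f = m \<otimes> e'"
    by (elim exE conjE)
  note step = this(4)[rule_format]
  have g: "g \<in> K" "g \<in> carrier G" using insert.prems K.subset by auto
  have EG: "\<And>e. e \<in> E \<Longrightarrow> e \<in> carrier G" using E K.subset by blast
  define E' where "E' = (\<lambda>(e, i). e \<otimes> g [^] i) ` (E \<times> {..<p})"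
  have E'I: "e \<otimes> g [^] i \<in> E'" if "e \<in> E" "i < p" for e i
    using that by (force simp: E'_def)
  have gK: "g [^] i \<in> K" for i :: nat
    by (induction i) (use g in auto)
  have "finite E'" using E by (simp add: E'_def)
  moreover have "E' \<subseteq> K" using E gK by (auto simp: E'_def)
  moreover have "\<one> \<in> E'" using E'I[OF E(3) p] by simp
  moreover have "\<forall>a\<in>E'. \<forall>f\<in>insert g F. \<exists>m\<in>H. \<exists>e'\<in>E'. a \<otimes> f = m \<otimes> e'"
  proof (intro ballI)
    fix a f assume a: "a \<in> E'" and f: "f \<in> insert g F"
    from a obtain e i where e: "e \<in> E" "i < p" "a = e \<otimes> g [^] i" by (auto simp: E'_def)
    note eG = EG[OF e(1)]
    show "\<exists>m\<in>H. \<exists>e'\<in>E'. a \<otimes> f = m \<otimes> e'"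
    proof (cases "f = g")
      case True
      then have af: "a \<otimes> f = e \<otimes> g [^] Suc i" using e g eG by (simp add: m_assoc)
      show ?thesis
      proof (cases "Suc i < p")
        case True
        have "a \<otimes> f = \<one> \<otimes> (e \<otimes> g [^] Suc i)" using af g eG by simp
        then show ?thesis using E'I[OF e(1) True] subgroup.one_closed[OF is_subgroup] by (intro bexI)
      next
        \<comment> \<open>The exponent wraps around: g ^ p lies in H and is moved to the left by
          conjugation with e.\<close>
        case False
        then have "Suc i = p" using e by simp
        then have "a \<otimes> f = (e \<otimes> g [^] p \<otimes> inv e) \<otimes> (e \<otimes> g [^] (0::nat))"
          using af g eG by (simp add: m_assoc)
        then show ?thesis using inv_op_closed2[OF eG pow[OF g(1)]] E'I[OF e(1) p] by (intro bexI)
      qed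
    next
      case False
      then have f: "f \<in> F" "f \<in> K" "f \<in> carrier G" using f insert.prems K.subset by auto
      \<comment> \<open>This c satisfies b f = c f b, so the power of g is moved past f at the cost
        of a factor in H.\<close>
      define b c where "b = g [^] i" and "c = commutator G (inv b) (inv f)"
      have b: "b \<in> K" "b \<in> carrier G" using gK g by (simp_all add: b_def)
      have c: "c \<in> H" "c \<in> carrier G" using comm[of "inv b" "inv f"] b f by (auto simp: c_def)
      obtain m e' where m: "m \<in> H" "e' \<in> E" "e \<otimes> f = m \<otimes> e'" using step[OF e(1) f(1)] by blast
      have mG: "m \<in> carrier G" "e' \<in> carrier G" using m EG by auto
      have "b \<otimes> f = c \<otimes> (f \<otimes> b)" using b f by (simp add: c_def commutator_def group_normalize)
      then have "a \<otimes> f = (e \<otimes> c \<otimes> inv e) \<otimes> (e \<otimes> f) \<otimes> b"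
        using b c f eG by (simp add: e b_def[symmetric] group_normalize)
      also have "\<dots> = ((e \<otimes> c \<otimes> inv e) \<otimes> m) \<otimes> (e' \<otimes> b)"
        using b c f eG mG by (simp add: m group_normalize)
      finally have "a \<otimes> f = ((e \<otimes> c \<otimes> inv e) \<otimes> m) \<otimes> (e' \<otimes> b)" .
      moreover have "(e \<otimes> c \<otimes> inv e) \<otimes> m \<in> H" using inv_op_closed2[OF eG c(1)] m by simp
      ultimately show ?thesis using E'I[OF m(2) e(2)] unfolding b_def by (intro bexI)
    qed
  qed
  ultimately show ?case by (intro exI[of _ E'] conjI)
qed

context topological_group
begin

lemma closed_rcoset:
  assumes "subgroup M G" "closedin T M" "b \<in> carrier G"
  shows "closedin T (M #> b)"
proof -
  interpret M: subgroup M G by fact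
  have "M #> b = {x \<in> topspace T. x \<otimes> inv b \<in> M}"
    using M.rcos_module[OF is_group assms(3)] M.elemrcos_carrier[OF is_group assms(3)]
    by (auto simp: topspace_eq)
  then show ?thesis
    using closedin_continuous_map_preimage[OF continuous_mult_right assms(2), of "inv b"] assms(3)
    by simp
qed

lemma open_rcoset:
  assumes "subgroup M G" "openin T M" "b \<in> carrier G"
  shows "openin T (M #> b)"
proof -
  interpret M: subgroup M G by fact
  have "M #> b = {x \<in> topspace T. x \<otimes> inv b \<in> M}"
    using M.rcos_module[OF is_group assms(3)] M.elemrcos_carrier[OF is_group assms(3)]
    by (auto simp: topspace_eq)
  then show ?thesis
    using openin_continuous_map_preimage[OF continuous_mult_right assms(2), of "inv b"] assms(3)
    by simp
qed

text \<open>The complement is a finite union of cosets, each of them closed.\<close>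

lemma open_of_finite_index:
  assumes M: "subgroup M G" "closedin T M" and fin: "finite (rcosets M)"
  shows "openin T M"
proof -
  have "closedin T (\<Union>(rcosets M - {M}))"
    using fin closed_rcoset[OF M] by (intro closedin_Union) (auto simp: RCOSETS_def)
  moreover have "M = topspace T - \<Union>(rcosets M - {M})"
  proof -
    have in_rcosets: "M \<in> rcosets M" by (rule subgroup.subgroup_in_rcosets[OF M(1) is_group])
    have "C \<inter> M = {}" if "C \<in> rcosets M - {M}" for C
      using pairwiseD[OF rcos_disjoint[OF M(1)], of C M] in_rcosets that by (auto simp: disjnt_def)
    then have "\<Union>(rcosets M - {M}) \<inter> M = {}" by blast
    moreover have "\<Union>(rcosets M) = carrier G" by (rule rcosets_part_G[OF M(1)])
    moreover have "\<Union>(rcosets M) = \<Union>(rcosets M - {M}) \<union> M" using in_rcosets by blast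
    ultimately show ?thesis unfolding topspace_eq by blast
  qed
  ultimately show ?thesis using openin_diff[OF openin_topspace] by metis
qed

text \<open>
  A dense finitely generated subgroup is covered by finitely many cosets of \<open>M\<close> as in Schreier's
  lemma; the union of these cosets is closed.
\<close>

lemma finite_index_step:
  assumes A: "finite A" "A \<subseteq> carrier G" "closed_generate G T A = carrier G"
    and K: "K \<lhd> G" "finite (rcosets K)"
    and M: "M \<lhd> G" "closedin T M"
    and p: "p > 0" and pow: "\<And>t. t \<in> K \<Longrightarrow> t [^] (p::nat) \<in> M"
    and comm: "\<And>s t. s \<in> carrier G \<Longrightarrow> t \<in> K \<Longrightarrow> commutator G s t \<in> M"
  shows "finite (rcosets M)"
proof -
  interpret K: normal K G by fact
  interpret M: normal M G by fact
  \<comment> \<open>Coset representatives of K, together with the identity so that the set D below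
    contains it.\<close>
  define R where "R = insert \<one> ((\<lambda>C. SOME x. x \<in> C) ` (rcosets K))"
  have rep: "(SOME x. x \<in> C) \<in> C" if "C \<in> rcosets K" for C
    using that K.rcosets_non_empty[OF that] by (metis ex_in_conv someI_ex)
  have RG: "R \<subseteq> carrier G"
    using rep K.rcosets_carrier[OF is_group] by (auto simp: R_def)
  have Rfin: "finite R" using K(2) by (simp add: R_def)
  have cover: "\<exists>r\<in>R. x \<otimes> inv r \<in> K" if x: "x \<in> carrier G" for x
  proof -
    define r where "r = (SOME y. y \<in> K #> x)"
    have C: "K #> x \<in> rcosets K" using x by (auto simp: RCOSETS_def)
    have r: "r \<in> K #> x" "r \<in> R" using rep[OF C] C by (auto simp: r_def R_def)
    have "K #> r = K #> x" using repr_independence[OF r(1) x K.is_subgroup] by simp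
    then have "x \<in> K #> r" using rcos_self[OF x K.is_subgroup] by simp
    then show ?thesis using K.rcos_module_imp[OF is_group] r RG by blast
  qed
  \<comment> \<open>With inverses included, stability under right multiplication by Y extends to the
    whole subgroup generated by A.\<close>
  define Y where "Y = A \<union> (\<lambda>x. inv x) ` A"
  have Y: "finite Y" "Y \<subseteq> carrier G" using A by (auto simp: Y_def)
  \<comment> \<open>The Schreier generators: those products of a representative, a generator and an
    inverse representative that lie in K.\<close>
  define F where "F = (\<lambda>(r, y, r'). r \<otimes> y \<otimes> inv r') ` (R \<times> Y \<times> R) \<inter> K"
  have F: "finite F" "F \<subseteq> K" using Y Rfin by (auto simp: F_def)
  have comm': "commutator G s t \<in> M" if "s \<in> K" "t \<in> K" for s t
    using that by (intro comm) auto
  have "\<exists>E. finite E \<and> E \<subseteq> K \<and> \<one> \<in> E \<and> (\<forall>e\<in>E. \<forall>f\<in>F. \<exists>m\<in>M. \<exists>e'\<in>E. e \<otimes> f = m \<otimes> e')"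
    by (rule M.finite_generation_mod[OF p _ _ K.is_subgroup F]; fact pow comm')
  then obtain E where E: "finite E" "E \<subseteq> K" "\<one> \<in> E"
    and "\<forall>e\<in>E. \<forall>f\<in>F. \<exists>m\<in>M. \<exists>e'\<in>E. e \<otimes> f = m \<otimes> e'"
    by (elim exE conjE)
  note step = this(4)[rule_format]
  define B where "B = (\<lambda>(e, r). e \<otimes> r) ` (E \<times> R)"
  have B: "finite B" "B \<subseteq> carrier G" using E Rfin RG K.subset by (auto simp: B_def)
  define D where "D = (\<Union>b\<in>B. M #> b)"
  have D: "closedin T D"
    unfolding D_def using B closed_rcoset[OF M.is_subgroup M(2)] by (intro closedin_Union) auto
  have DI: "m \<otimes> (e \<otimes> r) \<in> D" if "m \<in> M" "e \<in> E" "r \<in> R" for m e r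
    using that by (force simp: D_def B_def r_coset_def)
  have DY: "d \<otimes> y \<in> D" if "d \<in> D" "y \<in> Y" for d y
  proof -
    from \<open>d \<in> D\<close> obtain m e r where d: "d = m \<otimes> (e \<otimes> r)" "m \<in> M" "e \<in> E" "r \<in> R"
      by (auto simp: D_def B_def r_coset_def)
    have c: "m \<in> carrier G" "e \<in> carrier G" "r \<in> carrier G" "y \<in> carrier G"
      using d E K.subset RG Y that by auto
    then obtain r' where r': "r' \<in> R" "r \<otimes> y \<otimes> inv r' \<in> K" using cover[of "r \<otimes> y"] by auto
    then have r'G: "r' \<in> carrier G" using RG by blast
    have "r \<otimes> y \<otimes> inv r' \<in> F" unfolding F_def using d that r' by (force simp: F_def)
    then obtain m' e' where m': "m' \<in> M" "e' \<in> E" "e \<otimes> (r \<otimes> y \<otimes> inv r') = m' \<otimes> e'"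
      using step[OF d(3)] by blast
    have c': "m' \<in> carrier G" "e' \<in> carrier G" using m' E K.subset by auto
    \<comment> \<open>Inserting the inverse of r' followed by r' exposes a Schreier generator, which
      E absorbs up to a factor in M.\<close>
    have "d \<otimes> y = m \<otimes> (e \<otimes> (r \<otimes> y \<otimes> inv r')) \<otimes> r'"
      using c r'G by (simp add: d group_normalize)
    also have "\<dots> = (m \<otimes> m') \<otimes> (e' \<otimes> r')"
      unfolding m'(3) using c r'G c' by (simp add: m_assoc)
    also have "\<dots> \<in> D" using d m' r' by (intro DI) auto
    finally show ?thesis .
  qed
  have "\<forall>d\<in>D. d \<otimes> g \<in> D" if "g \<in> generate G A" for g
    using that
  proof (induction rule: generate.induct)
    case one
    then show ?case using closedin_subset[OF D] by (auto simp: topspace_eq)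
  next
    case (eng g h)
    then have "g \<in> carrier G" "h \<in> carrier G"
      using generate_in_carrier[OF A(2)] by auto
    then show ?case using eng closedin_subset[OF D] by (auto simp: topspace_eq simp flip: m_assoc)
  qed (use DY in \<open>auto simp: Y_def\<close>)
  moreover have "\<one> \<in> D" using DI[of \<one> \<one> \<one>] E by (simp add: R_def)
  ultimately have "generate G A \<subseteq> D"
    using generate_in_carrier[OF A(2)] by fastforce
  then have "carrier G \<subseteq> D"
    unfolding A(3)[symmetric] closed_generate_def using D by (rule closure_of_minimal)
  have "rcosets M \<subseteq> (\<lambda>b. M #> b) ` B"
  proof
    fix C assume "C \<in> rcosets M"
    then obtain x where x: "x \<in> carrier G" "C = M #> x" by (auto simp: RCOSETS_def)
    with \<open>carrier G \<subseteq> D\<close> obtain b where b: "b \<in> B" "x \<in> M #> b" by (auto simp: D_def)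
    then have "M #> b = M #> x" using B by (intro repr_independence M.is_subgroup) auto
    then show "C \<in> (\<lambda>b. M #> b) ` B" using b x by blast
  qed
  then show ?thesis using B by (meson finite_imageI finite_subset)
qed

lemma lower_p_central_finite_index:
  assumes "finite A" "A \<subseteq> carrier G" "closed_generate G T A = carrier G" "p > 0"
  shows "finite (rcosets (lower_p_central G T p k))"
proof -
  have "finite (rcosets (lower_p_central G T p (Suc k)))" for k
  proof (induction k)
    case 0
    have "rcosets (carrier G) \<subseteq> {carrier G}"
      using coset_join2[OF _ subgroup_self] by (auto simp: RCOSETS_def)
    then show ?case by (simp add: finite_subset)
  next
    case (Suc k)
    show ?case
      by (rule finite_index_step[OF assms(1-3) lower_p_central_normal Suc lower_p_central_normal
          lower_p_central_closed assms(4) lower_p_central_pow lower_p_central_commutator])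
  qed
  from this[of "k - 1"] this[of 0] show ?thesis by (cases k) auto
qed

text \<open>Openness makes the topology of the quotient discrete, so that continuity of cochains on
  the quotient becomes automatic.\<close>

lemma lower_p_central_open:
  assumes "finite A" "A \<subseteq> carrier G" "closed_generate G T A = carrier G" "p > 0"
  shows "openin T (lower_p_central G T p k)"
  using open_of_finite_index[OF normal_imp_subgroup[OF lower_p_central_normal]
      lower_p_central_closed lower_p_central_finite_index[OF assms]] .

end


section \<open>Cohomology classes and the transgression\<close>

lemma Fp_arith:
  assumes "1 < p"
  shows "carrier (Fp p) = {0..<int p}"
    and "a \<oplus>\<^bsub>Fp p\<^esub> b = (a + b) mod int p"
    and "a \<ominus>\<^bsub>Fp p\<^esub> b = (a - b) mod int p"
    and "\<ominus>\<^bsub>Fp p\<^esub> a = (- a) mod int p"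
    and "\<zero>\<^bsub>Fp p\<^esub> = 0"
proof -
  interpret residues "int p" "Fp p" by unfold_locales (use assms in auto)
  show "carrier (Fp p) = {0..<int p}" by (auto simp: res_carrier_eq)
  show "a \<oplus>\<^bsub>Fp p\<^esub> b = (a + b) mod int p" by (rule res_add_eq)
  show "a \<ominus>\<^bsub>Fp p\<^esub> b = (a - b) mod int p"
    unfolding a_minus_def res_add_eq res_neg_eq by (simp add: mod_simps)
  show "\<ominus>\<^bsub>Fp p\<^esub> a = (- a) mod int p" by (rule res_neg_eq)
  show "\<zero>\<^bsub>Fp p\<^esub> = 0" by (rule res_zero_eq)
qed

lemma mod_sum_eqI:
  fixes m :: int
  shows "a + b = c + d \<Longrightarrow> (a mod m + b mod m) mod m = (c mod m + d mod m) mod m"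
  by (simp add: mod_simps)

lemma coboundary_apply:
  assumes "1 < p" "g \<in> carrier G" "h \<in> carrier G"
  shows "coboundary G p y (g, h) = (y h - y (g \<otimes>\<^bsub>G\<^esub> h) + y g) mod int p"
  using assms by (simp add: coboundary_def Fp_arith mod_simps)

lemma coboundary_range:
  "1 < p \<Longrightarrow> g \<in> carrier G \<Longrightarrow> h \<in> carrier G \<Longrightarrow> coboundary G p y (g, h) \<in> {0..<int p}"
  by (simp add: coboundary_apply)

lemma (in normal) rcoset_function:
  assumes "\<And>v g. v \<in> H \<Longrightarrow> g \<in> carrier G \<Longrightarrow> e (v \<otimes> g) = e g"
  shows "\<exists>f. \<forall>g\<in>carrier G. f (H #> g) = e g"
proof (intro exI[of _ "\<lambda>C. e (SOME x. x \<in> C)"] ballI)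
  fix g assume g: "g \<in> carrier G"
  have "(SOME x. x \<in> H #> g) \<in> H #> g"
    using rcos_self[OF g is_subgroup] by (rule someI)
  then obtain v where "v \<in> H" "(SOME x. x \<in> H #> g) = v \<otimes> g" by (auto simp: r_coset_def)
  then show "e (SOME x. x \<in> H #> g) = e g" using assms g by simp
qed

lemma continuous_map_discrete_comp2:
  assumes "continuous_map X (discrete_topology A) f" "continuous_map X (discrete_topology B) g"
    and "\<And>a b. a \<in> A \<Longrightarrow> b \<in> B \<Longrightarrow> h a b \<in> C"
  shows "continuous_map X (discrete_topology C) (\<lambda>x. h (f x) (g x))"
proof -
  have "continuous_map X (discrete_topology (A \<times> B)) (\<lambda>x. (f x, g x))"
    unfolding prod_topology_discrete_topology using assms by (intro continuous_map_pairedI)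
  moreover have "continuous_map (discrete_topology (A \<times> B)) (discrete_topology C) (\<lambda>(a, b). h a b)"
    using assms(3) by auto
  ultimately have "continuous_map X (discrete_topology C) ((\<lambda>(a, b). h a b) \<circ> (\<lambda>x. (f x, g x)))"
    by (rule continuous_map_compose)
  then show ?thesis by (simp add: o_def)
qed

lemma carrier_FactGroup_iff: "C \<in> carrier (G Mod N) \<longleftrightarrow> (\<exists>g\<in>carrier G. C = N #>\<^bsub>G\<^esub> g)"
  by (auto simp: FactGroup_def RCOSETS_def)

section \<open>Classes of two-cocycles on discrete groups as explicit sets\<close>

context
  fixes Q :: "('q, 'm) monoid_scheme" and p :: nat
  assumes p: "1 < p"
begin

lemma Z2_discrete_iff:
  "z \<in> carrier (Z2 Q (discrete_topology (carrier Q)) p) \<longleftrightarrow>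
    z \<in> carrier Q \<times> carrier Q \<rightarrow>\<^sub>E {0..<int p} \<and>
    (\<forall>g \<in> carrier Q. \<forall>h \<in> carrier Q. \<forall>k \<in> carrier Q.
      (z (h, k) + z (g, h \<otimes>\<^bsub>Q\<^esub> k)) mod int p = (z (g \<otimes>\<^bsub>Q\<^esub> h, k) + z (g, h)) mod int p)"
  by (auto simp: Z2_def Fp_arith[OF p] simp flip: prod_topology_discrete_topology)

lemma H2_class_discrete:
  "H2_class Q (discrete_topology (carrier Q)) p z =
    {\<lambda>u \<in> carrier Q \<times> carrier Q. (coboundary Q p e u + z u) mod int p | e. e \<in> carrier Q \<rightarrow> {0..<int p}}"
  by (auto simp: H2_class_def B2_def r_coset_def Z2_def Fp_arith[OF p])

text \<open>The witness e may take arbitrary integer values; it is added to the cochain of a given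
  element of the class and the sum is reduced modulo p. The converse inclusion is the same argument
  for - e.\<close>

lemma H2_class_eqI:
  assumes "group Q"
    and eq: "\<And>g h. g \<in> carrier Q \<Longrightarrow> h \<in> carrier Q \<Longrightarrow>
      [z' (g, h) = z (g, h) + (e h - e (g \<otimes>\<^bsub>Q\<^esub> h) + e g)] (mod int p)"
  shows "H2_class Q (discrete_topology (carrier Q)) p z' = H2_class Q (discrete_topology (carrier Q)) p z"
proof -
  interpret group Q by fact
  have sub: "H2_class Q (discrete_topology (carrier Q)) p z' \<subseteq> H2_class Q (discrete_topology (carrier Q)) p z"
    if eq: "\<And>g h. g \<in> carrier Q \<Longrightarrow> h \<in> carrier Q \<Longrightarrow>
      [z' (g, h) = z (g, h) + (e h - e (g \<otimes>\<^bsub>Q\<^esub> h) + e g)] (mod int p)" for z z' e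
  proof
    fix c assume "c \<in> H2_class Q (discrete_topology (carrier Q)) p z'"
    then obtain f where f: "f \<in> carrier Q \<rightarrow> {0..<int p}"
      and c: "c = (\<lambda>u \<in> carrier Q \<times> carrier Q. (coboundary Q p f u + z' u) mod int p)"
      by (auto simp: H2_class_discrete)
    define d where "d x = (f x + e x) mod int p" for x
    have "c = (\<lambda>u \<in> carrier Q \<times> carrier Q. (coboundary Q p d u + z u) mod int p)"
    proof
      fix u
      show "c u = (\<lambda>u \<in> carrier Q \<times> carrier Q. (coboundary Q p d u + z u) mod int p) u"
      proof (cases "u \<in> carrier Q \<times> carrier Q")
        case True
        then obtain g h where u: "u = (g, h)" "g \<in> carrier Q" "h \<in> carrier Q" by auto
        let ?gh = "g \<otimes>\<^bsub>Q\<^esub> h"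
        have d: "[d x = f x + e x] (mod int p)" for x by (simp add: d_def cong_def)
        have "[coboundary Q p d u = (f h + e h) - (f ?gh + e ?gh) + (f g + e g)] (mod int p)"
          unfolding u coboundary_apply[OF p u(2,3)] cong_mod_left by (intro cong_add cong_diff d)
        then have "[coboundary Q p d u + z u = (f h + e h) - (f ?gh + e ?gh) + (f g + e g) + z u] (mod int p)"
          by (intro cong_add cong_refl)
        also have "(f h + e h) - (f ?gh + e ?gh) + (f g + e g) + z u =
            (f h - f ?gh + f g) + (z u + (e h - e ?gh + e g))" by simp
        also have "[\<dots> = coboundary Q p f u + z' u] (mod int p)"
          unfolding u coboundary_apply[OF p u(2,3)] 
          using eq[OF u(2,3)] by (intro cong_add) (auto simp: cong_sym)
        finally show ?thesis using True by (simp add: c cong_def)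
      qed (simp add: c)
    qed
    moreover have "d \<in> carrier Q \<rightarrow> {0..<int p}" using p by (auto simp: d_def)
    ultimately show "c \<in> H2_class Q (discrete_topology (carrier Q)) p z"
      unfolding H2_class_discrete by blast
  qed
  have "[z (g, h) = z' (g, h) + (- e h - - e (g \<otimes>\<^bsub>Q\<^esub> h) + - e g)] (mod int p)"
    if "g \<in> carrier Q" "h \<in> carrier Q" for g h
    using eq[OF that] by (simp add: cong_iff_dvd_diff dvd_diff_commute algebra_simps)
  from sub[OF eq] sub[of z z' "\<lambda>x. - e x", OF this] show ?thesis by blast
qed

text \<open>As z' is extensional with reduced values, it belongs to its own class through the zero
  cochain; membership in the class of z then yields e.\<close>

lemma H2_class_eqD:
  assumes "group Q" and z': "z' \<in> carrier Q \<times> carrier Q \<rightarrow>\<^sub>E {0..<int p}"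
    and eq: "H2_class Q (discrete_topology (carrier Q)) p z' = H2_class Q (discrete_topology (carrier Q)) p z"
  shows "\<exists>e \<in> carrier Q \<rightarrow> {0..<int p}. \<forall>g \<in> carrier Q. \<forall>h \<in> carrier Q.
      [z' (g, h) = z (g, h) + (e h - e (g \<otimes>\<^bsub>Q\<^esub> h) + e g)] (mod int p)"
proof -
  interpret group Q by fact
  have "z' = (\<lambda>u \<in> carrier Q \<times> carrier Q. (coboundary Q p (\<lambda>_. 0) u + z' u) mod int p)"
  proof
    fix u
    show "z' u = (\<lambda>u \<in> carrier Q \<times> carrier Q. (coboundary Q p (\<lambda>_. 0) u + z' u) mod int p) u"
    proof (cases "u \<in> carrier Q \<times> carrier Q")
      case True
      then have "z' u \<in> {0..<int p}" using z' by blast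
      then show ?thesis using True by (auto simp: coboundary_apply[OF p])
    next
      case False
      then show ?thesis using PiE_arb[OF z'] by simp
    qed
  qed
  moreover have "(\<lambda>_. 0) \<in> carrier Q \<rightarrow> {0..<int p}" using p by auto
  ultimately have "z' \<in> H2_class Q (discrete_topology (carrier Q)) p z'"
    unfolding H2_class_discrete by blast
  from this[unfolded eq] obtain e where e: "e \<in> carrier Q \<rightarrow> {0..<int p}"
    and z'_eq: "z' = (\<lambda>u \<in> carrier Q \<times> carrier Q. (coboundary Q p e u + z u) mod int p)"
    unfolding H2_class_discrete mem_Collect_eq by iprover
  have "[z' (g, h) = z (g, h) + (e h - e (g \<otimes>\<^bsub>Q\<^esub> h) + e g)] (mod int p)"
    if "g \<in> carrier Q" "h \<in> carrier Q" for g h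
    using that by (subst z'_eq) (simp add: cong_def coboundary_apply[OF p] mod_simps algebra_simps)
  then show ?thesis using e by blast
qed

end

text \<open>The condition inside the set in \<open>transgression\<close>, named so that existence of
  a cochain and independence of its choice can be stated separately.\<close>

definition transgression_cochain ::
    "('g, 'm) monoid_scheme \<Rightarrow> 'g topology \<Rightarrow> 'g set \<Rightarrow> nat \<Rightarrow> ('g \<Rightarrow> int) \<Rightarrow>
      ('g set \<times> 'g set \<Rightarrow> int) \<Rightarrow> ('g \<Rightarrow> int) \<Rightarrow> bool" where
  "transgression_cochain S T N p \<psi> z y \<longleftrightarrow>
     z \<in> carrier (Z2 (S Mod N) (quotient_topology T (carrier (S Mod N))) p) \<and>
     continuous_map T (Fp_topology p) y \<and> (\<forall>v \<in> N. y v = \<psi> v) \<and>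
     (\<forall>g \<in> carrier S. \<forall>h \<in> carrier S. z (N #>\<^bsub>S\<^esub> g, N #>\<^bsub>S\<^esub> h) = coboundary S p y (g, h))"

lemma transgression_eq_the_elem:
  "transgression S T N p \<psi> =
    the_elem {H2_class (S Mod N) (quotient_topology T (carrier (S Mod N))) p z | z y.
      transgression_cochain S T N p \<psi> z y}"
  by (simp add: transgression_def transgression_cochain_def Let_def)

locale open_normal = topological_group S T + normal N S
  for S :: "('g, 'm) monoid_scheme" (structure) and T and N +
  fixes p :: nat
  assumes openN: "openin T N" and p: "1 < p"
begin

lemma group_quotient: "group (S Mod N)"
  by (rule factorgroup_is_group)

lemma quotient_topology_discrete:
  "quotient_topology T (carrier (S Mod N)) = discrete_topology (carrier (S Mod N))"
proof -
  have "openin T (\<Union>U)" if U: "U \<subseteq> carrier (S Mod N)" for U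
  proof (rule openin_Union)
    fix C assume "C \<in> U"
    then have "C \<in> carrier (S Mod N)" using U by blast
    then obtain g where "g \<in> carrier S" "C = N #> g" by (auto simp: carrier_FactGroup_iff)
    then show "openin T C" using open_rcoset[OF is_subgroup openN] by simp
  qed
  then have "(U \<subseteq> carrier (S Mod N) \<and> openin T (\<Union>U)) = (U \<subseteq> carrier (S Mod N))" for U
    by iprover
  then have "(\<lambda>U. U \<subseteq> carrier (S Mod N) \<and> openin T (\<Union>U)) = (\<lambda>U. U \<subseteq> carrier (S Mod N))"
    by (simp only:)
  then show ?thesis by (simp add: quotient_topology_def discrete_topology_def)
qed

lemma rcoset_in_quotient: "g \<in> carrier S \<Longrightarrow> N #> g \<in> carrier (S Mod N)"
  by (auto simp: carrier_FactGroup_iff)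

lemma quotient_mult:
  "g \<in> carrier S \<Longrightarrow> h \<in> carrier S \<Longrightarrow> (N #> g) \<otimes>\<^bsub>S Mod N\<^esub> (N #> h) = N #> (g \<otimes> h)"
  by (simp add: rcos_sum)

text \<open>The coboundary agrees at (v, g) and (1, g), since the cosets agree, and this gives y (v
  g) = y g + \<psi> v - \<psi> 1 modulo p. The correction depends on \<psi> only, so y' - y is
  constant on cosets and descends to a cochain on the quotient with coboundary z' - z.\<close>

lemma transgression_cochain_class_unique:
  assumes c: "transgression_cochain S T N p \<psi> z y" "transgression_cochain S T N p \<psi> z' y'"
  shows "H2_class (S Mod N) (quotient_topology T (carrier (S Mod N))) p z' =
    H2_class (S Mod N) (quotient_topology T (carrier (S Mod N))) p z"
proof -
  define e where "e g = (y' g - y g) mod int p" for g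
  have y_N: "[y (v \<otimes> g) = y g + \<psi> v - \<psi> \<one>] (mod int p)"
    if c: "transgression_cochain S T N p \<psi> z y" and v: "v \<in> N" and g: "g \<in> carrier S" for z y v g
  proof -
    have "N #> v = N #> \<one>"
      using v by (simp add: coset_join2 is_subgroup)
    then have "coboundary S p y (v, g) = coboundary S p y (\<one>, g)"
      using c v g unfolding transgression_cochain_def by (metis mem_carrier one_closed)
    then have "[y g - y (v \<otimes> g) + y v = y g - y g + y \<one>] (mod int p)"
      using v g by (simp add: coboundary_apply[OF p] cong_def)
    moreover have "y v = \<psi> v" "y \<one> = \<psi> \<one>"
      using c v subgroup.one_closed[OF is_subgroup] by (auto simp: transgression_cochain_def)
    ultimately have "int p dvd (y g - y (v \<otimes> g) + \<psi> v) - \<psi> \<one>"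
      by (simp add: cong_iff_dvd_diff)
    then have "int p dvd - ((y g - y (v \<otimes> g) + \<psi> v) - \<psi> \<one>)" by (simp only: dvd_minus_iff)
    then show ?thesis by (simp add: cong_iff_dvd_diff algebra_simps)
  qed
  have "e (v \<otimes> g) = e g" if "v \<in> N" "g \<in> carrier S" for v g
    using cong_diff[OF y_N[OF c(2) that] y_N[OF c(1) that]] by (simp add: e_def cong_def)
  from rcoset_function[OF this] obtain f where f: "\<And>g. g \<in> carrier S \<Longrightarrow> f (N #> g) = e g" by blast
  show ?thesis
    unfolding quotient_topology_discrete
  proof (rule H2_class_eqI[OF p group_quotient])
    fix C D assume "C \<in> carrier (S Mod N)" "D \<in> carrier (S Mod N)"
    then obtain g h where g: "g \<in> carrier S" "C = N #> g" and h: "h \<in> carrier S" "D = N #> h"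
      by (auto simp: carrier_FactGroup_iff)
    have z: "z (C, D) = (y h - y (g \<otimes> h) + y g) mod int p"
        "z' (C, D) = (y' h - y' (g \<otimes> h) + y' g) mod int p"
      using c g h by (simp_all add: transgression_cochain_def coboundary_apply[OF p])
    have gh: "g \<otimes> h \<in> carrier S" using g h by simp
    have f_eq: "f C = e g" "f D = e h" "f (C \<otimes>\<^bsub>S Mod N\<^esub> D) = e (g \<otimes> h)"
      using f[OF g(1)] f[OF h(1)] f[OF gh]
      by (simp_all only: g(2) h(2) quotient_mult[OF g(1) h(1)])
    have e: "[e x = y' x - y x] (mod int p)" for x by (simp add: e_def cong_def)
    have "[(y h - y (g \<otimes> h) + y g) mod int p + (e h - e (g \<otimes> h) + e g) =
        (y h - y (g \<otimes> h) + y g) + ((y' h - y h) - (y' (g \<otimes> h) - y (g \<otimes> h)) + (y' g - y g))] (mod int p)"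
      by (intro cong_add cong_diff e) simp
    also have "(y h - y (g \<otimes> h) + y g) + ((y' h - y h) - (y' (g \<otimes> h) - y (g \<otimes> h)) + (y' g - y g)) =
        y' h - y' (g \<otimes> h) + y' g" by simp
    finally have cong: "[(y h - y (g \<otimes> h) + y g) mod int p + (e h - e (g \<otimes> h) + e g) =
        y' h - y' (g \<otimes> h) + y' g] (mod int p)" .
    show "[z' (C, D) = z (C, D) + (f D - f (C \<otimes>\<^bsub>S Mod N\<^esub> D) + f C)] (mod int p)"
      unfolding z f_eq cong_mod_left using cong by (rule cong_sym)
  qed
qed

lemma transgression_eq:
  assumes "transgression_cochain S T N p \<psi> z y"
  shows "transgression S T N p \<psi> = H2_class (S Mod N) (quotient_topology T (carrier (S Mod N))) p z"
proof -
  have "{H2_class (S Mod N) (quotient_topology T (carrier (S Mod N))) p z | z y.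
      transgression_cochain S T N p \<psi> z y} =
      {H2_class (S Mod N) (quotient_topology T (carrier (S Mod N))) p z}"
    using assms transgression_cochain_class_unique[OF assms] by blast
  then show ?thesis by (simp add: transgression_eq_the_elem)
qed

lemma H1_invariantsD:
  assumes "\<psi> \<in> H1_invariants S T N p"
  shows "\<And>u v. u \<in> N \<Longrightarrow> v \<in> N \<Longrightarrow> \<psi> (u \<otimes> v) = (\<psi> u + \<psi> v) mod int p"
    and "\<And>v. v \<in> N \<Longrightarrow> \<psi> v \<in> {0..<int p}"
    and "\<psi> \<in> extensional N"
    and "\<And>s v. s \<in> carrier S \<Longrightarrow> v \<in> N \<Longrightarrow> \<psi> (s \<otimes> v \<otimes> inv s) = \<psi> v"
    and "continuous_map (subtopology T N) (Fp_topology p) \<psi>"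
proof -
  show "\<psi> (u \<otimes> v) = (\<psi> u + \<psi> v) mod int p" if "u \<in> N" "v \<in> N" for u v
    using assms that by (auto simp: H1_invariants_def hom_def Fp_arith[OF p])
  show "\<psi> v \<in> {0..<int p}" if "v \<in> N" for v
    using assms that by (auto simp: H1_invariants_def hom_def Pi_iff Fp_arith[OF p])
  show "\<psi> \<in> extensional N" "continuous_map (subtopology T N) (Fp_topology p) \<psi>"
    using assms by (auto simp: H1_invariants_def)
  fix s v assume s: "s \<in> carrier S" "v \<in> N"
  have "\<psi> (inv (inv s) \<otimes> v \<otimes> inv s) = \<psi> v"
    using assms s unfolding H1_invariants_def by blast
  then show "\<psi> (s \<otimes> v \<otimes> inv s) = \<psi> v" using s by simp
qed

text \<open>With coset representatives r, the map y applies \<psi> to the quotient of g by its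
  representative. Invariance of \<psi> under conjugation makes y shift by \<psi> v when g is
  multiplied by v in N on either side, so its coboundary depends on the cosets only.\<close>

lemma transgression_cochain_exists:
  assumes psi: "\<psi> \<in> H1_invariants S T N p"
  shows "\<exists>z y. transgression_cochain S T N p \<psi> z y"
proof -
  note psiD = H1_invariantsD[OF psi]
  \<comment> \<open>The coset N itself is represented by the identity, so that y restricts to \<psi>
    on N.\<close>
  define r where "r C = (if C = N then \<one> else SOME x. x \<in> C)" for C
  have r: "r C \<in> C" "r C \<in> carrier S" if C: "C \<in> carrier (S Mod N)" for C
  proof -
    obtain g where g: "g \<in> carrier S" "C = N #> g" using C by (auto simp: carrier_FactGroup_iff)
    have "(SOME x. x \<in> C) \<in> C" using rcos_self[OF g(1) is_subgroup] unfolding g(2) by (rule someI)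
    then show "r C \<in> C" using subgroup.one_closed[OF is_subgroup] by (auto simp: r_def)
    then show "r C \<in> carrier S" using g elemrcos_carrier[OF is_group] by blast
  qed
  have coset_r: "N #> r C = C" if C: "C \<in> carrier (S Mod N)" for C
  proof -
    obtain g where g: "g \<in> carrier S" "C = N #> g" using C by (auto simp: carrier_FactGroup_iff)
    show ?thesis using repr_independence[of "r C" N g] r(1)[OF C] g is_subgroup by simp
  qed
  have r_diff: "g \<otimes> inv r (N #> g) \<in> N" if g: "g \<in> carrier S" for g
  proof -
    have C: "N #> g \<in> carrier (S Mod N)" using g by (rule rcoset_in_quotient)
    have "g \<in> N #> r (N #> g)" using rcos_self[OF g is_subgroup] coset_r[OF C] by simp
    then show ?thesis using rcos_module_imp[OF is_group r(2)[OF C]] by blast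
  qed
  define y where "y g = \<psi> (g \<otimes> inv r (N #> g))" for g
  have y_range: "y g \<in> {0..<int p}" if "g \<in> carrier S" for g
    unfolding y_def by (rule psiD(2)[OF r_diff[OF that]])
  have y_left: "y (v \<otimes> g) = (\<psi> v + y g) mod int p" if v: "v \<in> N" and g: "g \<in> carrier S" for v g
  proof -
    have C: "N #> g \<in> carrier (S Mod N)" using g by (rule rcoset_in_quotient)
    have "N #> (v \<otimes> g) = N #> g"
      using coset_mult_assoc[of N v g] coset_join2[OF mem_carrier[OF v] is_subgroup v] v g subset by simp
    moreover have "v \<otimes> g \<otimes> inv r (N #> g) = v \<otimes> (g \<otimes> inv r (N #> g))"
      using v g r(2)[OF C] by (simp add: m_assoc)
    ultimately show ?thesis using psiD(1)[OF v r_diff[OF g]] by (simp add: y_def)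
  qed
  have y_right: "y (g \<otimes> v) = (\<psi> v + y g) mod int p" if v: "v \<in> N" and g: "g \<in> carrier S" for v g
  proof -
    have "g \<otimes> v = (g \<otimes> v \<otimes> inv g) \<otimes> g" using v g by (simp add: m_assoc)
    then show ?thesis using y_left[OF inv_op_closed2[OF g v] g] psiD(4)[OF g v] by simp
  qed
  have y_N: "y v = \<psi> v" if "v \<in> N" for v
  proof -
    have "N #> v = N" using that by (simp add: coset_join2 is_subgroup)
    then show ?thesis using that by (simp add: y_def r_def)
  qed
  have y_cont: "continuous_map T (Fp_topology p) y"
    unfolding continuous_map_def
  proof (intro conjI allI impI)
    show "y \<in> topspace T \<rightarrow> topspace (Fp_topology p)"
      using y_range by (simp add: topspace_eq Fp_arith[OF p])
    fix U assume U: "openin (Fp_topology p) U"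
    define W where "W = {x \<in> N. \<psi> x \<in> U}"
    have "openin (subtopology T N) {x \<in> topspace (subtopology T N). \<psi> x \<in> U}"
      using psiD(5) U by (rule openin_continuous_map_preimage)
    moreover have "topspace (subtopology T N) = N" using subset by (auto simp: topspace_eq)
    ultimately have W: "openin T W"
      using openin_trans_full openN unfolding W_def by metis
    \<comment> \<open>On each coset y is a translate of \<psi>, so its preimages are unions of
      translates of open subsets of N.\<close>
    have "{x \<in> topspace T. y x \<in> U} =
        (\<Union>C\<in>carrier (S Mod N). {x \<in> topspace T. x \<otimes> inv r C \<in> W})" (is "?L = ?R")
    proof (intro subset_antisym subsetI)
      fix x assume x: "x \<in> ?L"
      then have "x \<in> carrier S" by (simp add: topspace_eq)
      then show "x \<in> ?R" using x r_diff[of x] rcoset_in_quotient[of x] by (auto simp: W_def y_def)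
    next
      fix x assume "x \<in> ?R"
      then obtain C where C: "C \<in> carrier (S Mod N)" and x: "x \<in> carrier S" "x \<otimes> inv r C \<in> W"
        by (auto simp: topspace_eq)
      have "x \<in> N #> r C" using x by (intro rcos_module_rev[OF is_group r(2)[OF C]]) (auto simp: W_def)
      then have "N #> x = N #> r C" using repr_independence[OF _ r(2)[OF C] is_subgroup] by simp
      then have "N #> x = C" using coset_r[OF C] by simp
      then show "x \<in> ?L" using x by (simp add: topspace_eq W_def y_def)
    qed
    moreover have "openin T ?R"
      using openin_continuous_map_preimage[OF continuous_mult_right W] r(2)
      by (intro openin_Union) auto
    ultimately show "openin T {x \<in> topspace T. y x \<in> U}" by simp
  qed
  define z where "z = (\<lambda>(C, D) \<in> carrier (S Mod N) \<times> carrier (S Mod N). coboundary S p y (r C, r D))"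
  have z_eq: "z (N #> g, N #> h) = coboundary S p y (g, h)"
    if g: "g \<in> carrier S" and h: "h \<in> carrier S" for g h
  proof -
    define a b where "a = r (N #> g)" and "b = r (N #> h)"
    have a: "a \<in> carrier S" and b: "b \<in> carrier S"
      using g h r(2) rcoset_in_quotient by (simp_all add: a_def b_def)
    define u v where "u = g \<otimes> inv a" and "v = h \<otimes> inv b"
    have u: "u \<in> N" "u \<in> carrier S" and v: "v \<in> N" "v \<in> carrier S"
      using r_diff g h mem_carrier by (simp_all add: a_def b_def u_def v_def)
    have g_eq: "g = u \<otimes> a" and h_eq: "h = v \<otimes> b"
      using g h a b by (simp_all add: u_def v_def m_assoc)
    \<comment> \<open>v is moved to the left of a by conjugation, which does not change the value of
      \<psi>.\<close>
    have "y (a \<otimes> (v \<otimes> b)) = (\<psi> v + y (a \<otimes> b)) mod int p"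
    proof -
      have "a \<otimes> (v \<otimes> b) = (a \<otimes> v \<otimes> inv a) \<otimes> (a \<otimes> b)"
        using a b v by (simp add: group_normalize)
      then show ?thesis using y_left[OF inv_op_closed2[OF a v(1)], of "a \<otimes> b"] psiD(4)[OF a v(1)] a b
        by simp
    qed
    then have "y (g \<otimes> h) = (\<psi> u + (\<psi> v + y (a \<otimes> b))) mod int p"
      using y_left[OF u(1), of "a \<otimes> (v \<otimes> b)"] a b u v by (simp add: g_eq h_eq m_assoc mod_simps)
    then have "[y (g \<otimes> h) = \<psi> u + (\<psi> v + y (a \<otimes> b))] (mod int p)" by (simp add: cong_def)
    moreover have "[y g = \<psi> u + y a] (mod int p)" "[y h = \<psi> v + y b] (mod int p)"
      using y_left u v a b by (simp_all add: g_eq h_eq cong_def)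
    ultimately have "[y h - y (g \<otimes> h) + y g =
        (\<psi> v + y b) - (\<psi> u + (\<psi> v + y (a \<otimes> b))) + (\<psi> u + y a)] (mod int p)"
      by (intro cong_add cong_diff)
    then have "coboundary S p y (g, h) = coboundary S p y (a, b)"
      using g h a b by (simp add: coboundary_apply[OF p] cong_def algebra_simps)
    then show ?thesis using g h by (simp add: z_def rcoset_in_quotient a_def b_def)
  qed
  have "z \<in> carrier (Z2 (S Mod N) (discrete_topology (carrier (S Mod N))) p)"
    unfolding Z2_discrete_iff[OF p]
  proof (intro conjI ballI)
    show "z \<in> carrier (S Mod N) \<times> carrier (S Mod N) \<rightarrow>\<^sub>E {0..<int p}"
      unfolding z_def by (intro PiE_I) (use coboundary_range[OF p, where G = S] r(2) in auto)
    fix A B C assume "A \<in> carrier (S Mod N)" "B \<in> carrier (S Mod N)" "C \<in> carrier (S Mod N)"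
    then obtain a b c where a: "a \<in> carrier S" "A = N #> a" and b: "b \<in> carrier S" "B = N #> b"
      and c: "c \<in> carrier S" "C = N #> c"
      by (auto simp: carrier_FactGroup_iff)
    show "(z (B, C) + z (A, B \<otimes>\<^bsub>S Mod N\<^esub> C)) mod int p = (z (A \<otimes>\<^bsub>S Mod N\<^esub> B, C) + z (A, B)) mod int p"
      unfolding a b c quotient_mult[OF a(1) b(1)] quotient_mult[OF b(1) c(1)]
      using a b c
      by (simp only: z_eq coboundary_apply[OF p] Group.monoid.m_closed[OF monoid_axioms], intro mod_sum_eqI, simp add: m_assoc)
  qed
  then have "transgression_cochain S T N p \<psi> z y"
    using y_cont y_N z_eq by (simp add: transgression_cochain_def quotient_topology_discrete)
  then show ?thesis by blast
qed

text \<open>Exactness of the five-term sequence at the invariant homomorphisms. If the classes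
  agree, y' - y corrected by the cochain e of the quotient is a continuous homomorphism on all of S.
  By hypothesis it vanishes on N, where it equals \<psi>' - \<psi> up to the constant
  \<open>e N\<close>.\<close>

lemma transgression_inj:
  assumes hom0: "\<And>f v. continuous_map T (Fp_topology p) f \<Longrightarrow>
      (\<And>g h. g \<in> carrier S \<Longrightarrow> h \<in> carrier S \<Longrightarrow> f (g \<otimes> h) = (f g + f h) mod int p) \<Longrightarrow>
      v \<in> N \<Longrightarrow> f v = 0"
  shows "inj_on (transgression S T N p) (H1_invariants S T N p)"
proof (rule inj_onI)
  fix \<psi> \<psi>' assume psi: "\<psi> \<in> H1_invariants S T N p" "\<psi>' \<in> H1_invariants S T N p"
    and eq: "transgression S T N p \<psi> = transgression S T N p \<psi>'"
  obtain z y z' y' where c: "transgression_cochain S T N p \<psi> z y" "transgression_cochain S T N p \<psi>' z' y'"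
    using transgression_cochain_exists psi by meson
  have "H2_class (S Mod N) (discrete_topology (carrier (S Mod N))) p z' =
      H2_class (S Mod N) (discrete_topology (carrier (S Mod N))) p z"
    using eq c[THEN transgression_eq] by (simp add: quotient_topology_discrete)
  moreover have "z' \<in> carrier (S Mod N) \<times> carrier (S Mod N) \<rightarrow>\<^sub>E {0..<int p}"
    using c(2) by (simp add: transgression_cochain_def quotient_topology_discrete Z2_discrete_iff[OF p])
  ultimately obtain e where e: "e \<in> carrier (S Mod N) \<rightarrow> {0..<int p}"
    and ze: "\<And>C D. C \<in> carrier (S Mod N) \<Longrightarrow> D \<in> carrier (S Mod N) \<Longrightarrow>
      [z' (C, D) = z (C, D) + (e D - e (C \<otimes>\<^bsub>S Mod N\<^esub> D) + e C)] (mod int p)"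
    using H2_class_eqD[OF p group_quotient] by meson
  define k where "k g = (e (N #> g) + y g) mod int p" for g
  define f where "f g = (y' g - k g) mod int p" for g
  have e_cont: "continuous_map T (Fp_topology p) (\<lambda>g. e (N #> g))"
    unfolding continuous_map_def
  proof (intro conjI allI impI)
    show "(\<lambda>g. e (N #> g)) \<in> topspace T \<rightarrow> topspace (Fp_topology p)"
      using e rcoset_in_quotient by (auto simp: topspace_eq Fp_arith[OF p])
    fix U
    have "{g \<in> topspace T. e (N #> g) \<in> U} =
        \<Union>{N #> g | g. g \<in> carrier S \<and> e (N #> g) \<in> U}" (is "?L = \<Union>?R")
    proof (intro subset_antisym subsetI)
      fix x assume "x \<in> ?L"
      then show "x \<in> \<Union>?R" using rcos_self[OF _ is_subgroup] by (auto simp: topspace_eq)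
    next
      fix x assume "x \<in> \<Union>?R"
      then obtain g where g: "g \<in> carrier S" "e (N #> g) \<in> U" "x \<in> N #> g" by blast
      then have "x \<in> carrier S" "N #> x = N #> g"
        using elemrcos_carrier[OF is_group] repr_independence[OF g(3,1) is_subgroup] by auto
      then show "x \<in> ?L" using g by (simp add: topspace_eq)
    qed
    moreover have "openin T (\<Union>?R)"
      using open_rcoset[OF is_subgroup openN] by (intro openin_Union) auto
    ultimately show "openin T {g \<in> topspace T. e (N #> g) \<in> U}" by simp
  qed
  have y_cont: "continuous_map T (Fp_topology p) y" "continuous_map T (Fp_topology p) y'"
    using c by (simp_all add: transgression_cochain_def)
  have "continuous_map T (Fp_topology p) k"
    unfolding k_def
    by (rule continuous_map_discrete_comp2[OF e_cont y_cont(1)]) (use p in \<open>simp add: Fp_arith\<close>)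
  then have f_cont: "continuous_map T (Fp_topology p) f"
    unfolding f_def
    by (rule continuous_map_discrete_comp2[OF y_cont(2)]) (use p in \<open>simp add: Fp_arith\<close>)
  have f_hom: "f (g \<otimes> h) = (f g + f h) mod int p" if g: "g \<in> carrier S" and h: "h \<in> carrier S" for g h
  proof -
    have z: "z (N #> g, N #> h) = (y h - y (g \<otimes> h) + y g) mod int p"
        "z' (N #> g, N #> h) = (y' h - y' (g \<otimes> h) + y' g) mod int p"
      using c g h by (simp_all add: transgression_cochain_def coboundary_apply[OF p])
    have "[z' (N #> g, N #> h) = z (N #> g, N #> h) +
        (e (N #> h) - e (N #> (g \<otimes> h)) + e (N #> g))] (mod int p)"
      using ze[OF rcoset_in_quotient[OF g] rcoset_in_quotient[OF h]] quotient_mult[OF g h] by simp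
    then have "[y' h - y' (g \<otimes> h) + y' g = y h - y (g \<otimes> h) + y g +
        (e (N #> h) - e (N #> (g \<otimes> h)) + e (N #> g))] (mod int p)"
      unfolding z by (simp add: cong_def mod_simps)
    then have "int p dvd (y' h - y' (g \<otimes> h) + y' g) - (y h - y (g \<otimes> h) + y g +
        (e (N #> h) - e (N #> (g \<otimes> h)) + e (N #> g)))" by (simp only: cong_iff_dvd_diff)
    then have "int p dvd - ((y' h - y' (g \<otimes> h) + y' g) - (y h - y (g \<otimes> h) + y g +
        (e (N #> h) - e (N #> (g \<otimes> h)) + e (N #> g))))" by (simp only: dvd_minus_iff)
    then have "[y' (g \<otimes> h) - (e (N #> (g \<otimes> h)) + y (g \<otimes> h)) =
      (y' g - (e (N #> g) + y g)) + (y' h - (e (N #> h) + y h))] (mod int p)"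
      by (simp add: cong_iff_dvd_diff algebra_simps)
    then show ?thesis by (simp add: f_def k_def cong_def mod_simps)
  qed
  have f0: "f v = 0" if "v \<in> N" for v using hom0[OF f_cont f_hom that] .
  have one: "\<one> \<in> N" by (rule subgroup.one_closed[OF is_subgroup])
  have psi1: "\<psi> \<one> = 0" if "\<psi> \<in> H1_invariants S T N p" for \<psi>
  proof -
    have "\<psi> \<one> mod int p = \<psi> \<one>" using H1_invariantsD(2)[OF that one] by simp
    then have "[\<psi> \<one> + \<psi> \<one> = \<psi> \<one> + 0] (mod int p)"
      using H1_invariantsD(1)[OF that one one, symmetric] by (simp add: cong_def)
    then have "[\<psi> \<one> = 0] (mod int p)" using cong_add_lcancel by blast
    then show ?thesis using H1_invariantsD(2)[OF that one] by (simp add: cong_def)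
  qed
  have yN: "y v = \<psi> v" "y' v = \<psi>' v" if "v \<in> N" for v
    using c that by (auto simp: transgression_cochain_def)
  \<comment> \<open>Evaluation at the identity, where f and both homomorphisms vanish, removes the
    constant.\<close>
  have eN: "e N mod int p = 0"
  proof -
    have "N #> \<one> = N" by (simp add: coset_join2 is_subgroup one)
    then have "(- e N) mod int p = 0"
      using f0[OF one] yN[OF one] psi1[OF psi(1)] psi1[OF psi(2)]
      by (simp add: f_def k_def mod_simps)
    then show ?thesis by (simp add: mod_eq_0_iff_dvd)
  qed
  show "\<psi> = \<psi>'"
  proof (rule extensionalityI[OF H1_invariantsD(3)[OF psi(1)] H1_invariantsD(3)[OF psi(2)]])
    fix v assume v: "v \<in> N"
    have "N #> v = N" using v by (simp add: coset_join2 is_subgroup)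
    then have "(\<psi>' v - (e N + \<psi> v)) mod int p = 0"
      using f0[OF v] yN[OF v] by (simp add: f_def k_def mod_simps)
    moreover have "int p dvd e N" using eN by presburger
    ultimately have "int p dvd (\<psi>' v - (e N + \<psi> v)) + e N" by (intro dvd_add) auto
    then have "int p dvd \<psi>' v - \<psi> v" by simp
    then have "\<psi>' v mod int p = \<psi> v mod int p" by (simp add: mod_eq_dvd_iff)
    then show "\<psi> v = \<psi>' v"
      using H1_invariantsD(2)[OF psi(1) v] H1_invariantsD(2)[OF psi(2) v] by simp
  qed
qed

end


section \<open>Pairing with a pulled back central extension\<close>

text \<open>The central kernel is parametrized by the integers through a homomorphism \<kappa> with
  kernel generated by p. Without residues as arguments, products of central factors become plain
  sums and cocycle identities become congruences modulo p.\<close>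

locale central_quotient = normal F U
  for F and U :: "('u, 'm) monoid_scheme" (structure) +
  fixes \<kappa> :: "int \<Rightarrow> 'u" and p :: nat
  assumes p: "1 < p"
    and kappa_closed [simp]: "\<kappa> a \<in> carrier U"
    and kappa_add: "\<kappa> (a + b) = \<kappa> a \<otimes> \<kappa> b"
    and kappa_central: "x \<in> carrier U \<Longrightarrow> x \<otimes> \<kappa> a = \<kappa> a \<otimes> x"
    and kappa_eq_iff: "\<kappa> a = \<kappa> b \<longleftrightarrow> [a = b] (mod int p)"
    and F_subset: "F \<subseteq> range \<kappa>"
begin

text \<open>The same expression as the identification in \<open>omega\<close>, so that
  \<open>omega\<close> unfolds to a class of \<open>section_cocycle\<close>.\<close>

definition kernel_coord :: "'u \<Rightarrow> int" where
  "kernel_coord = the_inv_into (carrier (Fp p)) \<kappa>"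

lemma kernel_coord:
  assumes "x \<in> F"
  shows "\<kappa> (kernel_coord x) = x" "kernel_coord x \<in> {0..<int p}"
proof -
  have inj: "inj_on \<kappa> (carrier (Fp p))"
    by (rule inj_onI) (use p in \<open>simp add: kappa_eq_iff Fp_arith cong_def\<close>)
  obtain a where "x = \<kappa> a" using assms F_subset by blast
  then have a: "x = \<kappa> (a mod int p)" by (simp add: kappa_eq_iff)
  moreover have "a mod int p \<in> carrier (Fp p)" using p by (simp add: Fp_arith)
  ultimately have "kernel_coord x = a mod int p"
    unfolding kernel_coord_def by (intro the_inv_into_f_eq[OF inj]) auto
  then show "\<kappa> (kernel_coord x) = x" "kernel_coord x \<in> {0..<int p}" using a p by simp_all
qed

lemma kappa_cancel:
  assumes "\<kappa> a \<otimes> x = \<kappa> b \<otimes> x" "x \<in> carrier U"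
  shows "[a = b] (mod int p)"
  using assms by (simp flip: kappa_eq_iff)

definition is_section :: "('u set \<Rightarrow> 'u) \<Rightarrow> bool" where
  "is_section \<theta> \<longleftrightarrow> (\<forall>C \<in> carrier (U Mod F). \<theta> C \<in> C)"

definition section_cocycle :: "('u set \<Rightarrow> 'u) \<Rightarrow> 'u set \<times> 'u set \<Rightarrow> int" where
  "section_cocycle \<theta> = (\<lambda>(g, h) \<in> carrier (U Mod F) \<times> carrier (U Mod F).
     kernel_coord (\<theta> g \<otimes> \<theta> h \<otimes> inv \<theta> (g \<otimes>\<^bsub>U Mod F\<^esub> h)))"

lemma section_closed:
  assumes "is_section \<theta>" "C \<in> carrier (U Mod F)"
  shows "\<theta> C \<in> carrier U" "F #> \<theta> C = C"
proof -
  obtain g where g: "g \<in> carrier U" "C = F #> g" using assms(2) by (auto simp: carrier_FactGroup_iff)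
  have "\<theta> C \<in> F #> g" using assms g unfolding is_section_def by blast
  then show "\<theta> C \<in> carrier U" "F #> \<theta> C = C"
    using g elemrcos_carrier[OF is_group] repr_independence[of "\<theta> C" F g] is_subgroup by auto
qed

lemma same_coset_diff:
  assumes "x \<in> carrier U" "y \<in> carrier U" "F #> x = F #> y"
  shows "x \<otimes> inv y \<in> F"
proof -
  have "x \<in> F #> y" using rcos_self[OF assms(1) is_subgroup] assms(3) by simp
  then show ?thesis using rcos_module_imp[OF is_group assms(2)] by blast
qed

lemma quotient_closed:
  "C \<in> carrier (U Mod F) \<Longrightarrow> D \<in> carrier (U Mod F) \<Longrightarrow> C \<otimes>\<^bsub>U Mod F\<^esub> D \<in> carrier (U Mod F)"
  by (rule monoid.m_closed[OF group.is_monoid[OF factorgroup_is_group]])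

lemma section_mult_coset:
  assumes "is_section \<theta>" "C \<in> carrier (U Mod F)" "D \<in> carrier (U Mod F)"
  shows "F #> (\<theta> C \<otimes> \<theta> D) = C \<otimes>\<^bsub>U Mod F\<^esub> D"
proof -
  have "F #> (\<theta> C \<otimes> \<theta> D) = (F #> \<theta> C) \<otimes>\<^bsub>U Mod F\<^esub> (F #> \<theta> D)"
    by (simp only: mult_FactGroup rcos_sum[OF section_closed(1)[OF assms(1,2)] section_closed(1)[OF assms(1,3)]])
  then show ?thesis using section_closed(2)[OF assms(1)] assms(2,3) by simp
qed

text \<open>The cocycle in a form without inverses; the computations below multiply elements out and
  compare the central factors.\<close>

lemma section_cocycle:
  assumes s: "is_section \<theta>" and C: "C \<in> carrier (U Mod F)" and D: "D \<in> carrier (U Mod F)"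
  shows "\<kappa> (section_cocycle \<theta> (C, D)) \<otimes> \<theta> (C \<otimes>\<^bsub>U Mod F\<^esub> D) = \<theta> C \<otimes> \<theta> D"
    and "section_cocycle \<theta> (C, D) \<in> {0..<int p}"
proof -
  note CD = quotient_closed[OF C D]
  note c = section_closed(1)[OF s C] section_closed(1)[OF s D] section_closed(1)[OF s CD]
  have F: "\<theta> C \<otimes> \<theta> D \<otimes> inv \<theta> (C \<otimes>\<^bsub>U Mod F\<^esub> D) \<in> F"
    using section_mult_coset[OF s C D] section_closed(2)[OF s CD] c
    by (intro same_coset_diff) simp_all
  show "\<kappa> (section_cocycle \<theta> (C, D)) \<otimes> \<theta> (C \<otimes>\<^bsub>U Mod F\<^esub> D) = \<theta> C \<otimes> \<theta> D"
    using C D c kernel_coord(1)[OF F] by (simp add: section_cocycle_def group_normalize)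
  show "section_cocycle \<theta> (C, D) \<in> {0..<int p}"
    using C D kernel_coord(2)[OF F] by (simp add: section_cocycle_def)
qed

text \<open>Both bracketings of the product of the representatives of A, B and C are brought to a
  central factor times the representative of A B C. Equality of the central factors is the cocycle
  identity.\<close>

lemma section_cocycle_Z2:
  assumes s: "is_section \<theta>"
  shows "section_cocycle \<theta> \<in> carrier (Z2 (U Mod F) (discrete_topology (carrier (U Mod F))) p)"
  unfolding Z2_discrete_iff[OF p]
proof (intro conjI ballI)
  show "section_cocycle \<theta> \<in> carrier (U Mod F) \<times> carrier (U Mod F) \<rightarrow>\<^sub>E {0..<int p}"
  proof (rule PiE_I)
    fix u assume "u \<in> carrier (U Mod F) \<times> carrier (U Mod F)"
    then show "section_cocycle \<theta> u \<in> {0..<int p}" using section_cocycle(2)[OF s] by blast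
  next
    fix u assume "u \<notin> carrier (U Mod F) \<times> carrier (U Mod F)"
    then show "section_cocycle \<theta> u = undefined" by (simp add: section_cocycle_def)
  qed
  interpret Q: group "U Mod F" by (rule factorgroup_is_group)
  fix A B C assume A: "A \<in> carrier (U Mod F)" and B: "B \<in> carrier (U Mod F)" and C: "C \<in> carrier (U Mod F)"
  let ?z = "section_cocycle \<theta>" and ?AB = "A \<otimes>\<^bsub>U Mod F\<^esub> B" and ?BC = "B \<otimes>\<^bsub>U Mod F\<^esub> C"
  have AB: "?AB \<in> carrier (U Mod F)" and BC: "?BC \<in> carrier (U Mod F)"
    using quotient_closed A B C by blast+
  have ABC: "?AB \<otimes>\<^bsub>U Mod F\<^esub> C \<in> carrier (U Mod F)" by (rule quotient_closed[OF AB C])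
  have assoc: "A \<otimes>\<^bsub>U Mod F\<^esub> ?BC = ?AB \<otimes>\<^bsub>U Mod F\<^esub> C" using Q.m_assoc[OF A B C] by (rule sym)
  note c = section_closed(1)[OF s]
  have "\<kappa> (?z (?AB, C) + ?z (A, B)) \<otimes> \<theta> (?AB \<otimes>\<^bsub>U Mod F\<^esub> C) =
      \<kappa> (?z (A, B)) \<otimes> (\<kappa> (?z (?AB, C)) \<otimes> \<theta> (?AB \<otimes>\<^bsub>U Mod F\<^esub> C))"
    using c[OF ABC] by (subst add.commute) (simp add: kappa_add m_assoc)
  also have "\<dots> = \<kappa> (?z (A, B)) \<otimes> (\<theta> ?AB \<otimes> \<theta> C)"
    by (simp only: section_cocycle(1)[OF s AB C])
  also have "\<dots> = (\<kappa> (?z (A, B)) \<otimes> \<theta> ?AB) \<otimes> \<theta> C" using c[OF AB] c[OF C] by (simp add: m_assoc)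
  also have "\<dots> = (\<theta> A \<otimes> \<theta> B) \<otimes> \<theta> C" by (simp only: section_cocycle(1)[OF s A B])
  also have "\<dots> = \<theta> A \<otimes> (\<theta> B \<otimes> \<theta> C)" using c[OF A] c[OF B] c[OF C] by (simp add: m_assoc)
  also have "\<dots> = \<theta> A \<otimes> (\<kappa> (?z (B, C)) \<otimes> \<theta> ?BC)" by (simp only: section_cocycle(1)[OF s B C])
  also have "\<dots> = (\<theta> A \<otimes> \<kappa> (?z (B, C))) \<otimes> \<theta> ?BC" using c[OF A] c[OF BC] by (simp add: m_assoc)
  also have "\<dots> = \<kappa> (?z (B, C)) \<otimes> (\<theta> A \<otimes> \<theta> ?BC)"
    using c[OF A] c[OF BC] by (simp add: kappa_central m_assoc)
  also have "\<dots> = \<kappa> (?z (B, C)) \<otimes> (\<kappa> (?z (A, ?BC)) \<otimes> \<theta> (A \<otimes>\<^bsub>U Mod F\<^esub> ?BC))"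
    by (simp only: section_cocycle(1)[OF s A BC])
  also have "\<dots> = \<kappa> (?z (B, C) + ?z (A, ?BC)) \<otimes> \<theta> (?AB \<otimes>\<^bsub>U Mod F\<^esub> C)"
    using c[OF ABC] by (simp only: assoc kappa_add m_assoc kappa_closed)
  finally have "[?z (?AB, C) + ?z (A, B) = ?z (B, C) + ?z (A, ?BC)] (mod int p)"
    by (rule kappa_cancel[OF _ c[OF ABC]])
  then show "(?z (B, C) + ?z (A, ?BC)) mod int p = (?z (?AB, C) + ?z (A, B)) mod int p"
    by (simp only: cong_def)
qed

text \<open>Two sections differ by central factors \<kappa> (e C), and the coboundary of e is the
  difference of the two cocycles.\<close>

lemma section_cocycle_class_unique:
  assumes s: "is_section \<theta>" and t: "is_section \<eta>"
  shows "H2_class (U Mod F) (discrete_topology (carrier (U Mod F))) p (section_cocycle \<eta>) =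
    H2_class (U Mod F) (discrete_topology (carrier (U Mod F))) p (section_cocycle \<theta>)"
proof (rule H2_class_eqI[OF p factorgroup_is_group])
  define e where "e C = kernel_coord (\<eta> C \<otimes> inv \<theta> C)" for C
  have e: "\<eta> C = \<kappa> (e C) \<otimes> \<theta> C" if C: "C \<in> carrier (U Mod F)" for C
  proof -
    note c = section_closed[OF s C] section_closed[OF t C]
    have "\<eta> C \<otimes> inv \<theta> C \<in> F" using c by (intro same_coset_diff) simp_all
    then show ?thesis using kernel_coord(1) c by (simp add: e_def m_assoc)
  qed
  fix A B assume A: "A \<in> carrier (U Mod F)" and B: "B \<in> carrier (U Mod F)"
  let ?AB = "A \<otimes>\<^bsub>U Mod F\<^esub> B"
  have AB: "?AB \<in> carrier (U Mod F)" by (rule quotient_closed[OF A B])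
  note c = section_closed(1)[OF s A] section_closed(1)[OF s B] section_closed(1)[OF s AB]
  have "\<kappa> (section_cocycle \<eta> (A, B) + e ?AB) \<otimes> \<theta> ?AB =
      \<kappa> (section_cocycle \<eta> (A, B)) \<otimes> \<eta> ?AB"
    unfolding e[OF AB] using c by (simp add: kappa_add m_assoc)
  also have "\<dots> = (\<kappa> (e A) \<otimes> \<theta> A) \<otimes> (\<kappa> (e B) \<otimes> \<theta> B)"
    by (simp only: section_cocycle(1)[OF t A B] e[OF A] e[OF B])
  also have "\<dots> = \<kappa> (e A) \<otimes> (\<theta> A \<otimes> \<kappa> (e B)) \<otimes> \<theta> B"
    using c by (simp add: m_assoc)
  also have "\<dots> = \<kappa> (e A) \<otimes> \<kappa> (e B) \<otimes> (\<theta> A \<otimes> \<theta> B)"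
    unfolding kappa_central[OF c(1)] using c by (simp add: m_assoc)
  also have "\<dots> = \<kappa> (e A) \<otimes> \<kappa> (e B) \<otimes> (\<kappa> (section_cocycle \<theta> (A, B)) \<otimes> \<theta> ?AB)"
    by (simp only: section_cocycle(1)[OF s A B])
  also have "\<dots> = \<kappa> (e A + e B + section_cocycle \<theta> (A, B)) \<otimes> \<theta> ?AB"
    using c by (simp add: kappa_add m_assoc)
  finally have "[section_cocycle \<eta> (A, B) + e ?AB = e A + e B + section_cocycle \<theta> (A, B)] (mod int p)"
    by (rule kappa_cancel[OF _ c(3)])
  from cong_diff[OF this cong_refl[of "e ?AB"]]
  show "[section_cocycle \<eta> (A, B) = section_cocycle \<theta> (A, B) + (e B - e ?AB + e A)] (mod int p)"
    by (simp add: algebra_simps)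
qed

lemma extension_class:
  assumes s: "is_section \<theta>"
  shows "the_elem {H2_class (U Mod F) (discrete_topology (carrier (U Mod F))) p (section_cocycle \<theta>) | \<theta>.
      is_section \<theta>} =
    H2_class (U Mod F) (discrete_topology (carrier (U Mod F))) p (section_cocycle \<theta>)"
proof -
  have "{H2_class (U Mod F) (discrete_topology (carrier (U Mod F))) p (section_cocycle \<theta>) | \<theta>.
      is_section \<theta>} =
    {H2_class (U Mod F) (discrete_topology (carrier (U Mod F))) p (section_cocycle \<theta>)}"
    using s section_cocycle_class_unique[OF s] by blast
  then show ?thesis by simp
qed

end

text \<open>The abstract setting of \<open>alpha\<close>: \<rho> stands for the Magnus
  representation, F for \<open>unip_filtration\<close>, and \<beta> for the map that \<rho> induces
  between the quotients.\<close>

locale extension_pullback =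
  S: open_normal S T N p + E: central_quotient F U \<kappa> p
  for S :: "('g, 'm) monoid_scheme" and T N p and F and U :: "('u, 'k) monoid_scheme" and \<kappa> +
  fixes \<rho> :: "'g \<Rightarrow> 'u" and \<beta> :: "'g set \<Rightarrow> 'u set"
  assumes rho_hom: "\<rho> \<in> hom S U"
    and rho_cont: "continuous_map T (discrete_topology (carrier U)) \<rho>"
    and rho_N: "\<rho> ` N \<subseteq> F"
    and beta: "\<And>g. g \<in> carrier S \<Longrightarrow> \<beta> (N #>\<^bsub>S\<^esub> g) = F #>\<^bsub>U\<^esub> \<rho> g"
begin

sublocale rho: group_hom S U \<rho>
  by (intro group_hom.intro group_hom_axioms.intro rho_hom S.is_group E.is_group)

text \<open>The trivial coset is sent to the identity, so that on N the coordinate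
  \<open>rho_coord\<close> alone determines \<rho>.\<close>

definition theta :: "'u set \<Rightarrow> 'u" where
  "theta C = (if C = F then \<one>\<^bsub>U\<^esub> else SOME x. x \<in> C)"

lemma theta_section: "E.is_section theta"
  unfolding E.is_section_def
proof
  fix C assume "C \<in> carrier (U Mod F)"
  then obtain g where g: "g \<in> carrier U" "C = F #>\<^bsub>U\<^esub> g" by (auto simp: carrier_FactGroup_iff)
  have "(SOME x. x \<in> C) \<in> C"
    using E.rcos_self[OF g(1) E.is_subgroup] unfolding g(2) by (rule someI)
  then show "theta C \<in> C" using subgroup.one_closed[OF E.is_subgroup] by (auto simp: theta_def)
qed

definition rho_coord :: "'g \<Rightarrow> int" where
  "rho_coord g = E.kernel_coord (\<rho> g \<otimes>\<^bsub>U\<^esub> inv\<^bsub>U\<^esub> theta (F #>\<^bsub>U\<^esub> \<rho> g))"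

lemma rho_coset: "g \<in> carrier S \<Longrightarrow> F #>\<^bsub>U\<^esub> \<rho> g \<in> carrier (U Mod F)"
  by (auto simp: carrier_FactGroup_iff)

lemma rho_coord:
  assumes g: "g \<in> carrier S"
  shows "\<rho> g = \<kappa> (rho_coord g) \<otimes>\<^bsub>U\<^esub> theta (F #>\<^bsub>U\<^esub> \<rho> g)" "rho_coord g \<in> {0..<int p}"
proof -
  note c = E.section_closed[OF theta_section rho_coset[OF g]] rho.hom_closed[OF g]
  have "\<rho> g \<otimes>\<^bsub>U\<^esub> inv\<^bsub>U\<^esub> theta (F #>\<^bsub>U\<^esub> \<rho> g) \<in> F" using c by (intro E.same_coset_diff) simp_all
  from E.kernel_coord[OF this] c
  show "\<rho> g = \<kappa> (rho_coord g) \<otimes>\<^bsub>U\<^esub> theta (F #>\<^bsub>U\<^esub> \<rho> g)" "rho_coord g \<in> {0..<int p}"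
    by (simp_all add: rho_coord_def E.m_assoc)
qed

lemma rho_coord_N:
  assumes "v \<in> N"
  shows "\<rho> v = \<kappa> (rho_coord v)"
proof -
  have "\<rho> v \<in> F" using assms rho_N by blast
  then have "F #>\<^bsub>U\<^esub> \<rho> v = F" using E.coset_join2[OF _ E.is_subgroup] by simp
  then show ?thesis using rho_coord(1)[of v] assms by (simp add: theta_def)
qed

abbreviation pulled_cocycle :: "'g set \<times> 'g set \<Rightarrow> int" where
  "pulled_cocycle \<equiv> (\<lambda>(g, h) \<in> carrier (S Mod N) \<times> carrier (S Mod N).
     E.section_cocycle theta (\<beta> g, \<beta> h))"

lemma beta_closed: "C \<in> carrier (S Mod N) \<Longrightarrow> \<beta> C \<in> carrier (U Mod F)"
  using rho_coset by (auto simp: carrier_FactGroup_iff beta)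

lemma beta_mult:
  assumes "C \<in> carrier (S Mod N)" "D \<in> carrier (S Mod N)"
  shows "\<beta> (C \<otimes>\<^bsub>S Mod N\<^esub> D) = \<beta> C \<otimes>\<^bsub>U Mod F\<^esub> \<beta> D"
proof -
  obtain g h where g: "g \<in> carrier S" "C = N #>\<^bsub>S\<^esub> g" and h: "h \<in> carrier S" "D = N #>\<^bsub>S\<^esub> h"
    using assms by (auto simp: carrier_FactGroup_iff)
  have gh: "g \<otimes>\<^bsub>S\<^esub> h \<in> carrier S" using g h by simp
  have "\<beta> (C \<otimes>\<^bsub>S Mod N\<^esub> D) = F #>\<^bsub>U\<^esub> \<rho> (g \<otimes>\<^bsub>S\<^esub> h)"
    unfolding g(2) h(2) S.quotient_mult[OF g(1) h(1)] by (rule beta[OF gh])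
  also have "\<dots> = (F #>\<^bsub>U\<^esub> \<rho> g) \<otimes>\<^bsub>U Mod F\<^esub> (F #>\<^bsub>U\<^esub> \<rho> h)"
    using g h by (simp add: E.rcos_sum)
  finally show ?thesis using g h by (simp add: beta)
qed

text \<open>Representatives of the class differ by coboundaries, and the pullback of the coboundary
  of e is the coboundary of e composed with \<beta>; hence \<open>the_elem\<close> is applied to a
  singleton.\<close>

lemma pullback_class:
  "H2_pullback (S Mod N) (quotient_topology T (carrier (S Mod N))) p \<beta>
     (H2_class (U Mod F) (discrete_topology (carrier (U Mod F))) p (E.section_cocycle theta)) =
   H2_class (S Mod N) (quotient_topology T (carrier (S Mod N))) p pulled_cocycle"
proof -
  let ?w = "H2_class (U Mod F) (discrete_topology (carrier (U Mod F))) p (E.section_cocycle theta)"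
  let ?f = "\<lambda>z. H2_class (S Mod N) (quotient_topology T (carrier (S Mod N))) p
      (\<lambda>(g, h) \<in> carrier (S Mod N) \<times> carrier (S Mod N). z (\<beta> g, \<beta> h))"
  have "?f z = ?f (E.section_cocycle theta)" if z: "z \<in> ?w" for z
  proof -
    from z obtain e where
      z_eq: "z = (\<lambda>u \<in> carrier (U Mod F) \<times> carrier (U Mod F).
        (coboundary (U Mod F) p e u + E.section_cocycle theta u) mod int p)"
      unfolding H2_class_discrete[OF E.p] mem_Collect_eq by iprover
    show ?thesis
      unfolding S.quotient_topology_discrete
    proof (rule H2_class_eqI[OF E.p S.group_quotient])
      fix C D assume C: "C \<in> carrier (S Mod N)" and D: "D \<in> carrier (S Mod N)"
      let ?z = "E.section_cocycle theta (\<beta> C, \<beta> D)"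
      have "[z (\<beta> C, \<beta> D) = ?z + (e (\<beta> D) - e (\<beta> (C \<otimes>\<^bsub>S Mod N\<^esub> D)) + e (\<beta> C))] (mod int p)"
        unfolding z_eq using beta_closed[OF C] beta_closed[OF D]
        by (simp add: coboundary_apply[OF E.p] beta_mult[OF C D] cong_def mod_simps algebra_simps
            del: mult_FactGroup)
      then show "[(\<lambda>(g, h) \<in> carrier (S Mod N) \<times> carrier (S Mod N). z (\<beta> g, \<beta> h)) (C, D) =
        pulled_cocycle (C, D) + (e (\<beta> D) - e (\<beta> (C \<otimes>\<^bsub>S Mod N\<^esub> D)) + e (\<beta> C))] (mod int p)"
        using C D by (simp del: mult_FactGroup)
    qed
  qed
  moreover have "?w \<noteq> {}"
  proof -
    have "(\<lambda>_. 0) \<in> carrier (U Mod F) \<rightarrow> {0..<int p}" using E.p by auto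
    then show ?thesis unfolding H2_class_discrete[OF E.p] by blast
  qed
  ultimately have "?f ` ?w = {?f (E.section_cocycle theta)}"
    by (simp only: image_constant_conv cong: image_cong if_cong) simp
  then show ?thesis by (simp add: H2_pullback_def)
qed

definition transgressed :: "'g \<Rightarrow> int" where
  "transgressed = (\<lambda>v \<in> N. (- rho_coord v) mod int p)"

text \<open>Comparing central factors in \<rho> (g h) = \<rho> g \<rho> h gives the cocycle at (g,
  h) as the coordinate of g h minus those of g and h. This is the coboundary of minus the
  coordinate.\<close>

lemma pulled_cochain:
  "transgression_cochain S T N p transgressed pulled_cocycle (\<lambda>g. (- rho_coord g) mod int p)"
proof -
  let ?y = "\<lambda>g. (- rho_coord g) mod int p"
  have z: "pulled_cocycle (N #>\<^bsub>S\<^esub> g, N #>\<^bsub>S\<^esub> h) = coboundary S p ?y (g, h)"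
    if g: "g \<in> carrier S" and h: "h \<in> carrier S" for g h
  proof -
    let ?z = "E.section_cocycle theta (F #>\<^bsub>U\<^esub> \<rho> g, F #>\<^bsub>U\<^esub> \<rho> h)"
    let ?t = "theta (F #>\<^bsub>U\<^esub> \<rho> (g \<otimes>\<^bsub>S\<^esub> h))"
    have gh: "g \<otimes>\<^bsub>S\<^esub> h \<in> carrier S" using g h by simp
    note c = E.section_closed(1)[OF theta_section rho_coset]
    have coset: "F #>\<^bsub>U\<^esub> \<rho> (g \<otimes>\<^bsub>S\<^esub> h) = (F #>\<^bsub>U\<^esub> \<rho> g) \<otimes>\<^bsub>U Mod F\<^esub> (F #>\<^bsub>U\<^esub> \<rho> h)"
      using g h by (simp add: E.rcos_sum)
    have "\<kappa> (rho_coord (g \<otimes>\<^bsub>S\<^esub> h)) \<otimes>\<^bsub>U\<^esub> ?t = \<rho> g \<otimes>\<^bsub>U\<^esub> \<rho> h"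
      using rho_coord(1)[OF gh] g h by simp
    also have "\<dots> = (\<kappa> (rho_coord g) \<otimes>\<^bsub>U\<^esub> theta (F #>\<^bsub>U\<^esub> \<rho> g)) \<otimes>\<^bsub>U\<^esub>
        (\<kappa> (rho_coord h) \<otimes>\<^bsub>U\<^esub> theta (F #>\<^bsub>U\<^esub> \<rho> h))"
      using rho_coord(1)[OF g] rho_coord(1)[OF h] by simp
    also have "\<dots> = \<kappa> (rho_coord g) \<otimes>\<^bsub>U\<^esub> (theta (F #>\<^bsub>U\<^esub> \<rho> g) \<otimes>\<^bsub>U\<^esub> \<kappa> (rho_coord h))
        \<otimes>\<^bsub>U\<^esub> theta (F #>\<^bsub>U\<^esub> \<rho> h)"
      using c[OF g] c[OF h] by (simp add: E.m_assoc)
    also have "\<dots> = \<kappa> (rho_coord g) \<otimes>\<^bsub>U\<^esub> \<kappa> (rho_coord h) \<otimes>\<^bsub>U\<^esub>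
        (theta (F #>\<^bsub>U\<^esub> \<rho> g) \<otimes>\<^bsub>U\<^esub> theta (F #>\<^bsub>U\<^esub> \<rho> h))"
      unfolding E.kappa_central[OF c[OF g]] using c[OF g] c[OF h] by (simp add: E.m_assoc)
    also have "theta (F #>\<^bsub>U\<^esub> \<rho> g) \<otimes>\<^bsub>U\<^esub> theta (F #>\<^bsub>U\<^esub> \<rho> h) = \<kappa> ?z \<otimes>\<^bsub>U\<^esub> ?t"
      unfolding coset by (rule E.section_cocycle(1)[OF theta_section rho_coset[OF g] rho_coset[OF h], symmetric])
    also have "\<kappa> (rho_coord g) \<otimes>\<^bsub>U\<^esub> \<kappa> (rho_coord h) \<otimes>\<^bsub>U\<^esub> (\<kappa> ?z \<otimes>\<^bsub>U\<^esub> ?t) =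
        \<kappa> (rho_coord g + rho_coord h + ?z) \<otimes>\<^bsub>U\<^esub> ?t"
      using c[OF gh] by (simp add: E.kappa_add E.m_assoc)
    finally have "[rho_coord (g \<otimes>\<^bsub>S\<^esub> h) = rho_coord g + rho_coord h + ?z] (mod int p)"
      by (rule E.kappa_cancel[OF _ c[OF gh]])
    from cong_diff[OF this cong_refl[of "rho_coord g + rho_coord h"]]
    have cong: "[?z = - rho_coord h + rho_coord (g \<otimes>\<^bsub>S\<^esub> h) - rho_coord g] (mod int p)"
      by (simp add: algebra_simps cong_sym)
    have "?z mod int p = ?z"
      using E.section_cocycle(2)[OF theta_section rho_coset[OF g] rho_coset[OF h]] by simp
    then have "?z = (- rho_coord h + rho_coord (g \<otimes>\<^bsub>S\<^esub> h) - rho_coord g) mod int p"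
      using cong by (simp add: cong_def)
    moreover have "pulled_cocycle (N #>\<^bsub>S\<^esub> g, N #>\<^bsub>S\<^esub> h) = ?z"
      using g h by (simp add: S.rcoset_in_quotient beta)
    moreover have "coboundary S p ?y (g, h) =
        (- rho_coord h + rho_coord (g \<otimes>\<^bsub>S\<^esub> h) - rho_coord g) mod int p"
    proof -
      have "[?y h - ?y (g \<otimes>\<^bsub>S\<^esub> h) + ?y g = - rho_coord h - - rho_coord (g \<otimes>\<^bsub>S\<^esub> h) + - rho_coord g] (mod int p)"
        by (intro cong_add cong_diff) simp_all
      then show ?thesis using g h by (simp add: coboundary_apply[OF E.p] cong_def)
    qed
    ultimately show ?thesis by simp
  qed
  have "pulled_cocycle \<in> carrier (Z2 (S Mod N) (discrete_topology (carrier (S Mod N))) p)"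
    unfolding Z2_discrete_iff[OF E.p]
  proof (intro conjI ballI)
    show "pulled_cocycle \<in> carrier (S Mod N) \<times> carrier (S Mod N) \<rightarrow>\<^sub>E {0..<int p}"
      by (intro PiE_I) (use E.section_cocycle(2)[OF theta_section] beta_closed in auto)
    fix A B C assume A: "A \<in> carrier (S Mod N)" and B: "B \<in> carrier (S Mod N)" and C: "C \<in> carrier (S Mod N)"
    have AB: "A \<otimes>\<^bsub>S Mod N\<^esub> B \<in> carrier (S Mod N)" and BC: "B \<otimes>\<^bsub>S Mod N\<^esub> C \<in> carrier (S Mod N)"
      using monoid.m_closed[OF group.is_monoid[OF S.group_quotient]] A B C by blast+
    show "(pulled_cocycle (B, C) + pulled_cocycle (A, B \<otimes>\<^bsub>S Mod N\<^esub> C)) mod int p =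
        (pulled_cocycle (A \<otimes>\<^bsub>S Mod N\<^esub> B, C) + pulled_cocycle (A, B)) mod int p"
      using E.section_cocycle_Z2[OF theta_section, unfolded Z2_discrete_iff[OF E.p]]
        A B C AB BC beta_closed beta_mult
      by (simp del: mult_FactGroup)
  qed
  moreover have "continuous_map T (Fp_topology p) ?y"
  proof -
    \<comment> \<open>The coordinate depends on g only through \<rho> g, and \<rho> is continuous
      into a discrete space.\<close>
    have "continuous_map (discrete_topology (carrier U)) (Fp_topology p)
       (\<lambda>x. (- E.kernel_coord (x \<otimes>\<^bsub>U\<^esub> inv\<^bsub>U\<^esub> theta (F #>\<^bsub>U\<^esub> x))) mod int p)"
      using E.p by (auto simp: Fp_arith)
    from continuous_map_compose[OF rho_cont this] show ?thesis by (simp add: o_def rho_coord_def)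
  qed
  ultimately show ?thesis
    using z by (simp add: transgression_cochain_def transgressed_def S.quotient_topology_discrete)
qed

text \<open>On N the map \<rho> is \<kappa> of the coordinate: multiplicativity of \<rho> yields
  additivity modulo p, and centrality of \<kappa> yields invariance under conjugation.\<close>

lemma transgressed_H1: "transgressed \<in> H1_invariants S T N p"
proof -
  note c = pulled_cochain
  have sub: "N \<subseteq> carrier S" by (rule S.subset)
  have range: "transgressed v \<in> carrier (Fp p)" if "v \<in> N" for v
    using that E.p by (simp add: transgressed_def Fp_arith)
  have hom: "transgressed (u \<otimes>\<^bsub>S\<^esub> v) = (transgressed u + transgressed v) mod int p"
    if u: "u \<in> N" and v: "v \<in> N" for u v
  proof -
    have uv: "u \<otimes>\<^bsub>S\<^esub> v \<in> N" using u v by (rule subgroup.m_closed[OF S.is_subgroup])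
    have "\<kappa> (rho_coord (u \<otimes>\<^bsub>S\<^esub> v)) = \<kappa> (rho_coord u + rho_coord v)"
      using rho_coord_N[OF uv] rho_coord_N[OF u] rho_coord_N[OF v] u v sub
      by (simp add: E.kappa_add subset_iff)
    then have "[rho_coord (u \<otimes>\<^bsub>S\<^esub> v) = rho_coord u + rho_coord v] (mod int p)"
      by (simp only: E.kappa_eq_iff)
    from cong_minus_minus_iff[THEN iffD2, OF this]
    show ?thesis using u v uv by (simp add: transgressed_def cong_def mod_simps)
  qed
  have inv: "transgressed (inv\<^bsub>S\<^esub> s \<otimes>\<^bsub>S\<^esub> v \<otimes>\<^bsub>S\<^esub> s) = transgressed v"
    if s: "s \<in> carrier S" and v: "v \<in> N" for s v
  proof -
    have vs: "inv\<^bsub>S\<^esub> s \<otimes>\<^bsub>S\<^esub> v \<otimes>\<^bsub>S\<^esub> s \<in> N" using s v by (rule S.inv_op_closed1)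
    have "\<rho> (inv\<^bsub>S\<^esub> s \<otimes>\<^bsub>S\<^esub> v \<otimes>\<^bsub>S\<^esub> s) = inv\<^bsub>U\<^esub> \<rho> s \<otimes>\<^bsub>U\<^esub> \<kappa> (rho_coord v) \<otimes>\<^bsub>U\<^esub> \<rho> s"
      using s v rho_coord_N[OF v] by simp
    also have "\<dots> = \<kappa> (rho_coord v)"
      unfolding E.kappa_central[OF E.inv_closed[OF rho.hom_closed[OF s]]]
      using s by (simp add: E.m_assoc)
    finally have "\<kappa> (rho_coord (inv\<^bsub>S\<^esub> s \<otimes>\<^bsub>S\<^esub> v \<otimes>\<^bsub>S\<^esub> s)) = \<kappa> (rho_coord v)"
      using rho_coord_N[OF vs] by simp
    then have "[rho_coord (inv\<^bsub>S\<^esub> s \<otimes>\<^bsub>S\<^esub> v \<otimes>\<^bsub>S\<^esub> s) = rho_coord v] (mod int p)"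
      by (simp only: E.kappa_eq_iff)
    from cong_minus_minus_iff[THEN iffD2, OF this]
    show ?thesis using v vs by (simp add: transgressed_def cong_def)
  qed
  have "continuous_map (subtopology T N) (Fp_topology p) (\<lambda>g. (- rho_coord g) mod int p)"
    using c by (intro continuous_map_from_subtopology) (simp add: transgression_cochain_def)
  then have cont: "continuous_map (subtopology T N) (Fp_topology p) transgressed"
    by (rule continuous_map_eq) (simp add: transgressed_def)
  show ?thesis
    unfolding H1_invariants_def
    using range hom inv cont E.p by (auto simp: hom_def Fp_arith transgressed_def[THEN arg_cong[of _ _ "\<lambda>f. f \<in> extensional N"]])
qed

text \<open>The minus sign in \<open>transgressed\<close> cancels the one in the definition of the
  pairing.\<close>

theorem pairing_pullback:
  assumes hom0: "\<And>f v. continuous_map T (Fp_topology p) f \<Longrightarrow>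
      (\<And>g h. g \<in> carrier S \<Longrightarrow> h \<in> carrier S \<Longrightarrow> f (g \<otimes>\<^bsub>S\<^esub> h) = (f g + f h) mod int p) \<Longrightarrow>
      v \<in> N \<Longrightarrow> f v = 0"
    and v: "v \<in> N" "\<rho> v = \<kappa> a"
  shows "\<ominus>\<^bsub>Fp p\<^esub> (the_inv_into (H1_invariants S T N p) (transgression S T N p)
      (H2_pullback (S Mod N) (quotient_topology T (carrier (S Mod N))) p \<beta>
        (H2_class (U Mod F) (discrete_topology (carrier (U Mod F))) p (E.section_cocycle theta)))) v =
    a mod int p"
proof -
  have "inj_on (transgression S T N p) (H1_invariants S T N p)"
    by (rule S.transgression_inj) (rule hom0)
  then have "the_inv_into (H1_invariants S T N p) (transgression S T N p)
      (transgression S T N p transgressed) = transgressed"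
    using transgressed_H1 by (rule the_inv_into_f_f)
  then have "the_inv_into (H1_invariants S T N p) (transgression S T N p)
      (H2_pullback (S Mod N) (quotient_topology T (carrier (S Mod N))) p \<beta>
        (H2_class (U Mod F) (discrete_topology (carrier (U Mod F))) p (E.section_cocycle theta))) = transgressed"
    using S.transgression_eq[OF pulled_cochain] pullback_class by simp
  moreover have "[rho_coord v = a] (mod int p)"
    using rho_coord_N[OF v(1)] v(2) by (simp flip: E.kappa_eq_iff)
  ultimately show ?thesis
    using v E.p by (simp add: Fp_arith transgressed_def mod_simps cong_def)
qed

end


section \<open>The Magnus homomorphism\<close>

lemma discrete_profinite_group:
  assumes "group G" "finite (carrier G)"
  shows "profinite_group G (discrete_topology (carrier G))"
proof -
  interpret group G by fact
  show ?thesis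
  proof unfold_locales
    show "continuous_map (prod_topology (discrete_topology (carrier G)) (discrete_topology (carrier G)))
        (discrete_topology (carrier G)) (\<lambda>(x, y). x \<otimes>\<^bsub>G\<^esub> y)"
      by (auto simp flip: prod_topology_discrete_topology)

    show "x = y" if "connectedin (discrete_topology (carrier G)) C" "x \<in> C" "y \<in> C" for C x y
      using that by (auto simp: connectedin_discrete_topology)
  qed (use assms in \<open>auto simp: compact_space_discrete_topology\<close>)
qed

lemma discrete_topological_group:
  assumes "group G"
  shows "topological_group G (discrete_topology (carrier G))"
proof -
  interpret group G by fact
  show ?thesis
  proof unfold_locales
    show "continuous_map (prod_topology (discrete_topology (carrier G)) (discrete_topology (carrier G)))
        (discrete_topology (carrier G)) (\<lambda>(x, y). x \<otimes>\<^bsub>G\<^esub> y)"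
      by (auto simp flip: prod_topology_discrete_topology)
  qed auto
qed

text \<open>The test groups of the universal property live in \<open>nat set\<close>; a finite group embeds there.\<close>

lemma free_profinite_finite_lift:
  fixes H :: "('h, 'm) monoid_scheme"
  assumes free: "free_profinite_group S T \<iota>" and H: "group H" "finite (carrier H)"
    and f: "range f \<subseteq> carrier H"
  shows "\<exists>\<phi> \<in> hom S H. continuous_map T (discrete_topology (carrier H)) \<phi> \<and> (\<forall>x. \<phi> (\<iota> x) = f x)"
proof -
  interpret H: group H by fact
  obtain e0 :: "'h \<Rightarrow> nat" where "inj_on e0 (carrier H)"
    using finite_imp_inj_to_nat_seg[OF H(2)] by metis
  then have inj: "inj_on (\<lambda>x. {e0 x}) (carrier H)" by (auto simp: inj_on_def)
  define e where "e = (\<lambda>x. {e0 x})"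
  define d where "d = the_inv_into (carrier H) e"
  have de: "d (e x) = x" if "x \<in> carrier H" for x
    unfolding d_def e_def by (rule the_inv_into_f_f[OF inj that])
  define K :: "nat set monoid" where
    "K = \<lparr>carrier = e ` carrier H, monoid.mult = (\<lambda>a b. e (d a \<otimes>\<^bsub>H\<^esub> d b)), one = e \<one>\<^bsub>H\<^esub>\<rparr>"
  have K: "group K"
  proof (rule groupI)
    fix a assume "a \<in> carrier K"
    then obtain x where "x \<in> carrier H" "a = e x" by (auto simp: K_def)
    then show "\<exists>b\<in>carrier K. b \<otimes>\<^bsub>K\<^esub> a = \<one>\<^bsub>K\<^esub>"
      by (intro bexI[of _ "e (inv\<^bsub>H\<^esub> x)"]) (auto simp: K_def de)
  qed (auto simp: K_def de H.m_assoc)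
  have "finite (carrier K)" using H by (simp add: K_def)
  then have "profinite_group K (discrete_topology (carrier K))"
    by (rule discrete_profinite_group[OF K])
  moreover have "range (\<lambda>x. e (f x)) \<subseteq> carrier K" using f by (auto simp: K_def)
  moreover have "\<forall>(H :: nat set monoid) TH f. profinite_group H TH \<and> range f \<subseteq> carrier H \<longrightarrow>
      (\<exists>\<phi> \<in> hom S H. continuous_map T TH \<phi> \<and> (\<forall>x. \<phi> (\<iota> x) = f x))"
    using free unfolding free_profinite_group_def by (elim conjE)
  ultimately have "\<exists>\<phi> \<in> hom S K. continuous_map T (discrete_topology (carrier K)) \<phi> \<and>
      (\<forall>x. \<phi> (\<iota> x) = e (f x))"
    by simp
  then obtain \<phi> where phi: "\<phi> \<in> hom S K"
    "continuous_map T (discrete_topology (carrier K)) \<phi>" "\<And>x. \<phi> (\<iota> x) = e (f x)"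
    by blast
  have "d \<in> hom K H" by (auto simp: hom_def K_def de)
  then have "d \<circ> \<phi> \<in> hom S H" using phi(1) by (rule hom_compose[rotated])
  moreover have "continuous_map (discrete_topology (carrier K)) (discrete_topology (carrier H)) d"
    by (auto simp: K_def de)
  then have "continuous_map T (discrete_topology (carrier H)) (d \<circ> \<phi>)"
    using phi(2) by (rule continuous_map_compose[rotated])
  moreover have "(d \<circ> \<phi>) (\<iota> x) = f x" for x
    using f phi(3)[of x] de[of "f x"] by auto
  ultimately show ?thesis by blast
qed

text \<open>Two continuous maps into a Hausdorff space that agree on a dense subgroup are equal. The
  topology of the target enters through separation only, so power series with the product topology
  are covered directly.\<close>

lemma continuous_hom_unique:
  assumes S: "topological_group S T" "A \<subseteq> carrier S" "closed_generate S T A = carrier S"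
    and H: "group H" "Hausdorff_space Y"
    and f: "f \<in> hom S H" "continuous_map T Y f" and g: "g \<in> hom S H" "continuous_map T Y g"
    and eq: "\<And>a. a \<in> A \<Longrightarrow> f a = g a" and x: "x \<in> carrier S"
  shows "f x = g x"
proof -
  interpret S: topological_group S T by fact
  interpret f: group_hom S H f
    by (intro group_hom.intro group_hom_axioms.intro S.is_group H f)
  interpret g: group_hom S H g
    by (intro group_hom.intro group_hom_axioms.intro S.is_group H g)
  have "f x = g x" if "x \<in> generate S A" for x
    using that
  proof (induction rule: generate.induct)
    case (inv h)
    then show ?case using eq S(2) by (auto simp: f.hom_inv g.hom_inv subset_iff)
  next
    case (eng h1 h2)
    then show ?case using S.generate_in_carrier[OF S(2)] by simp
  qed (use eq in auto)
  then show ?thesis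
    using x forall_in_closure_of_eq[OF _ H(2) f(2) g(2), of x "generate S A"]
    by (simp add: S(3)[symmetric] closed_generate_def)
qed

section \<open>Reduction of integral series modulo m\<close>

abbreviation ncm :: "int \<Rightarrow> ('x list \<Rightarrow> int) ring" where
  "ncm m \<equiv> nc_power_series (residue_ring m)"

definition red :: "int \<Rightarrow> 'x ncps \<Rightarrow> 'x list \<Rightarrow> int" where
  "red m f = (\<lambda>w. coeff f w mod m)"

lemma residue_ring_simps:
  "carrier (residue_ring m) = {0..m - 1}" "a \<otimes>\<^bsub>residue_ring m\<^esub> b = a * b mod m"
  "a \<oplus>\<^bsub>residue_ring m\<^esub> b = (a + b) mod m" "\<zero>\<^bsub>residue_ring m\<^esub> = 0" "\<one>\<^bsub>residue_ring m\<^esub> = 1"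
  by (simp_all add: residue_ring_def)

lemma finsum_residue_ring:
  assumes m: "1 < m" and "finite A" "\<And>k. k \<in> A \<Longrightarrow> f k \<in> {0..m - 1}"
  shows "finsum (residue_ring m) f A = (\<Sum>k\<in>A. f k) mod m"
proof -
  interpret residues m "residue_ring m" by unfold_locales (use m in auto)
  show ?thesis
    using assms(2,3)
  proof (induction rule: finite_induct)
    case (insert a A)
    have "finsum (residue_ring m) f (insert a A) = f a \<oplus>\<^bsub>residue_ring m\<^esub> finsum (residue_ring m) f A"
      using insert by (intro finsum_insert) (auto simp: residue_ring_simps)
    then show ?case using insert by (simp add: residue_ring_simps mod_simps)
  qed (simp add: residue_ring_simps)
qed

context
  fixes m :: int
  assumes m: "1 < m"
begin

lemma ncm_mult:
  assumes "f \<in> carrier (ncm m)" "g \<in> carrier (ncm m)"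
  shows "f \<otimes>\<^bsub>ncm m\<^esub> g = red m (NCPS f * NCPS g)"
proof
  fix w
  have "(f \<otimes>\<^bsub>ncm m\<^esub> g) w = (\<Sum>k\<in>{0..length w}. f (take k w) * g (drop k w) mod m) mod m"
    using m by (simp add: nc_power_series_def finsum_residue_ring residue_ring_simps)
  also have "\<dots> = red m (NCPS f * NCPS g) w" by (simp add: red_def coeff_mult mod_sum_eq)
  finally show "(f \<otimes>\<^bsub>ncm m\<^esub> g) w = red m (NCPS f * NCPS g) w" .
qed

lemma red_closed [simp]: "red m f \<in> carrier (ncm m)"
  using m by (simp add: red_def nc_power_series_def residue_ring_simps)

lemma red_NCPS: "f \<in> carrier (ncm m) \<Longrightarrow> red m (NCPS f) = f"
  by (auto simp: red_def nc_power_series_def residue_ring_simps Pi_iff fun_eq_iff)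

lemma red_mult_cong:
  assumes "red m f = red m f'" "red m g = red m g'"
  shows "red m (f * g) = red m (f' * g')"
proof
  fix w
  have f: "[coeff f v = coeff f' v] (mod m)" and g: "[coeff g v = coeff g' v] (mod m)" for v
    using assms by (auto simp: red_def cong_def fun_eq_iff)
  have "[coeff (f * g) w = coeff (f' * g') w] (mod m)"
    unfolding coeff_mult by (intro cong_sum cong_mult f g)
  then show "red m (f * g) w = red m (f' * g') w" by (simp add: red_def cong_def)
qed

lemma red_mult: "red m f \<otimes>\<^bsub>ncm m\<^esub> red m g = red m (f * g)"
  unfolding ncm_mult[OF red_closed red_closed] by (rule red_mult_cong) (simp_all add: red_def)

lemma red_one: "red m 1 = \<one>\<^bsub>ncm m\<^esub>"
  using m by (auto simp: red_def nc_power_series_def residue_ring_simps coeff_1)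

lemma ncm_monoid: "Group.monoid (ncm m :: ('x list \<Rightarrow> int) ring)"
proof (rule Group.monoid.intro)
  show "\<one>\<^bsub>ncm m\<^esub> \<in> carrier (ncm m)" unfolding red_one[symmetric] by (rule red_closed)
  fix f g h :: "'x list \<Rightarrow> int"
  assume f: "f \<in> carrier (ncm m)" and g: "g \<in> carrier (ncm m)" and h: "h \<in> carrier (ncm m)"
  show "f \<otimes>\<^bsub>ncm m\<^esub> g \<in> carrier (ncm m)" using f g by (simp add: ncm_mult)
  obtain a b c where "f = red m a" "g = red m b" "h = red m c"
    using red_NCPS[OF f, symmetric] red_NCPS[OF g, symmetric] red_NCPS[OF h, symmetric] by blast
  then show "f \<otimes>\<^bsub>ncm m\<^esub> g \<otimes>\<^bsub>ncm m\<^esub> h = f \<otimes>\<^bsub>ncm m\<^esub> (g \<otimes>\<^bsub>ncm m\<^esub> h)"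
    by (simp add: red_mult mult.assoc)
  show "\<one>\<^bsub>ncm m\<^esub> \<otimes>\<^bsub>ncm m\<^esub> f = f" "f \<otimes>\<^bsub>ncm m\<^esub> \<one>\<^bsub>ncm m\<^esub> = f"
    using red_mult[of 1 "NCPS f"] red_mult[of "NCPS f" 1] f by (simp_all add: red_one red_NCPS)
qed

lemma red_units:
  assumes "coeff f [] = 1"
  shows "red m f \<in> Units (ncm m)"
proof -
  have "red m (ninv f) \<otimes>\<^bsub>ncm m\<^esub> red m f = \<one>\<^bsub>ncm m\<^esub>" "red m f \<otimes>\<^bsub>ncm m\<^esub> red m (ninv f) = \<one>\<^bsub>ncm m\<^esub>"
    using assms by (simp_all add: red_mult ninv_mult red_one)
  then show ?thesis unfolding Units_def using red_closed by blast
qed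

lemma red_hom: "group_hom ncps_units (units_of (ncm m)) (red m)"
  by (intro group_hom.intro group_hom_axioms.intro group_ncps_units monoid.units_group[OF ncm_monoid])
    (auto simp: hom_def units_of_carrier units_of_mult red_units red_mult)

lemma red_var: "red m (1 + nvar x) = \<one>\<^bsub>ncm m\<^esub> \<oplus>\<^bsub>ncm m\<^esub> nc_var (residue_ring m) x"
  using m by (auto simp: red_def nc_power_series_def nc_var_def residue_ring_simps coeff_1 coeff_nvar)

section \<open>Finite truncations and the construction of the Magnus homomorphism\<close>

definition trunc :: "nat \<Rightarrow> 'x ncps \<Rightarrow> 'x list \<Rightarrow> int" where
  "trunc L f = restrict (red m f) {w. length w \<le> L}"

lemma trunc_mult_cong:
  assumes "trunc L f = trunc L f'" "trunc L g = trunc L g'"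
  shows "trunc L (f * g) = trunc L (f' * g')"
proof
  fix w
  have f: "[coeff f v = coeff f' v] (mod m)" and g: "[coeff g v = coeff g' v] (mod m)" 
    if "length v \<le> L" for v
    using fun_cong[OF assms(1), of v] fun_cong[OF assms(2), of v] that
    by (auto simp: trunc_def red_def cong_def)
  have "[coeff (f * g) w = coeff (f' * g') w] (mod m)" if "length w \<le> L"
    unfolding coeff_mult using that by (intro cong_sum cong_mult f g) auto
  then show "trunc L (f * g) w = trunc L (f' * g') w" by (simp add: trunc_def red_def cong_def)
qed

text \<open>Series with constant coefficient 1, taken modulo m and up to words longer than L. These
  are the finite groups to which the universal property of S is applied.\<close>

definition trunc_group :: "nat \<Rightarrow> ('x list \<Rightarrow> int) monoid" where
  "trunc_group L = \<lparr>carrier = trunc L ` {f. coeff f [] = 1},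
     monoid.mult = (\<lambda>a b. trunc L (NCPS a * NCPS b)), one = trunc L 1\<rparr>"

lemma trunc_idem: "trunc L (NCPS (trunc L f)) = trunc L f"
  by (auto simp: trunc_def red_def fun_eq_iff)

lemma trunc_mult: "trunc L f \<otimes>\<^bsub>trunc_group L\<^esub> trunc L g = trunc L (f * g)"
  by (simp add: trunc_group_def) (rule trunc_mult_cong; rule trunc_idem)

lemma trunc_group: "group (trunc_group L :: ('x list \<Rightarrow> int) monoid)"
proof (rule groupI)
  have mem: "a \<in> carrier (trunc_group L) \<longleftrightarrow> (\<exists>f. coeff f [] = 1 \<and> a = trunc L f)" for a :: "'x list \<Rightarrow> int"
    by (auto simp: trunc_group_def)
  have one: "\<one>\<^bsub>trunc_group L\<^esub> = trunc L (1 :: 'x ncps)" by (simp add: trunc_group_def)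
  show "\<one>\<^bsub>trunc_group L\<^esub> \<in> carrier (trunc_group L :: ('x list \<Rightarrow> int) monoid)"
    unfolding mem one by (rule exI[of _ 1]) (simp add: coeff_1)
  fix a :: "'x list \<Rightarrow> int" assume "a \<in> carrier (trunc_group L)"
  then obtain f where f: "coeff f [] = 1" "a = trunc L f" by (auto simp: mem)
  show "\<one>\<^bsub>trunc_group L\<^esub> \<otimes>\<^bsub>trunc_group L\<^esub> a = a" unfolding one f trunc_mult by simp
  show "\<exists>b\<in>carrier (trunc_group L). b \<otimes>\<^bsub>trunc_group L\<^esub> a = \<one>\<^bsub>trunc_group L\<^esub>"
  proof (rule bexI[of _ "trunc L (ninv f)"])
    show "trunc L (ninv f) \<otimes>\<^bsub>trunc_group L\<^esub> a = \<one>\<^bsub>trunc_group L\<^esub>"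
      unfolding one f trunc_mult using f by (simp add: ninv_mult)
    show "trunc L (ninv f) \<in> carrier (trunc_group L)" unfolding mem using f coeff_ninv_Nil by blast
  qed
  fix b :: "'x list \<Rightarrow> int" assume "b \<in> carrier (trunc_group L)"
  then obtain g where g: "coeff g [] = 1" "b = trunc L g" by (auto simp: mem)
  show "a \<otimes>\<^bsub>trunc_group L\<^esub> b \<in> carrier (trunc_group L)"
    unfolding mem f g trunc_mult by (rule exI[of _ "f * g"]) (use f g in simp)
  fix c :: "'x list \<Rightarrow> int" assume "c \<in> carrier (trunc_group L)"
  then obtain h where h: "c = trunc L h" by (auto simp: mem)
  show "a \<otimes>\<^bsub>trunc_group L\<^esub> b \<otimes>\<^bsub>trunc_group L\<^esub> c = a \<otimes>\<^bsub>trunc_group L\<^esub> (b \<otimes>\<^bsub>trunc_group L\<^esub> c)"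
    unfolding f g h trunc_mult by (simp add: mult.assoc)
qed

lemma trunc_group_finite: "finite (carrier (trunc_group L :: ('x::finite list \<Rightarrow> int) monoid))"
proof -
  have "finite {w :: 'x list. length w \<le> L}"
    using finite_lists_length_le[of "UNIV :: 'x set" L] by simp
  then have "finite ({w :: 'x list. length w \<le> L} \<rightarrow>\<^sub>E {0..m - 1})" by (intro finite_PiE) auto
  moreover have "carrier (trunc_group L) \<subseteq> {w :: 'x list. length w \<le> L} \<rightarrow>\<^sub>E {0..m - 1}"
    using m by (auto simp: trunc_group_def trunc_def red_def split: if_splits)
  ultimately show ?thesis by (rule finite_subset[rotated])
qed

text \<open>The homomorphisms into the truncations are compatible with each other by uniqueness, so
  the coefficient at w can be read off at level |w|, and products at w involve no longer
  words.\<close>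

lemma magnus_exists:
  fixes \<iota> :: "'x::finite \<Rightarrow> 'g"
  assumes free: "free_profinite_group S T \<iota>"
  shows "\<exists>f \<in> hom S (units_of (ncm m)). f \<in> extensional (carrier S) \<and>
    continuous_map T (product_topology (\<lambda>_. discrete_topology (carrier (residue_ring m))) UNIV) f \<and>
    (\<forall>x. f (\<iota> x) = red m (1 + nvar x)) \<and> (\<forall>\<sigma>\<in>carrier S. f \<sigma> [] = 1)"
proof -
  interpret S: profinite_group S T using free by (simp add: free_profinite_group_def)
  have gen: "range \<iota> \<subseteq> carrier S" "closed_generate S T (range \<iota>) = carrier S"
    using free by (simp_all add: free_profinite_group_def)
  have "\<exists>\<phi> \<in> hom S (trunc_group L). continuous_map T (discrete_topology (carrier (trunc_group L))) \<phi> \<and>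
      (\<forall>x. \<phi> (\<iota> x) = trunc L (1 + nvar x))" for L
    by (rule free_profinite_finite_lift[OF free trunc_group trunc_group_finite])
      (auto simp: trunc_group_def coeff_1 coeff_nvar)
  then obtain \<phi> where phi: "\<And>L. \<phi> L \<in> hom S (trunc_group L)"
    "\<And>L. continuous_map T (discrete_topology (carrier (trunc_group L))) (\<phi> L)"
    "\<And>L x. \<phi> L (\<iota> x) = trunc L (1 + nvar x)"
    by metis
  define f where "f = (\<lambda>\<sigma> \<in> carrier S. \<lambda>w. \<phi> (length w) \<sigma> w)"
  \<comment> \<open>Truncating level L to level |w| gives a continuous homomorphism with the same
    values on the basis as the one chosen at level |w|.\<close>
  have compat: "\<phi> L \<sigma> w = f \<sigma> w" if w: "length w \<le> L" and s: "\<sigma> \<in> carrier S" for L \<sigma> w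
  proof -
    define K where "K = length w"
    define r where "r a = trunc K (NCPS a)" for a :: "'x list \<Rightarrow> int"
    have r: "r (trunc L g) = trunc K g" for g
      using w by (auto simp: r_def trunc_def red_def K_def fun_eq_iff)
    have r_hom: "r \<in> hom (trunc_group L) (trunc_group K)"
    proof (rule homI)
      fix a b :: "'x list \<Rightarrow> int"
      assume "a \<in> carrier (trunc_group L)" "b \<in> carrier (trunc_group L)"
      then obtain g h where "a = trunc L g" "b = trunc L h" "coeff g [] = 1"
        by (auto simp: trunc_group_def)
      then show "r (a \<otimes>\<^bsub>trunc_group L\<^esub> b) = r a \<otimes>\<^bsub>trunc_group K\<^esub> r b"
        by (simp add: trunc_mult r)
    next
      fix a :: "'x list \<Rightarrow> int" assume "a \<in> carrier (trunc_group L)"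
      then show "r a \<in> carrier (trunc_group K)" by (auto simp: trunc_group_def r)
    qed
    have hom: "r \<circ> \<phi> L \<in> hom S (trunc_group K)" by (rule hom_compose[OF phi(1) r_hom])
    have "continuous_map (discrete_topology (carrier (trunc_group L))) (discrete_topology (carrier (trunc_group K))) r"
      by (auto simp: trunc_group_def r)
    then have cont: "continuous_map T (discrete_topology (carrier (trunc_group K))) (r \<circ> \<phi> L)"
      using phi(2) by (rule continuous_map_compose[rotated])
    have "(r \<circ> \<phi> L) \<sigma> = \<phi> K \<sigma>"
      by (rule continuous_hom_unique[OF S.topological_group_axioms gen trunc_group _ hom cont phi(1,2) _ s])
        (auto simp: phi(3) r)
    moreover have "\<phi> L \<sigma> \<in> carrier (trunc_group L)"
      using phi(1)[of L] s by (auto simp: hom_def)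
    then obtain g where g: "\<phi> L \<sigma> = trunc L g" by (auto simp: trunc_group_def)
    ultimately have "\<phi> K \<sigma> = trunc K g" by (simp add: r)
    then show ?thesis using w s by (simp add: f_def K_def g trunc_def)
  qed
  have range: "f \<sigma> w \<in> {0..m - 1}" if "\<sigma> \<in> carrier S" for \<sigma> w
  proof -
    have "\<phi> (length w) \<sigma> \<in> carrier (trunc_group (length w))"
      using phi(1)[of "length w"] that by (auto simp: hom_def)
    then show ?thesis using that m by (auto simp: f_def trunc_group_def trunc_def red_def)
  qed
  then have closed: "f \<sigma> \<in> carrier (ncm m)" if "\<sigma> \<in> carrier S" for \<sigma>
    using that by (auto simp: nc_power_series_def residue_ring_simps)
  have mult: "f (\<sigma> \<otimes>\<^bsub>S\<^esub> \<tau>) = f \<sigma> \<otimes>\<^bsub>ncm m\<^esub> f \<tau>" if s: "\<sigma> \<in> carrier S" and t: "\<tau> \<in> carrier S" for \<sigma> \<tau>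
  proof
    fix w :: "'x list"
    define L where "L = length w"
    have "f (\<sigma> \<otimes>\<^bsub>S\<^esub> \<tau>) w = (\<phi> L \<sigma> \<otimes>\<^bsub>trunc_group L\<^esub> \<phi> L \<tau>) w"
      using phi(1)[of L] s t by (simp add: f_def L_def hom_def)
    also have "\<dots> = (\<Sum>k = 0..length w. \<phi> L \<sigma> (take k w) * \<phi> L \<tau> (drop k w)) mod m"
      by (simp add: trunc_group_def trunc_def L_def red_def coeff_mult)
    also have "(\<Sum>k = 0..length w. \<phi> L \<sigma> (take k w) * \<phi> L \<tau> (drop k w)) =
        (\<Sum>k = 0..length w. f \<sigma> (take k w) * f \<tau> (drop k w))"
      by (intro sum.cong arg_cong2[where f = "(*)"] compat s t refl) (auto simp: L_def)
    also have "\<dots> mod m = (f \<sigma> \<otimes>\<^bsub>ncm m\<^esub> f \<tau>) w"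
      by (simp add: ncm_mult closed s t red_def coeff_mult)
    finally show "f (\<sigma> \<otimes>\<^bsub>S\<^esub> \<tau>) w = (f \<sigma> \<otimes>\<^bsub>ncm m\<^esub> f \<tau>) w" .
  qed
  have one: "f \<one>\<^bsub>S\<^esub> = \<one>\<^bsub>ncm m\<^esub>"
  proof
    fix w :: "'x list"
    interpret h: group_hom S "trunc_group (length w)" "\<phi> (length w)"
      by (intro group_hom.intro group_hom_axioms.intro S.is_group trunc_group phi(1))
    have "\<phi> (length w) \<one>\<^bsub>S\<^esub> = trunc (length w) 1" using h.hom_one by (simp add: trunc_group_def)
    then show "f \<one>\<^bsub>S\<^esub> w = \<one>\<^bsub>ncm m\<^esub> w" by (simp add: f_def trunc_def red_one)
  qed
  have "f \<sigma> \<in> Units (ncm m)" if s: "\<sigma> \<in> carrier S" for \<sigma>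
  proof -
    have "f (inv\<^bsub>S\<^esub> \<sigma>) \<otimes>\<^bsub>ncm m\<^esub> f \<sigma> = \<one>\<^bsub>ncm m\<^esub>" "f \<sigma> \<otimes>\<^bsub>ncm m\<^esub> f (inv\<^bsub>S\<^esub> \<sigma>) = \<one>\<^bsub>ncm m\<^esub>"
      using s by (simp_all add: mult[symmetric] one)
    then show ?thesis unfolding Units_def using closed[OF s] closed[of "inv\<^bsub>S\<^esub> \<sigma>"] s by blast
  qed
  then have "f \<in> hom S (units_of (ncm m))"
    using mult by (auto simp: hom_def units_of_carrier units_of_mult)
  moreover have "continuous_map T (discrete_topology (carrier (residue_ring m))) (\<lambda>\<sigma>. f \<sigma> w)" for w
  proof -
    have "continuous_map (discrete_topology (carrier (trunc_group (length w))))
        (discrete_topology (carrier (residue_ring m))) (\<lambda>a. a w)"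
      using m by (auto simp: trunc_group_def trunc_def red_def residue_ring_simps)
    from continuous_map_compose[OF phi(2) this]
    have "continuous_map T (discrete_topology (carrier (residue_ring m))) (\<lambda>\<sigma>. \<phi> (length w) \<sigma> w)"
      by (simp add: o_def)
    then show ?thesis by (rule continuous_map_eq) (simp add: f_def S.topspace_eq)
  qed
  moreover have "f (\<iota> x) = red m (1 + nvar x)" for x
    using gen(1) by (auto simp: f_def phi(3) trunc_def fun_eq_iff)
  moreover have "f \<sigma> [] = 1" if s: "\<sigma> \<in> carrier S" for \<sigma>
  proof -
    have "\<phi> 0 \<sigma> \<in> carrier (trunc_group 0)" using phi(1)[of 0] s by (auto simp: hom_def)
    then show ?thesis using s m by (auto simp: f_def trunc_group_def trunc_def red_def)
  qed
  moreover have "f \<in> extensional (carrier S)" by (simp add: f_def)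
  ultimately show ?thesis
    by (intro bexI[of _ f]) (auto simp: continuous_map_componentwise_UNIV)
qed

text \<open>Uniqueness on the topological generators justifies the description by
  \<open>THE\<close>. The constant coefficient 1 is recorded because membership in
  \<open>units_of\<close> allows any unit there.\<close>

lemma magnus:
  fixes \<iota> :: "'x::finite \<Rightarrow> 'g"
  assumes free: "free_profinite_group S T \<iota>"
  shows "magnus S T \<iota> (residue_ring m) \<in> hom S (units_of (ncm m))"
    and "continuous_map T (product_topology (\<lambda>_. discrete_topology (carrier (residue_ring m))) UNIV)
      (magnus S T \<iota> (residue_ring m))"
    and "magnus S T \<iota> (residue_ring m) (\<iota> x) = red m (1 + nvar x)"
    and "\<sigma> \<in> carrier S \<Longrightarrow> magnus S T \<iota> (residue_ring m) \<sigma> [] = 1"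
proof -
  interpret S: profinite_group S T using free by (simp add: free_profinite_group_def)
  have gen: "range \<iota> \<subseteq> carrier S" "closed_generate S T (range \<iota>) = carrier S"
    using free by (simp_all add: free_profinite_group_def)
  let ?Y = "product_topology (\<lambda>_. discrete_topology (carrier (residue_ring m))) (UNIV :: 'x list set)"
  let ?P = "\<lambda>f. f \<in> hom S (units_of (ncm m)) \<and> f \<in> extensional (carrier S) \<and>
        continuous_map T ?Y f \<and> (\<forall>x. f (\<iota> x) = \<one>\<^bsub>ncm m\<^esub> \<oplus>\<^bsub>ncm m\<^esub> nc_var (residue_ring m) x)"
  have Y: "Hausdorff_space ?Y" by (simp add: Hausdorff_space_product_topology)
  obtain f where f: "?P f" and f_Nil: "\<And>\<sigma>. \<sigma> \<in> carrier S \<Longrightarrow> f \<sigma> [] = 1"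
    using magnus_exists[OF free] unfolding red_var by blast
  have "g = f" if g: "?P g" for g
  proof (rule extensionalityI[of _ "carrier S"])
    note fc = conjunct1[OF f] conjunct1[OF conjunct2[OF conjunct2[OF f]]]
    note gc = conjunct1[OF g] conjunct1[OF conjunct2[OF conjunct2[OF g]]]
    have eq: "g a = f a" if "a \<in> range \<iota>" for a
      using that f g by (elim rangeE conjE) simp
    fix s assume s: "s \<in> carrier S"
    show "g s = f s"
      by (rule continuous_hom_unique[OF S.topological_group_axioms gen
          monoid.units_group[OF ncm_monoid] Y gc fc eq s])
  next
    show "g \<in> extensional (carrier S)" "f \<in> extensional (carrier S)"
      by (fact conjunct1[OF conjunct2[OF g]] conjunct1[OF conjunct2[OF f]])+
  qed
  with f have magnus_eq: "magnus S T \<iota> (residue_ring m) = f"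
    unfolding magnus_def by (rule the_equality)
  show "\<sigma> \<in> carrier S \<Longrightarrow> magnus S T \<iota> (residue_ring m) \<sigma> [] = 1"
    unfolding magnus_eq by (rule f_Nil)
  have "?P (magnus S T \<iota> (residue_ring m))" unfolding magnus_eq by (rule f)
  then show "magnus S T \<iota> (residue_ring m) \<in> hom S (units_of (ncm m))"
    "continuous_map T ?Y (magnus S T \<iota> (residue_ring m))"
    "magnus S T \<iota> (residue_ring m) (\<iota> x) = red m (1 + nvar x)"
    by (simp_all add: red_var)
qed

text \<open>The Magnus homomorphism and reduction modulo m both carry \<open>tau\<close> to
  \<open>tau\<close>, and their values on the letters agree; so one integral series serves every
  modulus.\<close>

lemma magnus_sigma:
  fixes \<iota> :: "'x::{finite, linorder} \<Rightarrow> 'g"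
  assumes free: "free_profinite_group S T \<iota>"
  shows "magnus S T \<iota> (residue_ring m) (sigma S \<iota> p n w) = red m (ntau w ^ (p ^ (n - length w)))"
proof -
  interpret S: profinite_group S T using free by (simp add: free_profinite_group_def)
  have gen: "range \<iota> \<subseteq> carrier S" using free by (simp add: free_profinite_group_def)
  let ?M = "magnus S T \<iota> (residue_ring m)"
  interpret M: group_hom S "units_of (ncm m)" ?M
    by (intro group_hom.intro group_hom_axioms.intro S.is_group magnus[OF free]
        monoid.units_group[OF ncm_monoid])
  interpret R: group_hom ncps_units "units_of (ncm m)" "red m :: 'x ncps \<Rightarrow> _" by (rule red_hom)
  have var: "range (\<lambda>x :: 'x. 1 + nvar x) \<subseteq> carrier ncps_units" by (auto simp: coeff_1 coeff_nvar)
  have tau: "?M (tau S \<iota> w) = red m (ntau w)"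
    unfolding M.hom_tau[OF gen] R.hom_tau[OF var] by (simp add: o_def magnus(3)[OF free])
  have "?M (sigma S \<iota> p n w) = red m (ntau w) [^]\<^bsub>units_of (ncm m)\<^esub> (p ^ (n - length w))"
    unfolding sigma_def M.hom_nat_pow[OF tau_closed[OF S.is_group gen]] tau ..
  also have "\<dots> = red m (ntau w ^ (p ^ (n - length w)))"
    using R.hom_nat_pow[OF tau_closed[OF group_ncps_units var]] by (simp add: pow_ncps_units)
  finally show ?thesis .
qed

end


section \<open>Unipotent matrices\<close>

text \<open>
  The unipotent matrices over \<open>\<int>/m\<close> are the images of series in letters \<open>1, \<dots>, s\<close>: the entry
  at \<open>(i, j)\<close> is the coefficient of the word \<open>i (i+1) \<dots> (j-1)\<close>.
\<close>

definition umat :: "int \<Rightarrow> nat \<Rightarrow> nat ncps \<Rightarrow> nat \<times> nat \<Rightarrow> int" where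
  "umat m s f = (\<lambda>(i, j) \<in> mat_indices s. if i \<le> j then coeff f [i..<j] mod m else 0)"

lemma umat_apply:
  "i \<in> {1..s + 1} \<Longrightarrow> j \<in> {1..s + 1} \<Longrightarrow> umat m s f (i, j) = (if i \<le> j then coeff f [i..<j] mod m else 0)"
  by (simp add: umat_def)

lemma umat_cong:
  assumes "\<And>i j. 1 \<le> i \<Longrightarrow> i \<le> j \<Longrightarrow> j \<le> s + 1 \<Longrightarrow> [coeff f [i..<j] = coeff g [i..<j]] (mod m)"
  shows "umat m s f = umat m s g"
  using assms by (auto simp: umat_def fun_eq_iff cong_def)

context
  fixes m :: int
  assumes m: "1 < m"
begin

text \<open>Cutting the interval word from i to j - 1 at k yields the interval words of the entries
  (i, k) and (k, j). So the matrix product is the Cauchy product, and the remaining summands vanish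
  by triangularity.\<close>

lemma unip_mult_umat:
  "umat m s f \<otimes>\<^bsub>unip (residue_ring m) s\<^esub> umat m s g = umat m s (f * g)"
proof
  fix u
  show "(umat m s f \<otimes>\<^bsub>unip (residue_ring m) s\<^esub> umat m s g) u = umat m s (f * g) u"
  proof (cases "u \<in> mat_indices s")
    case False
    then show ?thesis by (cases u) (auto simp: unip_def umat_def)
  next
    case True
    then obtain i j where u: "u = (i, j)" and i: "i \<in> {1..s + 1}" and j: "j \<in> {1..s + 1}" by auto
    let ?F = "umat m s f" and ?G = "umat m s g"
    have "(?F \<otimes>\<^bsub>unip (residue_ring m) s\<^esub> ?G) (i, j) = (\<Sum>k\<in>{1..s + 1}. ?F (i, k) * ?G (k, j) mod m) mod m"
      using i j m by (simp add: unip_def finsum_residue_ring residue_ring_simps)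
    also have "\<dots> = (\<Sum>k\<in>{1..s + 1}. ?F (i, k) * ?G (k, j)) mod m" by (rule mod_sum_eq)
    also have "(\<Sum>k\<in>{1..s + 1}. ?F (i, k) * ?G (k, j)) = (\<Sum>k\<in>{i..j}. ?F (i, k) * ?G (k, j))"
      using i j by (intro sum.mono_neutral_right) (auto simp: umat_apply)
    also have "\<dots> mod m = umat m s (f * g) (i, j)"
    proof (cases "i \<le> j")
      case False
      then show ?thesis using i j by (simp add: umat_apply)
    next
      case True
      have "(\<Sum>k\<in>{i..j}. ?F (i, k) * ?G (k, j)) =
          (\<Sum>k\<in>{i..j}. (coeff f [i..<k] mod m) * (coeff g [k..<j] mod m))"
        using i j by (intro sum.cong) (auto simp: umat_apply)
      also have "\<dots> mod m = (\<Sum>k\<in>{i..j}. coeff f [i..<k] * coeff g [k..<j]) mod m"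
        unfolding cong_def[symmetric] by (intro cong_sum cong_mult) auto
      also have "(\<Sum>k\<in>{i..j}. coeff f [i..<k] * coeff g [k..<j]) =
          (\<Sum>k = 0..j - i. coeff f [i..<k + i] * coeff g [k + i..<j])"
        using True sum.shift_bounds_cl_nat_ivl[of "\<lambda>k. coeff f [i..<k] * coeff g [k..<j]" 0 i "j - i"]
        by simp
      also have "\<dots> = coeff (f * g) [i..<j]"
        unfolding coeff_mult using True
        by (intro sum.cong) (auto simp: take_upt drop_upt add.commute[of _ i])
      finally show ?thesis using i j True by (simp add: umat_apply)
    qed
    finally show ?thesis unfolding u .
  qed
qed

lemma unip_one_umat: "\<one>\<^bsub>unip (residue_ring m) s\<^esub> = umat m s 1"
  using m by (auto simp: unip_def umat_def residue_ring_simps coeff_1 fun_eq_iff)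

lemma unip_carrier_umat:
  "carrier (unip (residue_ring m) s) = umat m s ` carrier ncps_units"
proof (intro subset_antisym subsetI)
  fix A assume "A \<in> umat m s ` carrier ncps_units"
  then obtain f where f: "coeff f [] = 1" "A = umat m s f" by auto
  have "umat m s f \<in> mat_indices s \<rightarrow>\<^sub>E {0..m - 1}"
  proof (rule PiE_I)
    fix u assume "u \<in> mat_indices s"
    then show "umat m s f u \<in> {0..m - 1}" using m by (cases u) (simp add: umat_apply)
  qed (simp add: umat_def)
  moreover have "umat m s f (i, i) = 1" if "i \<in> {1..s + 1}" for i
    using that f m by (simp add: umat_apply)
  moreover have "umat m s f (i, j) = 0" if "i \<in> {1..s + 1}" "j \<in> {1..s + 1}" "j < i" for i j
    using that by (simp add: umat_apply)
  ultimately show "A \<in> carrier (unip (residue_ring m) s)"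
    unfolding f(2) unip_def by (simp add: residue_ring_simps)
next
  fix A assume A: "A \<in> carrier (unip (residue_ring m) s)"
  \<comment> \<open>\<open>umat\<close> reads interval words only, and such a word is recovered from
    its first and last letter.\<close>
  define f where "f = NCPS (\<lambda>v. if v = [] then 1 else A (hd v, Suc (last v)))"
  have "A = umat m s f"
  proof
    fix u
    show "A u = umat m s f u"
    proof (cases "u \<in> mat_indices s")
      case False
      then show ?thesis using A by (cases u) (auto simp: unip_def umat_def PiE_def extensional_def)
    next
      case True
      then obtain i j where u: "u = (i, j)" and i: "i \<in> {1..s + 1}" and j: "j \<in> {1..s + 1}" by auto
      have "A (i, j) \<in> {0..m - 1}" using A i j by (auto simp: unip_def residue_ring_simps PiE_iff)
      then have mod: "A (i, j) mod m = A (i, j)" by simp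
      consider "i < j" | "i = j" | "j < i" by linarith
      then show ?thesis
      proof cases
        case 1
        then have "hd [i..<j] = i" "Suc (last [i..<j]) = j" "[i..<j] \<noteq> []" by auto
        then show ?thesis using 1 i j mod by (simp add: u umat_apply f_def)
      next
        case 2
        then show ?thesis using A i j m by (simp add: u umat_apply f_def unip_def residue_ring_simps)
      next
        case 3
        then show ?thesis using A i j by (simp add: u umat_apply unip_def residue_ring_simps)
      qed
    qed
  qed
  moreover have "f \<in> carrier ncps_units" by (simp add: f_def)
  ultimately show "A \<in> umat m s ` carrier ncps_units" by blast
qed

lemma unip_group: "group (unip (residue_ring m) s)"
proof (rule groupI)
  interpret K: group "ncps_units :: nat ncps monoid" by (rule group_ncps_units)
  show "\<one>\<^bsub>unip (residue_ring m) s\<^esub> \<in> carrier (unip (residue_ring m) s)"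
    unfolding unip_carrier_umat unip_one_umat by (rule imageI) (simp add: coeff_1)
  fix A assume "A \<in> carrier (unip (residue_ring m) s)"
  then obtain f where f: "A = umat m s f" "coeff f [] = 1" by (auto simp: unip_carrier_umat)
  show "\<one>\<^bsub>unip (residue_ring m) s\<^esub> \<otimes>\<^bsub>unip (residue_ring m) s\<^esub> A = A"
    unfolding f unip_one_umat unip_mult_umat by simp
  show "\<exists>B\<in>carrier (unip (residue_ring m) s). B \<otimes>\<^bsub>unip (residue_ring m) s\<^esub> A = \<one>\<^bsub>unip (residue_ring m) s\<^esub>"
  proof (rule bexI[of _ "umat m s (ninv f)"])
    show "umat m s (ninv f) \<otimes>\<^bsub>unip (residue_ring m) s\<^esub> A = \<one>\<^bsub>unip (residue_ring m) s\<^esub>"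
      unfolding f unip_one_umat unip_mult_umat using f by (simp add: ninv_mult)
    show "umat m s (ninv f) \<in> carrier (unip (residue_ring m) s)"
      unfolding unip_carrier_umat using f by (intro imageI) simp
  qed
  fix B assume "B \<in> carrier (unip (residue_ring m) s)"
  then obtain g where g: "B = umat m s g" "coeff g [] = 1" by (auto simp: unip_carrier_umat)
  show "A \<otimes>\<^bsub>unip (residue_ring m) s\<^esub> B \<in> carrier (unip (residue_ring m) s)"
    unfolding f g unip_carrier_umat unip_mult_umat using f g by (intro imageI) simp
  fix C assume "C \<in> carrier (unip (residue_ring m) s)"
  then obtain h where h: "C = umat m s h" by (auto simp: unip_carrier_umat)
  show "A \<otimes>\<^bsub>unip (residue_ring m) s\<^esub> B \<otimes>\<^bsub>unip (residue_ring m) s\<^esub> C =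
      A \<otimes>\<^bsub>unip (residue_ring m) s\<^esub> (B \<otimes>\<^bsub>unip (residue_ring m) s\<^esub> C)"
    unfolding f g h unip_mult_umat by (simp add: mult.assoc)
qed

lemma umat_hom: "group_hom ncps_units (unip (residue_ring m) s) (umat m s)"
  by (intro group_hom.intro group_hom_axioms.intro group_ncps_units unip_group)
    (auto simp: hom_def unip_mult_umat unip_carrier_umat)

end

section \<open>An upper bound for the lower p-central filtration of unipotent matrices\<close>

definition filtration_weight :: "nat \<Rightarrow> nat \<Rightarrow> nat \<Rightarrow> int" where
  "filtration_weight p k d = (if d = 0 then 0 else int p ^ (k - d))"

text \<open>The bound that Magnus coefficients obey on the term of index k: divisibility by p ^ (k -
  d) in degree d. The weight 0 in degree 0 forces the constant coefficient to be 1.\<close>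

definition filtration_series :: "nat \<Rightarrow> nat \<Rightarrow> nat ncps set" where
  "filtration_series p k = {f. f - 1 \<in> dv_ideal (filtration_weight p k)}"

lemma filtration_weight_Suc_dvd: "filtration_weight p k (Suc d) dvd filtration_weight p k d"
  by (auto simp: filtration_weight_def le_imp_power_dvd)

text \<open>A factor of weight index 1 is one without constant term; its degree of at least 1 pays
  for the step from k to k + 1.\<close>

lemma filtration_weight_mult_dvd:
  "filtration_weight p (Suc k) (i + j) dvd filtration_weight p 1 i * filtration_weight p k j"
  "filtration_weight p (Suc k) (i + j) dvd filtration_weight p k i * filtration_weight p 1 j"
  by (auto simp: filtration_weight_def le_imp_power_dvd)

lemma dv_ideal_weight_1_iff: "f \<in> dv_ideal (filtration_weight p 1) \<longleftrightarrow> coeff f [] = 0"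
proof -
  have "1 - length w = 0" if "w \<noteq> []" for w :: "'a list" using that by (cases w) auto
  then show ?thesis by (auto simp: dv_ideal_def filtration_weight_def)
qed

lemma filtration_series_units: "f \<in> filtration_series p k \<Longrightarrow> coeff f [] = 1"
  using dv_idealD[of "f - 1" "filtration_weight p k" "[]"]
  by (simp add: filtration_series_def filtration_weight_def coeff_1)

lemma filtration_series_subgroup: "subgroup (filtration_series p k) ncps_units"
proof (rule group.subgroupI[OF group_ncps_units])
  show "filtration_series p k \<subseteq> carrier ncps_units" using filtration_series_units by auto
  show "filtration_series p k \<noteq> {}" by (auto simp: filtration_series_def intro!: exI[of _ 1])
  note right = dv_ideal_mult_right[of "filtration_weight p k", OF filtration_weight_Suc_dvd]
  fix f assume f: "f \<in> filtration_series p k"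
  have f1: "coeff f [] = 1" by (rule filtration_series_units[OF f])
  have "ninv f - 1 = - ((f - 1) * ninv f)" using f1 by (simp add: algebra_simps ninv_mult)
  then show "inv\<^bsub>ncps_units\<^esub> f \<in> filtration_series p k"
    using f right[of "f - 1" "ninv f"] f1
    by (simp add: inv_ncps_units filtration_series_def dv_ideal_minus del: mult_minus_left)
  fix g assume g: "g \<in> filtration_series p k"
  have "(f - 1) * g + (g - 1) \<in> dv_ideal (filtration_weight p k)"
    using f g by (intro dv_ideal_add right) (simp_all add: filtration_series_def)
  moreover have "f * g - 1 = (f - 1) * g + (g - 1)" by (simp add: algebra_simps)
  ultimately show "f \<otimes>\<^bsub>ncps_units\<^esub> g \<in> filtration_series p k"
    by (simp only: filtration_series_def mem_Collect_eq ncps_units_simps)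
qed

text \<open>In the second-order expansion of (1 + g) ^ p the linear term gains the factor p, and the
  multiple of g * g gains a degree.\<close>

lemma filtration_series_pow:
  assumes f: "f \<in> filtration_series p (Suc k)"
  shows "f ^ p \<in> filtration_series p (Suc (Suc k))"
proof -
  define g where "g = f - 1"
  have g: "g \<in> dv_ideal (filtration_weight p (Suc k))" using f by (simp add: g_def filtration_series_def)
  have g1: "g \<in> dv_ideal (filtration_weight p 1)"
    unfolding dv_ideal_weight_1_iff using filtration_series_units[OF f] by (simp add: g_def coeff_1)
  obtain h where h: "(1 + g) ^ p = 1 + of_nat p * g + h * (g * g)" using one_plus_power by blast
  have "g * g \<in> dv_ideal (filtration_weight p (Suc (Suc k)))"
    by (rule dv_ideal_mult[OF g1 g filtration_weight_mult_dvd(1)])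
  then have 1: "h * (g * g) \<in> dv_ideal (filtration_weight p (Suc (Suc k)))"
    by (rule dv_ideal_mult_left[rotated]) (rule filtration_weight_Suc_dvd)
  have 2: "of_nat p * g \<in> dv_ideal (filtration_weight p (Suc (Suc k)))"
    unfolding dv_ideal_def
  proof (intro CollectI allI)
    fix w :: "nat list"
    have "filtration_weight p (Suc (Suc k)) (length w) dvd int p * filtration_weight p (Suc k) (length w)"
      by (auto simp: filtration_weight_def simp flip: power_Suc intro!: le_imp_power_dvd)
    also have "int p * filtration_weight p (Suc k) (length w) dvd int p * coeff g w"
      using dv_idealD[OF g, of w] by (rule mult_dvd_mono[OF dvd_refl])
    finally show "filtration_weight p (Suc (Suc k)) (length w) dvd coeff (of_nat p * g) w" by simp
  qed
  have "f ^ p - 1 = of_nat p * g + h * (g * g)" using h by (simp add: g_def)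
  then show ?thesis using dv_ideal_add[OF 2 1] by (simp add: filtration_series_def)
qed

text \<open>The deviation from 1 is a multiple of a b - b a; as a has no constant term, each product
  gains a degree.\<close>

lemma filtration_series_commutator:
  assumes h: "coeff h [] = 1" and f: "f \<in> filtration_series p (Suc k)"
  shows "commutator ncps_units h f \<in> filtration_series p (Suc (Suc k))"
proof -
  define a b where "a = h - 1" and "b = f - 1"
  have b: "b \<in> dv_ideal (filtration_weight p (Suc k))" using f by (simp add: b_def filtration_series_def)
  have a: "a \<in> dv_ideal (filtration_weight p 1)"
    unfolding dv_ideal_weight_1_iff using h by (simp add: a_def coeff_1)
  have "order_ge 1 a" "order_ge 1 b"
    using h filtration_series_units[OF f] by (simp_all add: a_def b_def order_ge_def coeff_1)
  then obtain q where q: "commutator ncps_units (1 + a) (1 + b) = 1 + (1 + q) * (a * b - b * a)"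
    using commutator_ncps_units by blast
  have "a * b - b * a \<in> dv_ideal (filtration_weight p (Suc (Suc k)))"
    by (intro dv_ideal_diff dv_ideal_mult[OF a b filtration_weight_mult_dvd(1)]
        dv_ideal_mult[OF b a filtration_weight_mult_dvd(2)])
  then have "(1 + q) * (a * b - b * a) \<in> dv_ideal (filtration_weight p (Suc (Suc k)))"
    by (rule dv_ideal_mult_left[rotated]) (rule filtration_weight_Suc_dvd)
  then show ?thesis using q by (simp add: filtration_series_def a_def b_def)
qed

text \<open>The image of the bounded series is a subgroup, closed since the topology is discrete,
  and it contains the generating powers and commutators.\<close>

lemma lower_p_central_unip_subset:
  fixes s :: nat
  assumes m: "1 < m"
  defines "U \<equiv> unip (residue_ring m) s"
  shows "lower_p_central U (discrete_topology (carrier U)) p (Suc k) \<subseteq>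
    umat m s ` filtration_series p (Suc k)"
proof (induction k)
  case 0
  have "filtration_series p (Suc 0) = carrier ncps_units"
    by (auto simp: filtration_series_def coeff_1 dv_ideal_weight_1_iff[unfolded One_nat_def])
  then show ?case using unip_carrier_umat[OF m, of s] by (simp add: U_def)
next
  case (Suc k)
  interpret h: group_hom ncps_units U "umat m s" unfolding U_def by (rule umat_hom[OF m])
  interpret U: topological_group U "discrete_topology (carrier U)"
    by (rule discrete_topological_group[OF h.H.is_group])
  let ?P = "umat m s ` filtration_series p (Suc (Suc k))"
  have sub: "subgroup ?P U" by (rule h.subgroup_img_is_subgroup[OF filtration_series_subgroup])
  show ?case
    unfolding lower_p_central.simps(3)
  proof (rule U.closed_generate_minimal[OF _ sub])
    show "closedin (discrete_topology (carrier U)) ?P"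
      using subgroup.subset[OF sub] by simp
    show "{t [^]\<^bsub>U\<^esub> p |t. t \<in> lower_p_central U (discrete_topology (carrier U)) p (Suc k)} \<union>
      {commutator U a t |a t. a \<in> carrier U \<and>
        t \<in> lower_p_central U (discrete_topology (carrier U)) p (Suc k)} \<subseteq> ?P"
    proof
      fix x assume "x \<in> {t [^]\<^bsub>U\<^esub> p |t. t \<in> lower_p_central U (discrete_topology (carrier U)) p (Suc k)} \<union>
        {commutator U a t |a t. a \<in> carrier U \<and>
          t \<in> lower_p_central U (discrete_topology (carrier U)) p (Suc k)}"
      then consider t where "x = t [^]\<^bsub>U\<^esub> p" "t \<in> lower_p_central U (discrete_topology (carrier U)) p (Suc k)"
        | a t where "x = commutator U a t" "a \<in> carrier U" 
            "t \<in> lower_p_central U (discrete_topology (carrier U)) p (Suc k)"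
        by blast
      then show "x \<in> ?P"
      proof cases
        case 1
        obtain f where f: "f \<in> filtration_series p (Suc k)" "t = umat m s f"
          using subsetD[OF Suc 1(2)] by blast
        have "umat m s (f ^ p) = x"
          using h.hom_nat_pow[of f p] filtration_series_units[OF f(1)] 1(1) f(2)
          by (simp add: pow_ncps_units)
        then show ?thesis using filtration_series_pow[OF f(1)] by blast
      next
        case 2
        obtain f where f: "f \<in> filtration_series p (Suc k)" "t = umat m s f"
          using subsetD[OF Suc 2(3)] by blast
        obtain g where g: "coeff g [] = 1" "a = umat m s g"
          using 2(2) unip_carrier_umat[OF m, of s] by (auto simp: U_def)
        have "umat m s (commutator ncps_units g f) = x"
          using h.hom_commutator[of g f] filtration_series_units[OF f(1)] 2(1) f(2) g by simp
        then show ?thesis using filtration_series_commutator[OF g(1) f(1)] by blast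
      qed
    qed
  qed
qed

section \<open>The corner subgroup of the unipotent matrices\<close>

definition corner_series :: "nat \<Rightarrow> nat \<Rightarrow> nat \<Rightarrow> int \<Rightarrow> nat ncps" where
  "corner_series p n s a = NCPS (\<lambda>v. if v = [1..<s + 1] then a * int p ^ (n - s) else 0)"

text \<open>Up to length s only the constant coefficient of f meets e. The words of matrix entries
  have length at most s, so this makes corner matrices central and their products additive.\<close>

lemma coeff_mult_order_ge:
  assumes "order_ge s e" "length v \<le> s"
  shows "coeff (f * e) v = coeff f [] * coeff e v" "coeff (e * f) v = coeff e v * coeff f []"
proof -
  have "coeff (f * e) v = coeff f [] * coeff e v \<and> coeff (e * f) v = coeff e v * coeff f []"
  proof (cases "length v = s")
    case True
    then show ?thesis
      using coeff_mult_leading[OF order_ge_0 assms(1), of v f]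
        coeff_mult_leading[OF assms(1) order_ge_0, of v f] by simp
  next
    case False
    then have "length v < s" using assms(2) by simp
    then show ?thesis
      using assms(1) order_ge_mult[OF assms(1) order_ge_0, of f] order_ge_mult[OF order_ge_0 assms(1), of f]
      by (simp add: order_ge_def)
  qed
  then show "coeff (f * e) v = coeff f [] * coeff e v" "coeff (e * f) v = coeff e v * coeff f []"
    by simp_all
qed

context
  fixes p n s :: nat
  assumes p: "1 < p" and s: "1 \<le> s" "s \<le> n"
begin

lemma modulus_gt_1: "1 < int p ^ (n - s + 1)"
  using p by (intro one_less_power) auto

text \<open>The letters 1 to s in order form the only interval word of full length, the one read at
  the corner.\<close>

lemma corner_mat_umat: "corner_mat p n s a = umat (int p ^ (n - s + 1)) s (1 + corner_series p n s a)"
proof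
  fix u
  show "corner_mat p n s a u = umat (int p ^ (n - s + 1)) s (1 + corner_series p n s a) u"
  proof (cases "u \<in> mat_indices s")
    case False
    then show ?thesis by (cases u) (auto simp: corner_mat_def umat_def)
  next
    case True
    then obtain i j where u: "u = (i, j)" and i: "i \<in> {1..s + 1}" and j: "j \<in> {1..s + 1}" by auto
    have eq: "[i..<j] = [1..<s + 1] \<longleftrightarrow> i = 1 \<and> j = s + 1" if "i \<le> j"
    proof
      assume e: "[i..<j] = [1..<s + 1]"
      then have "length [i..<j] = s" by simp
      then show "i = 1 \<and> j = s + 1" using i j that by auto
    qed simp
    show ?thesis
      using i j s modulus_gt_1 eq
      by (auto simp: u corner_mat_def umat_apply coeff_1 corner_series_def)
  qed
qed

lemma corner_series_order: "order_ge s (corner_series p n s a)"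
  by (auto simp: order_ge_def corner_series_def)

lemma corner_series_Nil [simp]: "coeff (corner_series p n s a) [] = 0"
  using corner_series_order[of a] s by (simp add: order_ge_def)

lemma corner_mat_closed: "corner_mat p n s a \<in> carrier (unip (Zpk p n s) s)"
  unfolding unip_carrier_umat[OF modulus_gt_1] corner_mat_umat by (rule imageI) (simp add: coeff_1)

lemma corner_mat_add:
  "corner_mat p n s (a + b) = corner_mat p n s a \<otimes>\<^bsub>unip (Zpk p n s) s\<^esub> corner_mat p n s b"
  unfolding corner_mat_umat unip_mult_umat[OF modulus_gt_1]
proof (rule umat_cong)
  fix i j :: nat assume ij: "1 \<le> i" "i \<le> j" "j \<le> s + 1"
  have len: "length [i..<j] \<le> s" using ij by simp
  have "coeff ((1 + corner_series p n s a) * (1 + corner_series p n s b)) [i..<j] =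
      coeff (1 + corner_series p n s a) [i..<j] + coeff (corner_series p n s b) [i..<j]"
    unfolding distrib_left coeff_add coeff_mult_order_ge(1)[OF corner_series_order len]
    by (simp add: coeff_1)
  also have "\<dots> = coeff (1 + corner_series p n s (a + b)) [i..<j]"
    by (simp add: corner_series_def distrib_right)
  finally show "[coeff (1 + corner_series p n s (a + b)) [i..<j] =
      coeff ((1 + corner_series p n s a) * (1 + corner_series p n s b)) [i..<j]] (mod int p ^ (n - s + 1))"
    by (simp only: cong_refl)
qed

lemma corner_mat_central:
  assumes "x \<in> carrier (unip (Zpk p n s) s)"
  shows "x \<otimes>\<^bsub>unip (Zpk p n s) s\<^esub> corner_mat p n s a = corner_mat p n s a \<otimes>\<^bsub>unip (Zpk p n s) s\<^esub> x"
proof -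
  obtain f where f: "coeff f [] = 1" "x = umat (int p ^ (n - s + 1)) s f"
    using assms unfolding unip_carrier_umat[OF modulus_gt_1] by auto
  show ?thesis
    unfolding f(2) corner_mat_umat unip_mult_umat[OF modulus_gt_1]
  proof (rule umat_cong)
    fix i j :: nat assume ij: "1 \<le> i" "i \<le> j" "j \<le> s + 1"
    have len: "length [i..<j] \<le> s" using ij by simp
    show "[coeff (f * (1 + corner_series p n s a)) [i..<j] =
        coeff ((1 + corner_series p n s a) * f) [i..<j]] (mod int p ^ (n - s + 1))"
      using coeff_mult_order_ge[OF corner_series_order[of a] len, of f]
      by (simp add: distrib_left distrib_right f(1))
  qed
qed

lemma corner_mat_corner: "corner_mat p n s a (1, s + 1) = a * int p ^ (n - s) mod int p ^ (n - s + 1)"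
  using s by (simp add: corner_mat_def)

text \<open>The modulus is p times the common factor p ^ (n - s), so dividing by that factor leaves
  residues modulo p.\<close>

lemma corner_cong_iff:
  "[a * int p ^ (n - s) = b * int p ^ (n - s)] (mod int p ^ (n - s + 1)) \<longleftrightarrow> [a = b] (mod int p)"
proof -
  have "a * int p ^ (n - s) - b * int p ^ (n - s) = int p ^ (n - s) * (a - b)" by (simp add: algebra_simps)
  then show ?thesis using p by (simp add: cong_iff_dvd_diff mult.commute[of "int p"])
qed

lemma corner_mat_eq_iff: "corner_mat p n s a = corner_mat p n s b \<longleftrightarrow> [a = b] (mod int p)"
proof
  assume "corner_mat p n s a = corner_mat p n s b"
  then have "corner_mat p n s a (1, s + 1) = corner_mat p n s b (1, s + 1)" by simp
  then show "[a = b] (mod int p)"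
    using corner_cong_iff[of a b] unfolding corner_mat_corner cong_def by iprover
next
  assume "[a = b] (mod int p)"
  then have "a * int p ^ (n - s) mod int p ^ (n - s + 1) = b * int p ^ (n - s) mod int p ^ (n - s + 1)"
    using corner_cong_iff[of a b] unfolding cong_def by iprover
  then show "corner_mat p n s a = corner_mat p n s b" unfolding corner_mat_def by (simp only:)
qed

text \<open>An entry at distance d from the diagonal, with 0 < d < s, is divisible by p ^ (n - d)
  and hence by the modulus; the corner is only known to be divisible by p ^ (n - s).\<close>

lemma unip_filtration_subset: "unip_filtration p n s \<subseteq> range (corner_mat p n s)"
proof
  let ?m = "int p ^ (n - s + 1)"
  fix A assume "A \<in> unip_filtration p n s"
  then have "A \<in> umat ?m s ` filtration_series p n"
    using lower_p_central_unip_subset[OF modulus_gt_1, of s p "n - 1"] s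
    by (auto simp: unip_filtration_def)
  then obtain f where f: "f \<in> filtration_series p n" "A = umat ?m s f" by blast
  have fd: "int p ^ (n - length w) dvd coeff f w" if "w \<noteq> []" for w
    using f(1) that dv_idealD[of "f - 1" "filtration_weight p n" w]
    by (simp add: filtration_series_def filtration_weight_def coeff_1)
  have "[1..<s + 1] \<noteq> []" "length [1..<s + 1] = s" using s by auto
  then obtain a where a: "coeff f [1..<s + 1] = int p ^ (n - s) * a" using fd[of "[1..<s + 1]"] by auto
  have "A = corner_mat p n s a"
    unfolding f(2) corner_mat_umat
  proof (rule umat_cong)
    fix i j :: nat assume ij: "1 \<le> i" "i \<le> j" "j \<le> s + 1"
    consider "i = j" | "i = 1" "j = s + 1" | "i < j" "j - i < s" using ij by linarith
    then show "[coeff f [i..<j] = coeff (1 + corner_series p n s a) [i..<j]] (mod ?m)"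
    proof cases
      case 1
      then show ?thesis using filtration_series_units[OF f(1)] by (simp add: coeff_1)
    next
      case 2
      then show ?thesis using a s by (simp add: coeff_1 corner_series_def mult.commute)
    next
      case 3
      have "?m dvd int p ^ (n - (j - i))" using 3 s by (intro le_imp_power_dvd) simp
      then have "?m dvd coeff f [i..<j]" using fd[of "[i..<j]"] 3 by (auto intro: dvd_trans)
      moreover have "coeff (1 + corner_series p n s a) [i..<j] = 0"
        using corner_series_order[of a] 3 by (simp add: coeff_1 order_ge_def)
      ultimately show ?thesis by (simp add: cong_0_iff)
    qed
  qed
  then show "A \<in> range (corner_mat p n s)" by blast
qed

lemma unip_filtration_normal: "unip_filtration p n s \<lhd> unip (Zpk p n s) s"
  unfolding unip_filtration_def
  by (rule topological_group.lower_p_central_normal[OF discrete_topological_group[OF unip_group[OF modulus_gt_1]]])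

lemma corner_central_quotient:
  "central_quotient (unip_filtration p n s) (unip (Zpk p n s) s) (corner_mat p n s) p"
proof -
  interpret normal "unip_filtration p n s" "unip (Zpk p n s) s" by (rule unip_filtration_normal)
  show ?thesis
    by unfold_locales (fact p corner_mat_closed corner_mat_add corner_mat_central corner_mat_eq_iff
        unip_filtration_subset)+
qed

end


section \<open>The entries of the pairing matrix\<close>

text \<open>There are finitely many coordinates with discrete values, so the preimage of a single
  tuple A is a finite intersection of open sets.\<close>

lemma continuous_map_discrete_PiE:
  assumes I: "finite I" and F: "\<And>i. i \<in> I \<Longrightarrow> continuous_map X (discrete_topology D) (\<lambda>x. f x i)"
    and C: "\<And>x. x \<in> topspace X \<Longrightarrow> f x \<in> C" "C \<subseteq> extensional I"
  shows "continuous_map X (discrete_topology C) f"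
  unfolding continuous_map_def
proof (intro conjI allI impI)
  show "f \<in> topspace X \<rightarrow> topspace (discrete_topology C)" using C by simp
  fix U assume "openin (discrete_topology C) U"
  then have U: "U \<subseteq> C" by simp
  have "{x \<in> topspace X. f x \<in> U} =
      (\<Union>A\<in>U. topspace X \<inter> (\<Inter>i\<in>I. {x \<in> topspace X. f x i \<in> {A i} \<inter> D}))"
  proof (intro subset_antisym subsetI)
    fix x assume x: "x \<in> {x \<in> topspace X. f x \<in> U}"
    have "f x i \<in> D" if "i \<in> I" for i
      using continuous_map_image_subset_topspace[OF F[OF that]] x by auto
    then show "x \<in> (\<Union>A\<in>U. topspace X \<inter> (\<Inter>i\<in>I. {x \<in> topspace X. f x i \<in> {A i} \<inter> D}))"
      using x by (intro UN_I[of "f x"]) auto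
  next
    fix x assume "x \<in> (\<Union>A\<in>U. topspace X \<inter> (\<Inter>i\<in>I. {x \<in> topspace X. f x i \<in> {A i} \<inter> D}))"
    then obtain A where A: "A \<in> U" "x \<in> topspace X" "\<And>i. i \<in> I \<Longrightarrow> f x i = A i" by auto
    have "f x = A"
      by (rule extensionalityI[of _ I]) (use A C U in auto)
    then show "x \<in> {x \<in> topspace X. f x \<in> U}" using A by simp
  qed
  moreover have "openin X (\<Union>A\<in>U. topspace X \<inter> (\<Inter>i\<in>I. {x \<in> topspace X. f x i \<in> {A i} \<inter> D}))"
  proof (intro openin_Union ballI)
    fix W assume "W \<in> (\<lambda>A. topspace X \<inter> (\<Inter>i\<in>I. {x \<in> topspace X. f x i \<in> {A i} \<inter> D})) ` U"
    then obtain A where W: "W = topspace X \<inter> (\<Inter>i\<in>I. {x \<in> topspace X. f x i \<in> {A i} \<inter> D})" by blast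
    have "openin X {x \<in> topspace X. f x i \<in> {A i} \<inter> D}" if "i \<in> I" for i
      by (rule openin_continuous_map_preimage[OF F[OF that]]) simp
    then show "openin X W" unfolding W using I by (intro openin_Int_Inter) auto
  qed
  ultimately show "openin X {x \<in> topspace X. f x \<in> U}" by simp
qed

text \<open>For n at least 2 the term is topologically generated by p-th powers and commutators. A
  homomorphism to the prime field kills these, and its kernel is closed.\<close>

lemma (in topological_group) lower_p_central_hom_zero:
  assumes p: "1 < p" and n: "n \<ge> 2"
    and f: "continuous_map T (Fp_topology p) f"
      "\<And>g h. g \<in> carrier G \<Longrightarrow> h \<in> carrier G \<Longrightarrow> f (g \<otimes> h) = (f g + f h) mod int p"
    and v: "v \<in> lower_p_central G T p n"
  shows "f v = 0"
proof -
  have range: "f g \<in> {0..<int p}" if "g \<in> carrier G" for g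
    using continuous_map_image_subset_topspace[OF f(1)] that p by (auto simp: topspace_eq Fp_arith)
  have zero: "f g = 0" if "g \<in> carrier G" "int p dvd f g" for g
    using range[OF that(1)] that(2) by (auto dest: zdvd_imp_le)
  have one: "f \<one> = 0"
  proof (rule zero)
    have "[f \<one> + 0 = f \<one> + f \<one>] (mod int p)" using f(2)[of \<one> \<one>] range[of \<one>] by (simp add: cong_def)
    then have "[0 = f \<one>] (mod int p)" using cong_add_lcancel by blast
    then show "int p dvd f \<one>" using cong_0_iff cong_sym by blast
  qed simp
  have mult: "[f (g \<otimes> h) = f g + f h] (mod int p)" if "g \<in> carrier G" "h \<in> carrier G" for g h
    using f(2)[OF that] by (simp add: cong_def)
  have inv: "[f (inv g) = - f g] (mod int p)" if "g \<in> carrier G" for g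
  proof -
    have "[f g + f (inv g) = f g + - f g] (mod int p)" using mult[of g "inv g"] that one by (simp add: cong_sym)
    then show ?thesis using cong_add_lcancel by blast
  qed
  have pow: "[f (g [^] k) = int k * f g] (mod int p)" if "g \<in> carrier G" for g and k :: nat
  proof (induction k)
    case (Suc k)
    have "[f (g [^] k \<otimes> g) = int k * f g + f g] (mod int p)"
      by (rule cong_trans[OF mult cong_add[OF Suc cong_refl]]) (use that in simp_all)
    then show ?case by (simp add: algebra_simps)
  qed (simp add: one)
  have comm: "[f (commutator G s t) = 0] (mod int p)" if s: "s \<in> carrier G" and t: "t \<in> carrier G" for s t
  proof -
    have "[f (inv s \<otimes> inv t \<otimes> s \<otimes> t) = f (inv s) + f (inv t) + f s + f t] (mod int p)"
      using s t by (intro cong_trans[OF mult cong_add[OF _ cong_refl]]) (simp_all add: mult)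
    also have "[f (inv s) + f (inv t) + f s + f t = - f s + - f t + f s + f t] (mod int p)"
      using s t by (intro cong_add cong_refl inv)
    finally show ?thesis by (simp add: commutator_def)
  qed
  define K where "K = {g \<in> carrier G. f g = 0}"
  have "subgroup K G"
  proof (rule subgroupI)
    show "K \<subseteq> carrier G" "K \<noteq> {}" using one by (auto simp: K_def)
    fix a assume a: "a \<in> K"
    then show "inv a \<in> K" using inv[of a] by (auto simp: K_def cong_0_iff intro: zero)
    fix b assume "b \<in> K"
    then show "a \<otimes> b \<in> K" using a f(2)[of a b] by (auto simp: K_def)
  qed
  moreover have "closedin T K"
  proof -
    have "closedin (Fp_topology p) {0}" using p by (simp add: Fp_arith)
    from closedin_continuous_map_preimage[OF f(1) this] show ?thesis by (simp add: K_def topspace_eq)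
  qed
  moreover obtain k where k: "n = Suc (Suc k)" using n by (metis Suc_le_D numeral_2_eq_2 Suc_le_mono)
  moreover have "{t [^] p |t. t \<in> lower_p_central G T p (Suc k)} \<union>
     {commutator G s t |s t. s \<in> carrier G \<and> t \<in> lower_p_central G T p (Suc k)} \<subseteq> K"
  proof -
    have "t [^] p \<in> K" if "t \<in> carrier G" for t
      using pow[OF that, of p] that by (auto simp: K_def intro!: zero) (simp add: cong_dvd_iff)
    moreover have "commutator G s t \<in> K" if "s \<in> carrier G" "t \<in> carrier G" for s t
      using comm[OF that] that by (auto simp: K_def cong_0_iff intro: zero)
    ultimately show ?thesis using lower_p_central_subset[of p "Suc k"] by blast
  qed
  ultimately have "lower_p_central G T p n \<subseteq> K"
    unfolding k lower_p_central.simps(3) by (intro closed_generate_minimal)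
  then show ?thesis using v by (auto simp: K_def)
qed

text \<open>Positions in w, counted from 1 like matrix indices, are sent to the letters of w.
  Reading coefficients through this map respects products because it acts letter by letter and
  commutes with cutting words; it presents \<rho> as \<open>umat\<close> of a series in
  positions.\<close>

definition letters :: "'x list \<Rightarrow> 'x ncps \<Rightarrow> nat ncps" where
  "letters w f = NCPS (\<lambda>v. coeff f (map (\<lambda>k. w ! (k - 1)) v))"

lemma letters_mult: "letters w (f * g) = letters w f * letters w g"
  by (rule ncps_eqI) (simp add: letters_def coeff_mult take_map drop_map)

lemma map_nth_upt:
  assumes "1 \<le> i" "i \<le> j" "j \<le> length w + 1"
  shows "map (\<lambda>k. w ! (k - 1)) [i..<j] = take (j - i) (drop (i - 1) w)"
  using assms by (intro nth_equalityI) auto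

context
  fixes p n :: nat and S :: "'s monoid" and T :: "'s topology" and \<iota> :: "'x::{finite, linorder} \<Rightarrow> 's"
  assumes p: "prime p" and n: "n \<ge> 2" and free: "free_profinite_group S T \<iota>"
begin

interpretation S: profinite_group S T
  using free by (simp add: free_profinite_group_def)

lemma p_gt_1: "1 < p"
  using p by (rule prime_gt_1_nat)

lemma basis: "range \<iota> \<subseteq> carrier S" "closed_generate S T (range \<iota>) = carrier S"
  using free by (simp_all add: free_profinite_group_def)

abbreviation N where "N \<equiv> lower_p_central S T p n"

lemma open_normal_N: "open_normal S T N p"
proof -
  interpret normal N S by (rule S.lower_p_central_normal)
  show ?thesis
    by unfold_locales
      (use S.lower_p_central_open[OF _ basis, of p n] p_gt_1 in auto)
qed

context
  fixes w :: "'x list"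
  assumes w: "w \<noteq> []" "length w \<le> n"
begin

abbreviation (input) modulus where "modulus \<equiv> int p ^ (n - length w + 1)"

lemma length_bounds: "1 \<le> length w" "length w \<le> n"
  using w by (auto simp: Suc_le_eq)

lemmas modulus = modulus_gt_1[OF p_gt_1 length_bounds]

abbreviation (input) Mag where "Mag \<equiv> magnus S T \<iota> (residue_ring modulus)"
abbreviation (input) rho where "rho \<equiv> magnus_rep S T \<iota> (residue_ring modulus) w"

lemma Mag_closed: "\<sigma> \<in> carrier S \<Longrightarrow> Mag \<sigma> \<in> carrier (ncm modulus)"
  using magnus(1)[OF modulus free] by (auto simp: hom_def units_of_carrier Units_def)

text \<open>Interval words of positions become the subwords of w in \<open>magnus_rep\<close>; the
  reduction in \<open>umat\<close> changes nothing, as the Magnus coefficients are already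
  reduced.\<close>

lemma rho_umat:
  assumes "\<sigma> \<in> carrier S"
  shows "rho \<sigma> = umat modulus (length w) (letters w (NCPS (Mag \<sigma>)))"
proof
  fix u
  show "rho \<sigma> u = umat modulus (length w) (letters w (NCPS (Mag \<sigma>))) u"
  proof (cases "u \<in> mat_indices (length w)")
    case False
    then show ?thesis by (cases u) (auto simp: magnus_rep_def umat_def)
  next
    case True
    then obtain i j where u: "u = (i, j)" and i: "i \<in> {1..length w + 1}" and j: "j \<in> {1..length w + 1}"
      by auto
    have "Mag \<sigma> v mod modulus = Mag \<sigma> v" for v
      using red_NCPS[OF modulus Mag_closed[OF assms]] by (simp add: red_def fun_eq_iff)
    then show ?thesis
      using i j map_nth_upt[of i j w]
      by (auto simp: u magnus_rep_def umat_apply letters_def magnus_coeff_def residue_ring_simps)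
  qed
qed

lemma letters_units: "\<sigma> \<in> carrier S \<Longrightarrow> letters w (NCPS (Mag \<sigma>)) \<in> carrier ncps_units"
  using magnus(4)[OF modulus free] by (simp add: letters_def)

lemma rho_hom: "rho \<in> hom S (unip (residue_ring modulus) (length w))"
proof (rule homI)
  fix \<sigma> \<tau> assume s: "\<sigma> \<in> carrier S" and t: "\<tau> \<in> carrier S"
  show "rho \<sigma> \<in> carrier (unip (residue_ring modulus) (length w))"
    unfolding unip_carrier_umat[OF modulus] rho_umat[OF s] using letters_units[OF s] by (rule imageI)
  have st: "\<sigma> \<otimes>\<^bsub>S\<^esub> \<tau> \<in> carrier S" using s t by simp
  have "Mag (\<sigma> \<otimes>\<^bsub>S\<^esub> \<tau>) = red modulus (NCPS (Mag \<sigma>) * NCPS (Mag \<tau>))"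
    using hom_mult[OF magnus(1)[OF modulus free] s t] ncm_mult[OF modulus Mag_closed[OF s] Mag_closed[OF t]]
    by (simp add: units_of_mult)
  then have "umat modulus (length w) (letters w (NCPS (Mag (\<sigma> \<otimes>\<^bsub>S\<^esub> \<tau>)))) =
      umat modulus (length w) (letters w (NCPS (Mag \<sigma>) * NCPS (Mag \<tau>)))"
    by (intro umat_cong) (simp add: letters_def red_def)
  then show "rho (\<sigma> \<otimes>\<^bsub>S\<^esub> \<tau>) = rho \<sigma> \<otimes>\<^bsub>unip (residue_ring modulus) (length w)\<^esub> rho \<tau>"
    unfolding rho_umat[OF s] rho_umat[OF t] rho_umat[OF st] unip_mult_umat[OF modulus] letters_mult .
qed

lemma rho_continuous:
  "continuous_map T (discrete_topology (carrier (unip (residue_ring modulus) (length w)))) rho"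
proof (rule continuous_map_discrete_PiE[of "mat_indices (length w)" _ "carrier (residue_ring modulus)"])
  show "finite (mat_indices (length w))" by simp
  show "rho \<sigma> \<in> carrier (unip (residue_ring modulus) (length w))" if "\<sigma> \<in> topspace T" for \<sigma>
    using rho_hom that by (auto simp: hom_def S.topspace_eq)
  show "carrier (unip (residue_ring modulus) (length w)) \<subseteq> extensional (mat_indices (length w))"
    by (auto simp: unip_def PiE_iff)
  fix u assume "u \<in> mat_indices (length w)"
  then obtain i j where u: "u = (i, j)" "i \<in> {1..length w + 1}" "j \<in> {1..length w + 1}" by auto
  have coord: "continuous_map T (discrete_topology (carrier (residue_ring modulus))) (\<lambda>\<sigma>. Mag \<sigma> v)" for v
    using magnus(2)[OF modulus free] by (simp add: continuous_map_componentwise_UNIV)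
  show "continuous_map T (discrete_topology (carrier (residue_ring modulus))) (\<lambda>\<sigma>. rho \<sigma> u)"
  proof (cases "i \<le> j")
    case True
    then have "(\<lambda>\<sigma>. rho \<sigma> u) = (\<lambda>\<sigma>. Mag \<sigma> (take (j - i) (drop (i - 1) w)))"
      using u by (simp add: magnus_rep_def magnus_coeff_def)
    then show ?thesis using coord by simp
  next
    case False
    then have "(\<lambda>\<sigma>. rho \<sigma> u) = (\<lambda>\<sigma>. 0)" using u by (simp add: magnus_rep_def residue_ring_simps)
    then show ?thesis using modulus by (simp add: residue_ring_simps)
  qed
qed

lemma rho_N: "rho ` N \<subseteq> unip_filtration p n (length w)"
  unfolding unip_filtration_def
  by (rule hom_lower_p_central[OF S.topological_group_axioms
      discrete_topological_group[OF unip_group[OF modulus]] rho_hom rho_continuous])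

text \<open>Elements of a coset of N differ by a factor in N, which \<rho> sends into the
  filtration; so \<open>the_elem\<close> is applied to a singleton.\<close>

lemma rho_bar:
  assumes g: "g \<in> carrier S"
  shows "magnus_rep_bar S T \<iota> p n w (N #>\<^bsub>S\<^esub> g) =
    unip_filtration p n (length w) #>\<^bsub>unip (residue_ring modulus) (length w)\<^esub> rho g"
proof -
  let ?U = "unip (residue_ring modulus) (length w)" and ?F = "unip_filtration p n (length w)"
  interpret F: normal ?F ?U by (rule unip_filtration_normal[OF p_gt_1 length_bounds])
  interpret N: normal N S by (rule S.lower_p_central_normal)
  interpret r: group_hom S ?U rho
    by (intro group_hom.intro group_hom_axioms.intro S.is_group unip_group[OF modulus] rho_hom)
  have "?F #>\<^bsub>?U\<^esub> rho \<sigma> = ?F #>\<^bsub>?U\<^esub> rho g" if "\<sigma> \<in> N #>\<^bsub>S\<^esub> g" for \<sigma>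
  proof -
    obtain v where v: "v \<in> N" "\<sigma> = v \<otimes>\<^bsub>S\<^esub> g" using \<open>\<sigma> \<in> N #>\<^bsub>S\<^esub> g\<close> by (auto simp: r_coset_def)
    have vc: "v \<in> carrier S" using v N.subset by blast
    have vF: "rho v \<in> ?F" using rho_N v by blast
    have "?F #>\<^bsub>?U\<^esub> rho \<sigma> = (?F #>\<^bsub>?U\<^esub> rho v) #>\<^bsub>?U\<^esub> rho g"
      unfolding v(2) r.hom_mult[OF vc g]
      by (rule F.coset_mult_assoc[OF F.subset r.hom_closed[OF vc] r.hom_closed[OF g], symmetric])
    also have "?F #>\<^bsub>?U\<^esub> rho v = ?F"
      by (rule F.coset_join2[OF r.hom_closed[OF vc] F.is_subgroup vF])
    finally show ?thesis .
  qed
  moreover have "N #>\<^bsub>S\<^esub> g \<noteq> {}" using S.rcos_self[OF g N.is_subgroup] by blast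
  ultimately have "(\<lambda>\<sigma>. ?F #>\<^bsub>?U\<^esub> rho \<sigma>) ` (N #>\<^bsub>S\<^esub> g) = {?F #>\<^bsub>?U\<^esub> rho g}" by blast
  then show ?thesis unfolding magnus_rep_bar_def Let_def by (simp only: the_elem_eq)
qed

lemma pullback: "extension_pullback S T N p (unip_filtration p n (length w))
    (unip (residue_ring modulus) (length w)) (corner_mat p n (length w)) rho (magnus_rep_bar S T \<iota> p n w)"
  by (intro extension_pullback.intro extension_pullback_axioms.intro open_normal_N
      corner_central_quotient[OF p_gt_1 length_bounds] rho_hom rho_continuous rho_N rho_bar)

lemma pairing_corner:
  assumes "v \<in> N" "rho v = corner_mat p n (length w) a"
  shows "transgression_pairing S T p n v (alpha S T \<iota> p n w) = a mod int p"
proof -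
  interpret P: extension_pullback S T N p "unip_filtration p n (length w)"
    "unip (residue_ring modulus) (length w)" "corner_mat p n (length w)" rho "magnus_rep_bar S T \<iota> p n w"
    by (rule pullback)
  \<comment> \<open>\<open>omega\<close> is the class of the extension in the sense of
    \<open>central_quotient\<close>, and for that class any section may be used, in particular the
    normalized one.\<close>
  have omega: "omega p n (length w) =
      H2_class (unip_bar p n (length w)) (discrete_topology (carrier (unip_bar p n (length w)))) p
        (P.E.section_cocycle P.theta)"
    using P.E.extension_class[OF P.theta_section]
    by (simp only: omega_def unip_bar_def Let_def P.E.section_cocycle_def P.E.kernel_coord_def
        P.E.is_section_def)
  show ?thesis
    unfolding transgression_pairing_def alpha_def Let_def omega unip_bar_def
    by (rule P.pairing_pullback[OF _ assms])
      (rule S.lower_p_central_hom_zero[OF p_gt_1 n])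
qed

text \<open>The corner entry of \<rho> is the coefficient of the whole word w. The integer a is
  determined only modulo p, hence the existential form.\<close>

lemma pairing_coeff:
  assumes "v \<in> N"
  shows "\<exists>a. transgression_pairing S T p n v (alpha S T \<iota> p n w) = a mod int p \<and>
    Mag v w = a * int p ^ (n - length w) mod modulus"
proof -
  have v: "v \<in> carrier S" using assms S.lower_p_central_subset by blast
  have "rho v \<in> range (corner_mat p n (length w))"
    using rho_N assms unip_filtration_subset[OF p_gt_1 length_bounds] by blast
  then obtain a where a: "rho v = corner_mat p n (length w) a" by blast
  have "rho v (1, length w + 1) = Mag v w"
    by (simp add: magnus_rep_def magnus_coeff_def)
  then have "Mag v w = a * int p ^ (n - length w) mod modulus"
    using corner_mat_corner[OF p_gt_1 length_bounds, of a] by (simp only: a)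
  then show ?thesis using pairing_corner[OF assms a] by blast
qed

end

text \<open>The congruence of \<open>coeff_ntau_power\<close> is divided by p ^ (n - |z|), which
  leaves a congruence modulo p. For words of equal length this factor is exactly the one produced by
  the power in \<open>sigma\<close>.\<close>

lemma pairing_sigma_alpha:
  assumes w: "w \<in> Lyn n" and z: "z \<in> Lyn n"
  shows "transgression_pairing S T p n (sigma S \<iota> p n w) (alpha S T \<iota> p n z) =
    (if length z = length w then coeff (ntau w - 1) z mod int p else 0)"
proof -
  have w': "lyndon w" "length w \<le> n" "w \<noteq> []" and z': "lyndon z" "length z \<le> n" "z \<noteq> []"
    using w z by (auto simp: Lyn_def lyndon_def)
  define m where "m = int p ^ (n - length z + 1)"
  have m: "1 < m" unfolding m_def by (rule modulus[OF z'(3,2)])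
  have sN: "sigma S \<iota> p n w \<in> N"
    by (rule S.sigma_lower_p_central[OF basis(1) w'(3,2)])
  from pairing_coeff[OF z'(3,2) sN] obtain a where
    a: "transgression_pairing S T p n (sigma S \<iota> p n w) (alpha S T \<iota> p n z) = a mod int p"
    and c: "magnus S T \<iota> (residue_ring m) (sigma S \<iota> p n w) z = a * int p ^ (n - length z) mod m"
    unfolding m_def by blast
  have "[a * int p ^ (n - length z) = coeff (ntau w ^ (p ^ (n - length w))) z] (mod m)"
    using c unfolding magnus_sigma[OF m free] red_def cong_def by (rule sym)
  also have "[coeff (ntau w ^ (p ^ (n - length w))) z =
    (if length z = length w then int p ^ (n - length w) * coeff (ntau w - 1) z else 0)] (mod m)"
    unfolding m_def by (rule coeff_ntau_power[OF w'(1,2) z'(1,2)])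
  finally have "[a * int p ^ (n - length z) =
     (if length z = length w then coeff (ntau w - 1) z else 0) * int p ^ (n - length z)] (mod m)"
    by (simp add: mult.commute split: if_splits)
  then have "[a = (if length z = length w then coeff (ntau w - 1) z else 0)] (mod int p)"
    unfolding m_def corner_cong_iff[OF p_gt_1 length_bounds[OF z'(3,2)]] .
  then show ?thesis unfolding a by (simp add: cong_def)
qed

end

section \<open>The block structure\<close>

text \<open>The head of a sorted list is related to all later members, so by asymmetry the two heads
  agree and do not recur; the tails then have equal sets.\<close>

lemma sorted_wrt_unique:
  assumes asym: "\<And>x y. R x y \<Longrightarrow> \<not> R y x"
  shows "sorted_wrt R xs \<Longrightarrow> sorted_wrt R ys \<Longrightarrow> set xs = set ys \<Longrightarrow> xs = ys"
proof (induction xs arbitrary: ys)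
  case (Cons x xs)
  then obtain y ys' where ys: "ys = y # ys'" by (cases ys) auto
  have Rx: "\<And>z. z \<in> set xs \<Longrightarrow> R x z" and Ry: "\<And>z. z \<in> set ys' \<Longrightarrow> R y z"
    and eq: "insert x (set xs) = insert y (set ys')"
    using Cons.prems unfolding ys by auto
  have "x = y"
  proof (rule ccontr)
    assume "x \<noteq> y"
    have "x \<in> insert y (set ys')" unfolding eq[symmetric] by simp
    moreover have "y \<in> insert x (set xs)" unfolding eq by simp
    ultimately have "x \<in> set ys'" "y \<in> set xs" using \<open>x \<noteq> y\<close> by auto
    then show False using Rx Ry asym by blast
  qed
  moreover have "x \<notin> set xs" "y \<notin> set ys'" using Rx Ry asym by blast+
  then have "set xs = set ys'" using Cons.prems(3) \<open>x = y\<close> unfolding ys by auto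
  then have "xs = ys'" using Cons.prems by (intro Cons.IH) (auto simp: ys)
  ultimately show ?case by (simp add: ys)
qed simp

lemma mat_append_four_block:
  fixes F :: "'a \<Rightarrow> 'a \<Rightarrow> int"
  assumes "\<And>x y. x \<in> set xs \<Longrightarrow> y \<in> set ys \<Longrightarrow> F x y = 0 \<and> F y x = 0"
  defines "M \<equiv> \<lambda>zs. mat (length zs) (length zs) (\<lambda>(i, j). F (zs ! i) (zs ! j))"
  shows "M (xs @ ys) = four_block_mat (M xs) (0\<^sub>m (length xs) (length ys)) (0\<^sub>m (length ys) (length xs)) (M ys)"
  by (rule eq_matI) (auto simp: M_def nth_append assms(1))

text \<open>Here \<open>sorted_wrt\<close> expresses no order; it quantifies over pairs of lists at
  different positions.\<close>

lemma mat_concat_diag_block: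
  fixes F :: "'a \<Rightarrow> 'a \<Rightarrow> int"
  defines "M \<equiv> \<lambda>zs. mat (length zs) (length zs) (\<lambda>(i, j). F (zs ! i) (zs ! j))"
  assumes "sorted_wrt (\<lambda>xs ys. \<forall>x\<in>set xs. \<forall>y\<in>set ys. F x y = 0 \<and> F y x = 0) xss"
  shows "M (concat xss) = diag_block_mat (map M xss)"
  using assms(2)
proof (induction xss)
  case Nil
  show ?case by (rule eq_matI) (auto simp: M_def)
next
  case (Cons xs xss)
  have dim: "dim_row (M zs) = length zs" "dim_col (M zs) = length zs" for zs by (simp_all add: M_def)
  have "M (concat (xs # xss)) = four_block_mat (M xs) (0\<^sub>m (length xs) (length (concat xss)))
      (0\<^sub>m (length (concat xss)) (length xs)) (M (concat xss))"
    unfolding M_def concat.simps using Cons.prems by (intro mat_append_four_block) auto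
  also have "\<dots> = diag_block_mat (map M (xs # xss))"
    using Cons by (simp add: Let_def dim flip: Cons.IH)
  finally show ?case .
qed

lemma finite_Lyn: "finite (Lyn n :: 'x::{finite, linorder} list set)"
  using finite_lists_length_le[of "UNIV :: 'x set" n] by (auto simp: Lyn_def elim: finite_subset[rotated])

lemma perm_class_eq: "v \<in> perm_class n w \<Longrightarrow> perm_class n v = perm_class n w"
  by (auto simp: perm_class_def)

lemma perm_class_less_asym: "perm_class_less C D \<Longrightarrow> \<not> perm_class_less D C"
  by (auto simp: perm_class_less_def length_lex_less_def)

lemma Lyn_less_asym: "Lyn_less n w v \<Longrightarrow> \<not> Lyn_less n v w"
proof -
  have "\<not> (perm_class_less D C \<or> D = C \<and> v < w)" if "perm_class_less C D \<or> C = D \<and> w < v" for C D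
    using that perm_class_less_asym[of C D] perm_class_less_asym[of C C] by auto
  then show "Lyn_less n w v \<Longrightarrow> \<not> Lyn_less n v w" unfolding Lyn_less_def .
qed

text \<open>The concatenation of the classes, each listed lexicographically, is sorted as well and
  has the same members, so uniqueness of sorted enumerations identifies the two lists.\<close>

lemma Lyn_order_concat:
  fixes ws :: "'x::{finite, linorder} list list"
  assumes ws: "set ws = Lyn n" "sorted_wrt (Lyn_less n) ws"
    and Cs: "set Cs = perm_class n ` Lyn n" "sorted_wrt perm_class_less Cs"
  shows "ws = concat (map sorted_list_of_set Cs)"
proof (rule sorted_wrt_unique[OF Lyn_less_asym ws(2)])
  have fin: "finite (perm_class n w)" for w :: "'x list"
    by (rule finite_subset[OF _ finite_Lyn[of n]]) (auto simp: perm_class_def)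
  have mem: "perm_class n v = C \<and> finite C" if "C \<in> set Cs" "v \<in> C" for C v
  proof -
    obtain x where x: "C = perm_class n x" using \<open>C \<in> set Cs\<close> Cs(1) by auto
    then show ?thesis using perm_class_eq[of v n x] \<open>v \<in> C\<close> fin by simp
  qed
  have finC: "finite C" if "C \<in> set Cs" for C using that Cs(1) fin by auto
  have union: "(\<Union>C\<in>set Cs. C) = Lyn n" unfolding Cs(1) by (auto simp: perm_class_def)
  show "set ws = set (concat (map sorted_list_of_set Cs))"
    using union finC by (auto simp: ws(1))
  show "sorted_wrt (Lyn_less n) (concat (map sorted_list_of_set Cs))"
    using Cs(2) mem finC
  proof (induction Cs)
    case (Cons C Cs)
    have C: "finite C" and memC: "\<And>v. v \<in> C \<Longrightarrow> perm_class n v = C" using Cons.prems by auto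
    have "sorted_wrt (Lyn_less n) (sorted_list_of_set C)"
      by (rule sorted_wrt_mono_rel[OF _ strict_sorted_list_of_set])
        (use C memC in \<open>auto simp: Lyn_less_def\<close>)
    moreover have "Lyn_less n v u" if v: "v \<in> C" and D: "D \<in> set Cs" and u: "u \<in> D" for v u D
    proof -
      have "perm_class_less C D" using Cons.prems(1) D by simp
      moreover have "perm_class n u = D" using Cons.prems(2)[of D u] D u by simp
      ultimately show ?thesis using memC[OF v] by (simp add: Lyn_less_def)
    qed
    ultimately show ?case using Cons C by (auto simp: sorted_wrt_append)
  qed simp
qed


text \<open>Both orders are asymmetric, so sortedness excludes repetitions: \<open>ws\<close> and
  \<open>Cs\<close> enumerate the Lyndon words and the permutation classes once each.\<close>

theorem corollary7p2:
  fixes p n :: nat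
    and S :: "'s monoid" and T :: "'s topology"
    and \<iota> :: "'x::{finite, linorder} \<Rightarrow> 's"
    and ws :: "'x list list" and Cs :: "'x list set list"
  assumes "prime p" and "n \<ge> 2"
    and "free_profinite_group S T \<iota>"
    and "set ws = Lyn n" and "sorted_wrt (Lyn_less n) ws"
    and "set Cs = perm_class n ` Lyn n" and "sorted_wrt perm_class_less Cs"
  shows "pairing_mat S T \<iota> p n ws =
           diag_block_mat (map (\<lambda>C. pairing_mat S T \<iota> p n (sorted_list_of_set C)) Cs) \<and>
         (\<forall>C \<in> set Cs. unipotent_upper_triangular (pairing_mat S T \<iota> p n (sorted_list_of_set C)))"
proof -
  define F where "F w z = transgression_pairing S T p n (sigma S \<iota> p n w) (alpha S T \<iota> p n z)" for w z
  have F: "F w z = (if length z = length w then coeff (ntau w - 1) z mod int p else 0)"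
    if "w \<in> Lyn n" "z \<in> Lyn n" for w z
    unfolding F_def by (rule pairing_sigma_alpha[OF assms(1-3) that])
  \<comment> \<open>In the leading degree the expansion at w contains only rearrangements of w that
    are at least w. The first alternative separates the classes, the second gives the zeros below
    the diagonal.\<close>
  have F_zero: "F w z = 0" if wz: "w \<in> Lyn n" "z \<in> Lyn n" and "mset z \<noteq> mset w \<or> z < w" for w z
  proof -
    have "lyndon w" using wz by (simp add: Lyn_def)
    then have "length z = length w \<Longrightarrow> coeff (ntau w - 1) z = 0"
      using ntau_leading[of w] that(3) leD by blast
    then show ?thesis using F[OF wz] by simp
  qed
  have F_one: "F w w = 1" if "w \<in> Lyn n" for w
  proof -
    have "lyndon w" using that by (simp add: Lyn_def)
    then have "coeff (ntau w - 1) w = 1" using ntau_leading by blast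
    then show ?thesis using F[OF that that] prime_gt_1_nat[OF assms(1)] by simp
  qed
  have mat: "pairing_mat S T \<iota> p n zs = mat (length zs) (length zs) (\<lambda>(i, j). F (zs ! i) (zs ! j))" for zs
    by (simp add: pairing_mat_def F_def)
  have fin: "finite C" and sub: "C \<subseteq> Lyn n" if "C \<in> set Cs" for C
    using that finite_Lyn[of n, where ?'x = 'x] unfolding assms(6) by (auto simp: perm_class_def)
  have blocks: "F x y = 0 \<and> F y x = 0"
    if "C \<in> set Cs" "D \<in> set Cs" "C \<noteq> D" "x \<in> C" "y \<in> D" for C D x y
  proof -
    have "C = perm_class n x" "D = perm_class n y"
      using that perm_class_eq unfolding assms(6) by blast+
    then have "mset x \<noteq> mset y" using that(3) by (auto simp: perm_class_def)
    then show ?thesis using F_zero that sub by (metis subsetD)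
  qed
  have "sorted_wrt (\<lambda>C D. C \<noteq> D) Cs"
    by (rule sorted_wrt_mono_rel[OF _ assms(7)]) (use perm_class_less_asym in blast)
  \<comment> \<open>Membership in \<open>Cs\<close> is carried along with distinctness, since the
    vanishing between blocks is known for classes of the list only.\<close>
  then have "sorted_wrt (\<lambda>C D. C \<in> set Cs \<and> D \<in> set Cs \<and> C \<noteq> D) Cs"
    by (rule sorted_wrt_mono_rel[rotated]) blast
  then have "sorted_wrt (\<lambda>C D. \<forall>x\<in>set (sorted_list_of_set C). \<forall>y\<in>set (sorted_list_of_set D). F x y = 0 \<and> F y x = 0) Cs"
    by (rule sorted_wrt_mono_rel[rotated]) (use blocks fin in auto)
  then have "mat (length (concat (map sorted_list_of_set Cs))) (length (concat (map sorted_list_of_set Cs)))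
      (\<lambda>(i, j). F (concat (map sorted_list_of_set Cs) ! i) (concat (map sorted_list_of_set Cs) ! j)) =
    diag_block_mat (map (\<lambda>zs. mat (length zs) (length zs) (\<lambda>(i, j). F (zs ! i) (zs ! j)))
      (map sorted_list_of_set Cs))"
    by (intro mat_concat_diag_block) (simp add: sorted_wrt_map)
  then have "pairing_mat S T \<iota> p n ws =
      diag_block_mat (map (\<lambda>C. pairing_mat S T \<iota> p n (sorted_list_of_set C)) Cs)"
    unfolding Lyn_order_concat[OF assms(4-7)] mat by (simp add: o_def)
  moreover have "unipotent_upper_triangular (pairing_mat S T \<iota> p n (sorted_list_of_set C))"
    if C: "C \<in> set Cs" for C
  proof -
    let ?l = "sorted_list_of_set C"
    have l: "?l ! i \<in> Lyn n" if "i < length ?l" for i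
      using nth_mem[OF that] fin[OF C] sub[OF C] by auto
    have "F (?l ! i) (?l ! j) = 0" if "i < length ?l" "j < i" for i j
    proof -
      have "?l ! j < ?l ! i"
        using that strict_sorted_list_of_set[of C] by (simp add: sorted_wrt_nth_less)
      then show ?thesis using F_zero l that by simp
    qed
    then show ?thesis
      unfolding unipotent_upper_triangular_def mat using F_one l by (auto simp: upper_triangular_def)
  qed
  ultimately show ?thesis by blast
qed

end
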